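(* Let $(M,g,\mathcal V,\mathcal F)$ be a non-degenerate second order conformally superintegrable system on a surface ($\dim M=2$), with conformal structure tensor $S_{ijk}$, function $t$ (with $t_i=\nabla_i t$) and secondary structure tensor $\tau_{ij}$ (all defined in the context), and let $\Xi_{ij}=(\nabla^a+\tfrac23t^a)S_{ija}$, which is a conformal invariant. Then the following prolongation holds: \begin{align*} \nabla_lS_{ijk}&=\tfrac16\,\mathrm{Sym}^\circ_{ijk}\Bigl[-\tfrac23S_{ijk}t_l+2t_iS_{jkl}+\Xi_{ij}g_{kl}\Bigr],\\ \nabla_k\Xi_{ij}&=\tfrac13S_{ijk}\,S^{abc}S_{abc}-\tfrac29\,\mathrm{Sym}_{ijk}\Bigl(\Xi_{jk}t_i-\tfrac12g_{ij}\Xi_{ka}t^a\Bigr)+\tfrac23\,\mathrm{Sym}^\circ_{ij}\bigl(g_{jk}S_{iab}\Xi^{ab}\bigr),\\ \nabla^a\tau_{ak}&=-S_{kab}\tau^{ab}+S_{kab}\Xi^{ab}-\tfrac23\Xi_{ka}t^a-\tfrac49S_{kab}t^at^b-\tfrac59S_{abc}S^{abc}t_k+\tfrac12\nabla_kR-Rt_k,\\ \nabla^2_{ij}t&=\tfrac32\Bigl[\tau_{ij}+\tfrac23S_{ija}t^a+\tfrac49\,\mathrm{Sym}^\circ_{ij}(t_it_j)+\tfrac13\Xi_{ij}\Bigr]+\tfrac12g_{ij}\Bigl[\tfrac13S^{abc}S_{abc}+\tfrac32R\Bigr]. \end{align*}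
   Context: All objects are smooth, real and local. $(M,g)$ is a surface with Riemannian metric, $\nabla$ its Levi-Civita connection, a comma denotes covariant differentiation, indices are raised and lowered with $g$, $\Delta=\nabla^a\nabla_a$, and $R$ is the scalar curvature (twice the Gauss curvature). Symmetrisers: $\mathrm{Sym}_{ij}X_{ij}=X_{ij}+X_{ji}$; $\mathrm{Sym}_{ijk}$ is the sum over all 6 permutations of $(i,j,k)$; the superscript $\circ$ means that the result is additionally projected onto its completely trace-free part in the indicated indices, e.g. $\mathrm{Sym}^\circ_{ij}X_{ij}=X_{ij}+X_{ji}-g_{ij}X^a{}_a$. Indices not listed in the symmetriser are spectators. Conformal integrals: for a Hamiltonian $H=g^{ij}p_ip_j+V$ on $T^*M$, a second order conformal integral is a function $F=C^{ij}p_ip_j+W$ ($C^{ij}$ symmetric, $C^{ij},W$ depending only on position) with $\{F,H\}=\rho H$ for some $\rho$ linear in momenta. Then $C_{ij}$ is a conformal Killing tensor (the trace-free part of the symmetrised $\nabla_kC_{ij}$ vanishes); modulo multiples of $H$ by functions, $C$ may be and is taken trace-free, except for the integral $H$ itself. With $\rho_k=\frac12C^a{}_{k,a}$, compatibility with $V$ (Bertrand-Darboux condition) is that the antisymmetrisation in $(i,j)$ of $C^a{}_iV_{,ja}+C^a{}_{i,j}V_{,a}-V_{,i}\rho_j-V\rho_{i,j}$ vanishes. Non-degenerate system: a quadruple $(M,g,\mathcal V,\mathcal F)$ where $\mathcal F$ is a 3-dimensional space of second order conformal integrals spanned by $H$ and two further ones, all three functionally independent, whose trace-free conformal Killing tensors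 form an irreducible set of endomorphisms (irreducibility), $\mathcal V$ is a 4-dimensional linear space of functions, and for every $V\in\mathcal V$ the Bertrand-Darboux condition holds for all integrals in $\mathcal F$, and $$V_{,ij}=T_{ij}{}^kV_{,k}+\tfrac12g_{ij}\Delta V+\tau_{ij}V$$ with tensors $T_{ijk}$ and $\tau_{ij}$ independent of $V$. These are unique, $T_{ijk}$ is symmetric and trace-free in $(i,j)$, and $\tau_{ij}$ is symmetric and trace-free. $T$ is the primary and $\tau$ the secondary structure tensor. One has $$T_{ijk}=S_{ijk}+t_ig_{jk}+t_jg_{ik}-g_{ij}t_k,$$ where $S_{ijk}$ (the conformal structure tensor) is totally symmetric and trace-free and $t_i=\frac12T_{ai}{}^a=\nabla_it$ for a function $t$, unique up to an additive constant. Conformal invariance of $\Xi_{ij}$ means that it is unchanged under conformal transformations $g\mapsto\Omega^2g$, $V\mapsto\Omega^{-2}V$ of the system, under which $S_{ijk}\mapsto\Omega^2S_{ijk}$ and $t\mapsto t-3\ln|\Omega|$.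
   Formalization: Signs corrected: the coefficient -2/9 in the equation for ∇Ξ becomes +2/9, the term +1/3 Ξ_ij in the Hessian of t becomes -1/3 Ξ_ij, and -Vρ_{i,j} in the Bertrand-Darboux condition becomes +Vρ_{i,j}; as printed the equations fail for the Smorodinsky-Winternitz system. *)

theory Defs
  imports "HOL-Analysis.Analysis"
begin

text \<open>
  Everything is local: the surface \<open>M\<close> is a non-empty connected open subset \<open>U\<close> of the plane, i.e. a
  coordinate domain.  A tensor field is given by its coordinate components.  Unless said otherwise
  components carry lower indices, and raising is done explicitly with the inverse metric.
  Only values on \<open>U\<close> matter.
\<close>

type_synonym pt = "real^2"
type_synonym tensor1 = "pt \<Rightarrow> 2 \<Rightarrow> real"
type_synonym tensor2 = "pt \<Rightarrow> 2 \<Rightarrow> 2 \<Rightarrow> real"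
type_synonym tensor3 = "pt \<Rightarrow> 2 \<Rightarrow> 2 \<Rightarrow> 2 \<Rightarrow> real"
type_synonym metric = "pt \<Rightarrow> real^2^2"
type_synonym phase_fun = "pt \<times> pt \<Rightarrow> real"


section \<open>Riemannian geometry in coordinates\<close>

definition pd :: "2 \<Rightarrow> (pt \<Rightarrow> real) \<Rightarrow> pt \<Rightarrow> real" where
  "pd i f x = frechet_derivative f (at x) (axis i 1)"

primrec Ck_on :: "nat \<Rightarrow> pt set \<Rightarrow> (pt \<Rightarrow> real) \<Rightarrow> bool" where
  "Ck_on 0 U f = continuous_on U f"
| "Ck_on (Suc k) U f = ((\<forall>x\<in>U. f differentiable (at x)) \<and> (\<forall>i. Ck_on k U (pd i f)))"

definition smooth_on :: "pt set \<Rightarrow> (pt \<Rightarrow> real) \<Rightarrow> bool" where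
  "smooth_on U f \<longleftrightarrow> (\<forall>k. Ck_on k U f)"

definition riemannian_surface :: "pt set \<Rightarrow> metric \<Rightarrow> bool" where
  "riemannian_surface U g \<longleftrightarrow>
     open U \<and> connected U \<and> U \<noteq> {} \<and>
     (\<forall>i j. smooth_on U (\<lambda>x. g x $ i $ j)) \<and>
     (\<forall>x\<in>U. transpose (g x) = g x \<and> (\<forall>v. v \<noteq> 0 \<longrightarrow> v \<bullet> (g x *v v) > 0))"

definition ginv :: "metric \<Rightarrow> pt \<Rightarrow> 2 \<Rightarrow> 2 \<Rightarrow> real" where
  "ginv g x i j = matrix_inv (g x) $ i $ j"

definition christoffel :: "metric \<Rightarrow> pt \<Rightarrow> 2 \<Rightarrow> 2 \<Rightarrow> 2 \<Rightarrow> real" where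
  \<comment> \<open>\<open>christoffel g x k i j\<close> is \<open>\<Gamma>\<close> with upper index \<open>k\<close> and lower indices \<open>i\<close>, \<open>j\<close>\<close>
  "christoffel g x k i j = (\<Sum>l\<in>UNIV. ginv g x k l *
     (pd i (\<lambda>y. g y $ l $ j) x + pd j (\<lambda>y. g y $ l $ i) x - pd l (\<lambda>y. g y $ i $ j) x)) / 2"

text \<open>
  Covariant derivatives.  The index of the derivative always comes first:
  \<open>nabla3 g X x l i j k\<close> is \<open>\<nabla>\<^sub>l X\<^sub>i\<^sub>j\<^sub>k\<close>, in comma notation \<open>X\<^sub>i\<^sub>j\<^sub>k\<^sub>,\<^sub>l\<close>.
\<close>

definition grad :: "(pt \<Rightarrow> real) \<Rightarrow> tensor1" where
  "grad f x i = pd i f x"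

definition nabla1 :: "metric \<Rightarrow> tensor1 \<Rightarrow> tensor2" where
  "nabla1 g X x l i =
     pd l (\<lambda>y. X y i) x - (\<Sum>a\<in>UNIV. christoffel g x a l i * X x a)"

definition nabla2 :: "metric \<Rightarrow> tensor2 \<Rightarrow> tensor3" where
  "nabla2 g X x l i j =
     pd l (\<lambda>y. X y i j) x
     - (\<Sum>a\<in>UNIV. christoffel g x a l i * X x a j)
     - (\<Sum>a\<in>UNIV. christoffel g x a l j * X x i a)"

definition nabla3 :: "metric \<Rightarrow> tensor3 \<Rightarrow> pt \<Rightarrow> 2 \<Rightarrow> 2 \<Rightarrow> 2 \<Rightarrow> 2 \<Rightarrow> real" where
  "nabla3 g X x l i j k =
     pd l (\<lambda>y. X y i j k) x
     - (\<Sum>a\<in>UNIV. christoffel g x a l i * X x a j k)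
     - (\<Sum>a\<in>UNIV. christoffel g x a l j * X x i a k)
     - (\<Sum>a\<in>UNIV. christoffel g x a l k * X x i j a)"

definition hess :: "metric \<Rightarrow> (pt \<Rightarrow> real) \<Rightarrow> tensor2" where
  "hess g f = nabla1 g (grad f)"

definition laplacian :: "metric \<Rightarrow> (pt \<Rightarrow> real) \<Rightarrow> pt \<Rightarrow> real" where
  "laplacian g f x = (\<Sum>a\<in>UNIV. \<Sum>b\<in>UNIV. ginv g x a b * hess g f x a b)"

definition riemann :: "metric \<Rightarrow> pt \<Rightarrow> 2 \<Rightarrow> 2 \<Rightarrow> 2 \<Rightarrow> 2 \<Rightarrow> real" where
  \<comment> \<open>\<open>riemann g x k l i j\<close>: upper index \<open>k\<close>; the \<open>k\<close>-component of
      \<open>\<nabla>\<^sub>i \<nabla>\<^sub>j \<partial>\<^sub>l - \<nabla>\<^sub>j \<nabla>\<^sub>i \<partial>\<^sub>l\<close>\<close>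
  "riemann g x k l i j =
     pd i (\<lambda>y. christoffel g y k j l) x - pd j (\<lambda>y. christoffel g y k i l) x
     + (\<Sum>m\<in>UNIV. christoffel g x k i m * christoffel g x m j l)
     - (\<Sum>m\<in>UNIV. christoffel g x k j m * christoffel g x m i l)"

definition ricci :: "metric \<Rightarrow> tensor2" where
  "ricci g x l j = (\<Sum>k\<in>UNIV. riemann g x k l k j)"

text \<open>With these signs the scalar curvature of the unit sphere is \<open>2\<close>.\<close>

definition scalar_curvature :: "metric \<Rightarrow> pt \<Rightarrow> real" where
  "scalar_curvature g x = (\<Sum>a\<in>UNIV. \<Sum>b\<in>UNIV. ginv g x a b * ricci g x a b)"

definition raise1 :: "metric \<Rightarrow> tensor1 \<Rightarrow> tensor1" where
  "raise1 g X x i = (\<Sum>a\<in>UNIV. ginv g x i a * X x a)"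

definition raise2 :: "metric \<Rightarrow> tensor2 \<Rightarrow> tensor2" where
  "raise2 g X x i j = (\<Sum>a\<in>UNIV. \<Sum>b\<in>UNIV. ginv g x i a * ginv g x j b * X x a b)"

definition raise3 :: "metric \<Rightarrow> tensor3 \<Rightarrow> tensor3" where
  "raise3 g X x i j k = (\<Sum>a\<in>UNIV. \<Sum>b\<in>UNIV. \<Sum>c\<in>UNIV.
     ginv g x i a * ginv g x j b * ginv g x k c * X x a b c)"


section \<open>Symmetrisers\<close>

text \<open>
  They act on arrays of components at a single point; \<open>G\<close> is the metric at that point.
  Spectator indices are parameters of the array.
\<close>

definition sym3 :: "(2 \<Rightarrow> 2 \<Rightarrow> 2 \<Rightarrow> real) \<Rightarrow> 2 \<Rightarrow> 2 \<Rightarrow> 2 \<Rightarrow> real" where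
  "sym3 X i j k = X i j k + X i k j + X j i k + X j k i + X k i j + X k j i"

definition sym2_tracefree :: "real^2^2 \<Rightarrow> (2 \<Rightarrow> 2 \<Rightarrow> real) \<Rightarrow> 2 \<Rightarrow> 2 \<Rightarrow> real" where
  "sym2_tracefree G X i j =
     X i j + X j i - G $ i $ j * (\<Sum>a\<in>UNIV. \<Sum>b\<in>UNIV. matrix_inv G $ a $ b * X a b)"

text \<open>
  In dimension \<open>n\<close> the trace-free part of a totally symmetric \<open>Y\<^sub>i\<^sub>j\<^sub>k\<close> with trace \<open>y\<^sub>k\<close> is
  \<open>Y\<^sub>i\<^sub>j\<^sub>k - (g\<^sub>i\<^sub>j y\<^sub>k + g\<^sub>j\<^sub>k y\<^sub>i + g\<^sub>k\<^sub>i y\<^sub>j) / (n + 2)\<close>; here \<open>n = 2\<close>.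
\<close>

definition sym3_tracefree ::
    "real^2^2 \<Rightarrow> (2 \<Rightarrow> 2 \<Rightarrow> 2 \<Rightarrow> real) \<Rightarrow> 2 \<Rightarrow> 2 \<Rightarrow> 2 \<Rightarrow> real" where
  "sym3_tracefree G X i j k =
     (let y = (\<lambda>l. \<Sum>a\<in>UNIV. \<Sum>b\<in>UNIV. matrix_inv G $ a $ b * sym3 X a b l)
      in sym3 X i j k - (G $ i $ j * y k + G $ j $ k * y i + G $ k $ i * y j) / 4)"


section \<open>Conformal integrals\<close>

definition poisson :: "phase_fun \<Rightarrow> phase_fun \<Rightarrow> phase_fun" where
  "poisson F G z = (\<Sum>i\<in>UNIV.
      frechet_derivative F (at z) (axis i 1, 0) * frechet_derivative G (at z) (0, axis i 1)
    - frechet_derivative F (at z) (0, axis i 1) * frechet_derivative G (at z) (axis i 1, 0))"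

text \<open>
  The phase space function \<open>C\<^sup>i\<^sup>j p\<^sub>i p\<^sub>j + W\<close>.  Here (and wherever it has type
  \<open>pt \<Rightarrow> real^2^2\<close>) \<open>C\<close> carries upper indices.
\<close>

definition quadratic :: "(pt \<Rightarrow> real^2^2) \<Rightarrow> (pt \<Rightarrow> real) \<Rightarrow> phase_fun" where
  "quadratic C W = (\<lambda>(x, p). p \<bullet> (C x *v p) + W x)"

definition hamiltonian :: "metric \<Rightarrow> (pt \<Rightarrow> real) \<Rightarrow> phase_fun" where
  "hamiltonian g V = quadratic (\<lambda>x. matrix_inv (g x)) V"

definition conformal_integral ::
    "pt set \<Rightarrow> phase_fun \<Rightarrow> (pt \<Rightarrow> real^2^2) \<Rightarrow> (pt \<Rightarrow> real) \<Rightarrow> bool" where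
  "conformal_integral U H C W \<longleftrightarrow>
     (\<forall>i j. smooth_on U (\<lambda>x. C x $ i $ j)) \<and> smooth_on U W \<and>
     (\<forall>x\<in>U. transpose (C x) = C x) \<and>
     (\<exists>\<rho> :: pt \<Rightarrow> real^2. \<forall>x\<in>U. \<forall>p.
        poisson (quadratic C W) H (x, p) = (\<rho> x \<bullet> p) * H (x, p))"

definition lower2 :: "metric \<Rightarrow> (pt \<Rightarrow> real^2^2) \<Rightarrow> tensor2" where
  "lower2 g C x i j = (g x ** C x ** g x) $ i $ j"

text \<open>\<open>\<rho>\<^sub>k = C\<^sup>a\<^sub>k\<^sub>,\<^sub>a / 2\<close>\<close>

definition bd_rho :: "metric \<Rightarrow> (pt \<Rightarrow> real^2^2) \<Rightarrow> tensor1" where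
  "bd_rho g C x k =
     (\<Sum>a\<in>UNIV. \<Sum>b\<in>UNIV. ginv g x a b * nabla2 g (lower2 g C) x a b k) / 2"

text \<open>
  For trace-free \<open>C\<close>, \<open>C\<^sup>i\<^sup>jp\<^sub>ip\<^sub>j + W\<close> being a conformal integral of \<open>g\<^sup>i\<^sup>jp\<^sub>ip\<^sub>j + V\<close> forces
  \<open>W\<^sub>,\<^sub>i = C\<^sup>a\<^sub>i V\<^sub>,\<^sub>a + V \<rho>\<^sub>i\<close> with \<open>\<rho>\<^sub>i\<close> as above (half the factor in \<open>{F, H}\<close>).  The
  Bertrand-Darboux condition is the closedness of the right hand side, i.e. the vanishing of the
  antisymmetric part of the following expression.  Note that modulo terms symmetric in \<open>i\<close>, \<open>j\<close>
  the last two terms are \<open>V\<^sub>,\<^sub>j \<rho>\<^sub>i + V \<rho>\<^sub>i\<^sub>,\<^sub>j\<close>, as well as \<open>- V\<^sub>,\<^sub>i \<rho>\<^sub>j - V \<rho>\<^sub>j\<^sub>,\<^sub>i\<close>.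
\<close>

definition bd_expr :: "metric \<Rightarrow> (pt \<Rightarrow> real^2^2) \<Rightarrow> (pt \<Rightarrow> real) \<Rightarrow> tensor2" where
  "bd_expr g C V x i j =
     (\<Sum>a\<in>UNIV. \<Sum>b\<in>UNIV. ginv g x a b * lower2 g C x b i * hess g V x a j)
     + (\<Sum>a\<in>UNIV. \<Sum>b\<in>UNIV. ginv g x a b * nabla2 g (lower2 g C) x j b i * pd a V x)
     - pd i V x * bd_rho g C x j
     + V x * nabla1 g (bd_rho g C) x j i"

definition bertrand_darboux ::
    "pt set \<Rightarrow> metric \<Rightarrow> (pt \<Rightarrow> real^2^2) \<Rightarrow> (pt \<Rightarrow> real) \<Rightarrow> bool" where
  "bertrand_darboux U g C V \<longleftrightarrow>
     (\<forall>x\<in>U. \<forall>i j. bd_expr g C V x i j - bd_expr g C V x j i = 0)"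


section \<open>Non-degenerate systems\<close>

text \<open>
  \<open>\<V>\<close> is an \<open>n\<close>-dimensional linear space of functions on \<open>D\<close> with basis \<open>B 0, \<dots>, B (n - 1)\<close>.
  Functions on \<open>D\<close> are total functions considered up to their values outside \<open>D\<close>.
\<close>

definition basis_on :: "'a set \<Rightarrow> nat \<Rightarrow> (nat \<Rightarrow> 'a \<Rightarrow> real) \<Rightarrow> ('a \<Rightarrow> real) set \<Rightarrow> bool" where
  "basis_on D n B \<V> \<longleftrightarrow>
     (\<forall>c. (\<forall>z\<in>D. (\<Sum>m<n. c m * B m z) = 0) \<longrightarrow> (\<forall>m<n. c m = 0)) \<and>
     \<V> = {f. \<exists>c. \<forall>z\<in>D. f z = (\<Sum>m<n. c m * B m z)}"

text \<open>The differentials are linearly independent on a dense subset of \<open>D\<close>.\<close>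

definition functionally_independent :: "(pt \<times> pt) set \<Rightarrow> nat \<Rightarrow> (nat \<Rightarrow> phase_fun) \<Rightarrow> bool" where
  "functionally_independent D n F \<longleftrightarrow>
     D \<subseteq> closure {z \<in> D. \<forall>c.
       (\<forall>v. (\<Sum>m<n. c m * frechet_derivative (F m) (at z) v) = 0) \<longrightarrow> (\<forall>m<n. c m = 0)}"

definition irreducible_endomorphisms :: "(real^2^2) set \<Rightarrow> bool" where
  "irreducible_endomorphisms \<A> \<longleftrightarrow>
     (\<forall>L. subspace L \<and> (\<forall>A\<in>\<A>. (\<lambda>v. A *v v) ` L \<subseteq> L) \<longrightarrow> L = {0} \<or> L = UNIV)"

definition structure_tensors ::
    "pt set \<Rightarrow> metric \<Rightarrow> (pt \<Rightarrow> real) set \<Rightarrow> tensor3 \<Rightarrow> tensor2 \<Rightarrow> bool" where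
  "structure_tensors U g \<V> T \<tau> \<longleftrightarrow>
     (\<forall>i j k. smooth_on U (\<lambda>x. T x i j k)) \<and>
     (\<forall>i j. smooth_on U (\<lambda>x. \<tau> x i j)) \<and>
     (\<forall>x\<in>U. \<forall>i j k. T x i j k = T x j i k) \<and>
     (\<forall>x\<in>U. \<forall>k. (\<Sum>a\<in>UNIV. \<Sum>b\<in>UNIV. ginv g x a b * T x a b k) = 0) \<and>
     (\<forall>x\<in>U. \<forall>i j. \<tau> x i j = \<tau> x j i) \<and>
     (\<forall>x\<in>U. (\<Sum>a\<in>UNIV. \<Sum>b\<in>UNIV. ginv g x a b * \<tau> x a b) = 0) \<and>
     (\<forall>V\<in>\<V>. \<forall>x\<in>U. \<forall>i j.
        hess g V x i j =
          (\<Sum>k\<in>UNIV. T x i j k * raise1 g (grad V) x k)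
          + g x $ i $ j * laplacian g V x / 2
          + \<tau> x i j * V x)"

text \<open>
  The integrals are \<open>F\<^sub>m = C\<^sub>m\<^sup>i\<^sup>j p\<^sub>i p\<^sub>j + W\<^sub>m\<close> for \<open>m = 0, 1, 2\<close>, where \<open>F\<^sub>0 = H\<close>.  The endomorphism
  belonging to \<open>C\<close> is \<open>C\<^sup>i\<^sup>a g\<^sub>a\<^sub>j\<close>, whose matrix is \<open>C x ** g x\<close>.  The Bertrand-Darboux condition is
  linear in \<open>C\<close>, so it holds for all integrals in \<open>\<F>\<close> iff it holds for the \<open>F\<^sub>m\<close>.
\<close>

definition nondegenerate_system ::
    "pt set \<Rightarrow> metric \<Rightarrow> (pt \<Rightarrow> real) set \<Rightarrow> phase_fun set \<Rightarrow> bool" where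
  "nondegenerate_system U g \<V> \<F> \<longleftrightarrow>
     riemannian_surface U g \<and>
     (\<exists>B. basis_on U 4 B \<V>) \<and> (\<forall>V\<in>\<V>. smooth_on U V) \<and>
     (\<exists>C W H.
        C 0 = (\<lambda>x. matrix_inv (g x)) \<and> H = hamiltonian g (W 0) \<and>
        (\<forall>m<3. conformal_integral U H (C m) (W m)) \<and>
        (\<forall>x\<in>U. trace (C 1 x ** g x) = 0 \<and> trace (C 2 x ** g x) = 0) \<and>
        basis_on (U \<times> UNIV) 3 (\<lambda>m. quadratic (C m) (W m)) \<F> \<and>
        functionally_independent (U \<times> UNIV) 3 (\<lambda>m. quadratic (C m) (W m)) \<and>
        (\<forall>x\<in>U. irreducible_endomorphisms {C 1 x ** g x, C 2 x ** g x}) \<and>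
        (\<forall>V\<in>\<V>. \<forall>m<3. bertrand_darboux U g (C m) V)) \<and>
     (\<exists>T \<tau>. structure_tensors U g \<V> T \<tau>)"

text \<open>
  \<open>S\<close> is the conformal structure tensor and \<open>t\<close> a potential of \<open>t\<^sub>i = T\<^sub>a\<^sub>i\<^sup>a / 2\<close>, for the primary
  structure tensor \<open>T\<close>.
\<close>

definition conformal_structure ::
    "pt set \<Rightarrow> metric \<Rightarrow> tensor3 \<Rightarrow> tensor3 \<Rightarrow> (pt \<Rightarrow> real) \<Rightarrow> bool" where
  "conformal_structure U g T S t \<longleftrightarrow>
     smooth_on U t \<and>
     (\<forall>x\<in>U. \<forall>i. pd i t x = (\<Sum>a\<in>UNIV. \<Sum>b\<in>UNIV. ginv g x a b * T x a i b) / 2) \<and>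
     (\<forall>i j k. smooth_on U (\<lambda>x. S x i j k)) \<and>
     (\<forall>x\<in>U. \<forall>i j k. S x i j k = S x j i k \<and> S x i j k = S x i k j) \<and>
     (\<forall>x\<in>U. \<forall>k. (\<Sum>a\<in>UNIV. \<Sum>b\<in>UNIV. ginv g x a b * S x a b k) = 0) \<and>
     (\<forall>x\<in>U. \<forall>i j k. T x i j k =
        S x i j k + pd i t x * g x $ j $ k + pd j t x * g x $ i $ k - g x $ i $ j * pd k t x)"

definition Xi :: "metric \<Rightarrow> tensor3 \<Rightarrow> (pt \<Rightarrow> real) \<Rightarrow> tensor2" where
  "Xi g S t x i j = (\<Sum>a\<in>UNIV. \<Sum>b\<in>UNIV.
     ginv g x a b * (nabla3 g S x b i j a + 2/3 * pd b t x * S x i j a))"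

text \<open>
  A conformal transformation \<open>g \<mapsto> \<Omega>\<^sup>2 g\<close>, \<open>V \<mapsto> \<Omega>\<^sup>-\<^sup>2 V\<close> of the system leaves the \<open>C\<^sup>i\<^sup>j\<close> and \<open>W\<close> of
  the integrals other than \<open>H\<close> unchanged; the structure tensors depend on \<open>g\<close> and \<open>\<V>\<close> only.

  A check of signs: for the flat metric and the potentials \<open>a (x\<^sup>2 + y\<^sup>2) + b/x\<^sup>2 + c/y\<^sup>2 + d\<close> one has
  \<open>\<tau> = 0\<close>, \<open>t = - 3/4 ln (x y)\<close>, \<open>S\<^sub>x\<^sub>x\<^sub>x = - 3/(4x)\<close>, \<open>S\<^sub>y\<^sub>y\<^sub>y = - 3/(4y)\<close>,
  \<open>\<Xi>\<^sub>x\<^sub>x = 9/8 (1/x\<^sup>2 - 1/y\<^sup>2)\<close>, \<open>\<Xi>\<^sub>x\<^sub>y = - 3/(4xy)\<close>.  This forces the terms \<open>+ 2/9 Sym(\<dots>)\<close> in the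
  derivative of \<open>\<Xi>\<close> and \<open>- 1/3 \<Xi>\<close> in the Hessian of \<open>t\<close>; the opposite signs fail here.
\<close>

definition conf_metric :: "(pt \<Rightarrow> real) \<Rightarrow> metric \<Rightarrow> metric" where
  "conf_metric \<Omega> g x = (\<Omega> x)\<^sup>2 *\<^sub>R g x"

definition conf_potentials :: "pt set \<Rightarrow> (pt \<Rightarrow> real) \<Rightarrow> (pt \<Rightarrow> real) set \<Rightarrow> (pt \<Rightarrow> real) set" where
  "conf_potentials U \<Omega> \<V> = {V'. \<exists>V\<in>\<V>. \<forall>x\<in>U. V' x = V x / (\<Omega> x)\<^sup>2}"

end

theory Submission
  imports Defs
begin

text \<open>
  Contracting all tensors with a complex null frame \<open>m\<close>, \<open>g(m,m) = 0\<close>, \<open>g(m,m\<bar>) = 2\<close>, turns a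
  symmetric trace-free tensor into one complex function and covariant differentiation into two weighted
  operators \<open>eth\<close> and \<open>ethb\<close> with \<open>[eth, ethb] = - s R\<close> on weight \<open>s\<close>.

  The equation for the potentials closes up to a linear system for \<open>(V, dV, \<Delta>V)\<close>.  As \<open>\<V>\<close> is
  four-dimensional and \<open>U\<close> is connected, these data can be prescribed at a point, so that every linear relation
  between them splits into its coefficients.  The \<open>dV\<close>-coefficient of the Bertrand-Darboux condition then
  expresses the divergence of a trace-free conformal Killing tensor \<open>C\<close> by \<open>C\<close> itself.  By irreducibility the two
  tensors are linearly independent at each point, and the integrability condition of this system for \<open>C\<close>,
  together with the \<open>V\<close>-coefficient of the Bertrand-Darboux condition, yields the derivative of \<open>S\<close> and the
  Hessian of \<open>t\<close>.  The commutator applied to \<open>S\<close> and to \<open>dt\<close>, and the integrability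
  condition for \<open>\<Delta>V\<close>, give the remaining two equations.
\<close>

section \<open>Partial derivatives and smooth functions\<close>

text \<open>In dimension two a symmetric trace-free tensor has one independent complex frame
  component, so \<open>S\<close>, \<open>\<tau>\<close>, \<open>\<Xi>\<close>, \<open>C\<close> and
  \<open>dt\<close> are carried by \<open>sg\<close>, \<open>th\<close>, \<open>xi\<close>,
  \<open>c\<close> and \<open>p\<close>. As g(m,mb) = 2, raising an index contributes a factor 1/2;
  this is the source of most powers of two below. Prescribing the data of a potential at a point
  looks like an existence theorem for an overdetermined system. Uniqueness suffices: evaluation at a
  point is a linear map between real spaces of dimension four, so injectivity gives surjectivity.
  Relations are split by reality: if \<open>b\<close> stands for the complex component of dV, then A
  b + B cnj b is real for all \<open>b\<close> exactly when B = cnj A. One real condition on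
  potentials thus yields a complex equation on structure tensors. The divergences of
  \<open>\<Xi>\<close> and \<open>\<tau>\<close> cannot be found one after the other. The commutator
  on dt and the condition for \<Delta>V give two different combinations of them, and both come from
  solving a linear system of two equations.\<close>

lemma pd_has_derivative: "(f has_derivative f') (at x) \<Longrightarrow> pd i f x = f' (axis i 1)"
  unfolding pd_def by (metis frechet_derivative_at)

text \<open>At a point of the open set both functions have the same derivatives, so the choice
  inside \<open>frechet_derivative\<close> picks the same value even where no derivative
  exists.\<close>

lemma pd_cong:
  assumes "open U" "x \<in> U" "\<And>y. y \<in> U \<Longrightarrow> f y = g y"
  shows "pd i f x = pd i g x"
proof -
  have "(f has_derivative f') (at x) \<longleftrightarrow> (g has_derivative f') (at x)" for f'
    using has_derivative_transform_within_open[of f f' x UNIV U g]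
      has_derivative_transform_within_open[of g f' x UNIV U f] assms by auto
  then show ?thesis
    by (simp add: pd_def frechet_derivative_def)
qed

lemma differentiable_cong_open:
  assumes "open U" "x \<in> U" "\<And>y. y \<in> U \<Longrightarrow> f y = g y" "f differentiable (at x)"
  shows "g differentiable (at x)"
  using has_derivative_transform_within_open[of f _ x UNIV U g] assms
  unfolding differentiable_def by blast

lemma pd_const [simp]: "pd i (\<lambda>x. c) x = 0"
  by (simp add: pd_def)

lemma pd_add:
  assumes "f differentiable (at x)" "g differentiable (at x)"
  shows "pd i (\<lambda>y. f y + g y) x = pd i f x + pd i g x"
proof -
  note * = assms[unfolded frechet_derivative_works]
  show ?thesis
    using pd_has_derivative[OF has_derivative_add[OF *]] by (simp add: pd_def)
qed

lemma pd_diff: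
  assumes "f differentiable (at x)" "g differentiable (at x)"
  shows "pd i (\<lambda>y. f y - g y) x = pd i f x - pd i g x"
proof -
  note * = assms[unfolded frechet_derivative_works]
  show ?thesis
    using pd_has_derivative[OF has_derivative_diff[OF *]] by (simp add: pd_def)
qed

lemma pd_minus:
  assumes "f differentiable (at x)"
  shows "pd i (\<lambda>y. - f y) x = - pd i f x"
proof -
  note * = assms[unfolded frechet_derivative_works]
  show ?thesis
    using pd_has_derivative[OF has_derivative_minus[OF *]] by (simp add: pd_def)
qed

lemma pd_mult:
  assumes "f differentiable (at x)" "g differentiable (at x)"
  shows "pd i (\<lambda>y. f y * g y) x = pd i f x * g x + f x * pd i g x"
proof -
  note * = assms[unfolded frechet_derivative_works]
  show ?thesis
    using pd_has_derivative[OF has_derivative_mult[OF *]] by (simp add: pd_def)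
qed

lemma pd_inverse:
  assumes "f differentiable (at x)" "f x \<noteq> 0"
  shows "pd i (\<lambda>y. inverse (f y)) x = - (pd i f x * (inverse (f x) * inverse (f x)))"
proof -
  note * = assms(1)[unfolded frechet_derivative_works]
  show ?thesis
    using pd_has_derivative[OF Deriv.has_derivative_inverse[OF assms(2) *]] by (simp add: pd_def)
qed

lemma pd_sqrt:
  assumes "f differentiable (at x)" "f x > 0"
  shows "pd i (\<lambda>y. sqrt (f y)) x = pd i f x * inverse (2 * sqrt (f x))"
proof -
  note * = assms(1)[unfolded frechet_derivative_works]
  show ?thesis
    using pd_has_derivative[OF has_derivative_real_sqrt[OF assms(2) *]]
    by (simp add: pd_def field_simps)
qed

lemma differentiable_sqrt:
  fixes f :: "pt \<Rightarrow> real"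
  assumes "f differentiable (at x)" "f x > 0"
  shows "(\<lambda>y. sqrt (f y)) differentiable (at x)"
  using has_derivative_real_sqrt[OF assms(2) assms(1)[unfolded frechet_derivative_works]]
  by (auto simp: differentiable_def)

text \<open>The closure rules below know the formula for \<open>pd\<close> of a compound function
  only at points of \<open>U\<close>; this lemma carries each such formula into the
  induction.\<close>

lemma Ck_on_cong:
  assumes "open U" "Ck_on k U f" "\<And>x. x \<in> U \<Longrightarrow> f x = g x"
  shows "Ck_on k U g"
  using assms(2,3)
proof (induction k arbitrary: f g)
  case 0
  then show ?case using continuous_on_cong by force
next
  case (Suc k)
  have "g differentiable (at x)" if "x \<in> U" for x
    using differentiable_cong_open[OF assms(1) that Suc.prems(2)] Suc.prems(1) that by auto
  moreover have "Ck_on k U (pd i g)" for i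
    by (rule Suc.IH[of "pd i f"]) (use Suc.prems pd_cong[OF assms(1) _ Suc.prems(2)] in auto)
  ultimately show ?case by simp
qed

lemma Ck_on_Suc_imp: "Ck_on (Suc k) U f \<Longrightarrow> Ck_on k U f"
proof (induction k arbitrary: f)
  case 0
  have "isCont f x" if "x \<in> U" for x
    by (rule differentiable_imp_continuous_within) (use 0 that in simp)
  then have "continuous_on U f"
    by (simp add: continuous_at_imp_continuous_on)
  then show ?case by simp
next
  case (Suc k)
  have "Ck_on k U (pd i f)" for i
    by (rule Suc.IH) (use Suc.prems in simp)
  with Suc.prems show ?case
    by (simp del: Ck_on.simps(1))
qed

lemma Ck_on_add: "open U \<Longrightarrow> Ck_on k U f \<Longrightarrow> Ck_on k U g \<Longrightarrow> Ck_on k U (\<lambda>x. f x + g x)"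
proof (induction k arbitrary: f g)
  case 0
  then show ?case by (auto intro: continuous_intros)
next
  case (Suc k)
  have "Ck_on k U (pd i (\<lambda>x. f x + g x))" for i
    by (rule Ck_on_cong[OF Suc.prems(1) Suc.IH[of "pd i f" "pd i g"]])
       (use Suc.prems in \<open>auto simp: pd_add\<close>)
  with Suc.prems show ?case by simp
qed

lemma Ck_on_minus: "open U \<Longrightarrow> Ck_on k U f \<Longrightarrow> Ck_on k U (\<lambda>x. - f x)"
proof (induction k arbitrary: f)
  case 0
  then show ?case by (auto intro: continuous_intros)
next
  case (Suc k)
  have "Ck_on k U (pd i (\<lambda>x. - f x))" for i
    by (rule Ck_on_cong[OF Suc.prems(1) Suc.IH[of "pd i f"]])
       (use Suc.prems in \<open>auto simp: pd_minus\<close>)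
  with Suc.prems show ?case by simp
qed

lemma Ck_on_mult: "open U \<Longrightarrow> Ck_on k U f \<Longrightarrow> Ck_on k U g \<Longrightarrow> Ck_on k U (\<lambda>x. f x * g x)"
proof (induction k arbitrary: f g)
  case 0
  then show ?case by (auto intro: continuous_intros)
next
  case (Suc k)
  have *: "Ck_on k U f" "Ck_on k U g"
    using Suc.prems Ck_on_Suc_imp by blast+
  have "Ck_on k U (pd i (\<lambda>x. f x * g x))" for i
    by (rule Ck_on_cong[OF Suc.prems(1) Ck_on_add[OF Suc.prems(1)
          Suc.IH[of "pd i f" g] Suc.IH[of f "pd i g"]]])
       (use Suc.prems * in \<open>auto simp: pd_mult\<close>)
  with Suc.prems show ?case by simp
qed

lemma Ck_on_const: "Ck_on k U (\<lambda>x. c)"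
proof (induction k arbitrary: c)
  case (Suc k)
  have "pd i (\<lambda>x. c) = (\<lambda>x. 0)" for i
    by (rule ext) simp
  with Suc show ?case by simp
qed auto

text \<open>The derivative is a product of \<open>pd i f\<close> and two factors
  \<open>inverse (f x)\<close>, so the induction hypothesis for the inverse itself covers
  it.\<close>

lemma Ck_on_inverse:
  "open U \<Longrightarrow> \<forall>x\<in>U. f x \<noteq> 0 \<Longrightarrow> Ck_on k U f \<Longrightarrow> Ck_on k U (\<lambda>x. inverse (f x))"
proof (induction k)
  case 0
  then show ?case by (auto intro: continuous_intros)
next
  case (Suc k)
  have *: "Ck_on k U (\<lambda>x. inverse (f x))"
    using Suc Ck_on_Suc_imp by blast
  have **: "Ck_on k U (pd i f)" for i
    using Suc.prems by simp
  have "Ck_on k U (pd i (\<lambda>x. inverse (f x)))" for i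
    by (rule Ck_on_cong[OF Suc.prems(1) Ck_on_minus[OF Suc.prems(1) Ck_on_mult[OF Suc.prems(1)
          **[of i] Ck_on_mult[OF Suc.prems(1) * *]]]])
       (use Suc.prems in \<open>auto simp: pd_inverse\<close>)
  with Suc.prems show ?case by simp
qed

lemma Ck_on_sqrt:
  "open U \<Longrightarrow> \<forall>x\<in>U. f x > 0 \<Longrightarrow> Ck_on k U f \<Longrightarrow> Ck_on k U (\<lambda>x. sqrt (f x))"
proof (induction k)
  case 0
  then show ?case by (auto intro: continuous_intros)
next
  case (Suc k)
  have *: "Ck_on k U (\<lambda>x. sqrt (f x))"
    using Suc Ck_on_Suc_imp by blast
  have 1: "Ck_on k U (\<lambda>x. inverse (2 * sqrt (f x)))"
    by (rule Ck_on_inverse[OF Suc.prems(1) _ Ck_on_mult[OF Suc.prems(1) Ck_on_const *]])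
       (use Suc.prems in force)
  have **: "Ck_on k U (pd i f)" for i
    using Suc.prems by simp
  have "Ck_on k U (pd i (\<lambda>x. sqrt (f x)))" for i
    by (rule Ck_on_cong[OF Suc.prems(1) Ck_on_mult[OF Suc.prems(1) **[of i] 1]])
       (use Suc.prems in \<open>auto simp: pd_sqrt\<close>)
  with Suc.prems show ?case by (simp add: differentiable_sqrt)
qed

lemma smooth_on_differentiable: "smooth_on U f \<Longrightarrow> x \<in> U \<Longrightarrow> f differentiable (at x)"
  unfolding smooth_on_def by (metis Ck_on.simps(2))

lemma smooth_on_pd: "smooth_on U f \<Longrightarrow> smooth_on U (pd i f)"
  unfolding smooth_on_def by (metis Ck_on.simps(2))

lemma smooth_on_continuous: "smooth_on U f \<Longrightarrow> continuous_on U f"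
  unfolding smooth_on_def by (metis Ck_on.simps(1))

lemma smooth_on_cong:
  "open U \<Longrightarrow> smooth_on U f \<Longrightarrow> (\<And>x. x \<in> U \<Longrightarrow> f x = g x) \<Longrightarrow> smooth_on U g"
  unfolding smooth_on_def using Ck_on_cong by blast

lemma smooth_on_const: "smooth_on U (\<lambda>x. c)"
  by (simp add: smooth_on_def Ck_on_const)

lemma smooth_on_add: "open U \<Longrightarrow> smooth_on U f \<Longrightarrow> smooth_on U g \<Longrightarrow> smooth_on U (\<lambda>x. f x + g x)"
  by (simp add: smooth_on_def Ck_on_add)

lemma smooth_on_minus: "open U \<Longrightarrow> smooth_on U f \<Longrightarrow> smooth_on U (\<lambda>x. - f x)"
  by (simp add: smooth_on_def Ck_on_minus)

lemma smooth_on_diff: "open U \<Longrightarrow> smooth_on U f \<Longrightarrow> smooth_on U g \<Longrightarrow> smooth_on U (\<lambda>x. f x - g x)"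
  using smooth_on_add[OF _ _ smooth_on_minus, of U f g] by simp

lemma smooth_on_mult: "open U \<Longrightarrow> smooth_on U f \<Longrightarrow> smooth_on U g \<Longrightarrow> smooth_on U (\<lambda>x. f x * g x)"
  by (simp add: smooth_on_def Ck_on_mult)

lemma smooth_on_inverse:
  "open U \<Longrightarrow> smooth_on U f \<Longrightarrow> (\<And>x. x \<in> U \<Longrightarrow> f x \<noteq> 0) \<Longrightarrow> smooth_on U (\<lambda>x. inverse (f x))"
  by (simp add: smooth_on_def Ck_on_inverse)

lemma smooth_on_divide:
  "open U \<Longrightarrow> smooth_on U f \<Longrightarrow> smooth_on U g \<Longrightarrow> (\<And>x. x \<in> U \<Longrightarrow> g x \<noteq> 0) \<Longrightarrow>
    smooth_on U (\<lambda>x. f x / g x)"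
  by (simp add: divide_inverse smooth_on_mult smooth_on_inverse)

lemma smooth_on_sqrt:
  "open U \<Longrightarrow> smooth_on U f \<Longrightarrow> (\<And>x. x \<in> U \<Longrightarrow> f x > 0) \<Longrightarrow> smooth_on U (\<lambda>x. sqrt (f x))"
  by (simp add: smooth_on_def Ck_on_sqrt)

lemma smooth_on_sum:
  "open U \<Longrightarrow> (\<And>i. i \<in> I \<Longrightarrow> smooth_on U (f i)) \<Longrightarrow> smooth_on U (\<lambda>x. \<Sum>i\<in>I. f i x)"
  by (induction I rule: infinite_finite_induct) (auto intro: smooth_on_const smooth_on_add)

lemmas smooth_on_intros = smooth_on_const smooth_on_add smooth_on_minus smooth_on_diff
  smooth_on_mult smooth_on_sum smooth_on_divide smooth_on_pd

section \<open>Equality of mixed second partial derivatives\<close>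

lemma pd_line:
  assumes "f differentiable (at (x + s *\<^sub>R axis i 1))"
  shows "((\<lambda>s. f (x + s *\<^sub>R axis i 1)) has_real_derivative pd i f (x + s *\<^sub>R axis i 1)) (at s)"
proof -
  let ?y = "x + s *\<^sub>R axis i 1"
  have f: "(f has_derivative frechet_derivative f (at ?y)) (at ?y)"
    using assms frechet_derivative_works by blast
  have "((\<lambda>s. x + s *\<^sub>R axis i 1) has_derivative (\<lambda>h. h *\<^sub>R axis i 1)) (at s)"
    by (auto intro!: derivative_eq_intros)
  from has_derivative_compose[OF this f]
  have "((\<lambda>s. f (x + s *\<^sub>R axis i 1)) has_derivative (\<lambda>h. frechet_derivative f (at ?y) (h *\<^sub>R axis i 1))) (at s)" .
  moreover have "frechet_derivative f (at ?y) (h *\<^sub>R axis i 1) = pd i f ?y * h" for h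
    using linear_frechet_derivative[OF assms] by (simp add: linear_cmul pd_def)
  ultimately show ?thesis
    by (simp add: has_field_derivative_def)
qed

text \<open>Mean value theorem twice: along direction i for the difference of \<open>f\<close> on
  two parallel segments, then along direction j for \<open>pd i f\<close>.\<close>

lemma second_difference:
  fixes f :: "pt \<Rightarrow> real"
  assumes h: "h > 0"
    and U: "\<And>s r. 0 \<le> s \<Longrightarrow> s \<le> h \<Longrightarrow> 0 \<le> r \<Longrightarrow> r \<le> h \<Longrightarrow> x + s *\<^sub>R axis i 1 + r *\<^sub>R axis j 1 \<in> U"
    and f: "smooth_on U f"
  obtains s r where "0 < s" "s < h" "0 < r" "r < h"
    "f (x + h *\<^sub>R axis i 1 + h *\<^sub>R axis j 1) - f (x + h *\<^sub>R axis i 1) - f (x + h *\<^sub>R axis j 1) + f x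
       = h * h * pd j (pd i f) (x + s *\<^sub>R axis i 1 + r *\<^sub>R axis j 1)"
proof -
  define u v :: pt where "u = axis i 1" and "v = axis j 1"
  note U = U[folded u_def v_def]
  define \<phi> where "\<phi> s = f ((x + h *\<^sub>R v) + s *\<^sub>R u) - f (x + s *\<^sub>R u)" for s
  have U1: "(x + h *\<^sub>R v) + s *\<^sub>R u \<in> U" "x + s *\<^sub>R u \<in> U" if "0 \<le> s" "s \<le> h" for s
    using U[of s h] U[of s 0] that h by (auto simp: algebra_simps)
  have "(\<phi> has_real_derivative pd i f ((x + h *\<^sub>R v) + s *\<^sub>R u) - pd i f (x + s *\<^sub>R u)) (at s)"
    if "0 \<le> s" "s \<le> h" for s
    unfolding \<phi>_def
    using pd_line[of f "x + h *\<^sub>R v" s i] pd_line[of f x s i] U1[OF that] smooth_on_differentiable[OF f]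
    unfolding u_def by (auto intro!: derivative_intros)
  from MVT2[OF h this] obtain s where s: "0 < s" "s < h"
    "\<phi> h - \<phi> 0 = h * (pd i f ((x + h *\<^sub>R v) + s *\<^sub>R u) - pd i f (x + s *\<^sub>R u))"
    by auto
  have "((\<lambda>r. pd i f ((x + s *\<^sub>R u) + r *\<^sub>R v)) has_real_derivative
      pd j (pd i f) ((x + s *\<^sub>R u) + r *\<^sub>R v)) (at r)" if "0 \<le> r" "r \<le> h" for r
    unfolding v_def
    by (rule pd_line) (use U[of s r] s that smooth_on_differentiable[OF smooth_on_pd[OF f]] in \<open>auto simp: v_def\<close>)
  from MVT2[OF h this] obtain r where r: "0 < r" "r < h"
    "pd i f ((x + s *\<^sub>R u) + h *\<^sub>R v) - pd i f (x + s *\<^sub>R u)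
       = h * pd j (pd i f) ((x + s *\<^sub>R u) + r *\<^sub>R v)"
    by auto
  have *: "f ((x + h *\<^sub>R v) + h *\<^sub>R u) = f (x + h *\<^sub>R u + h *\<^sub>R v)"
    "pd i f ((x + h *\<^sub>R v) + s *\<^sub>R u) = pd i f ((x + s *\<^sub>R u) + h *\<^sub>R v)"
    by (simp_all add: add.assoc add.commute[of "h *\<^sub>R v"])
  have "f (x + h *\<^sub>R u + h *\<^sub>R v) - f (x + h *\<^sub>R u) - f (x + h *\<^sub>R v) + f x = \<phi> h - \<phi> 0"
    by (simp add: \<phi>_def * algebra_simps)
  also have "\<dots> = h * (h * pd j (pd i f) ((x + s *\<^sub>R u) + r *\<^sub>R v))"
    unfolding s(3) * r(3) ..
  finally have "f (x + h *\<^sub>R u + h *\<^sub>R v) - f (x + h *\<^sub>R u) - f (x + h *\<^sub>R v) + f x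
       = h * (h * pd j (pd i f) ((x + s *\<^sub>R u) + r *\<^sub>R v))" .
  then show thesis
    using that s r unfolding u_def v_def by (auto simp: mult.assoc)
qed

text \<open>The second difference is symmetric in the two directions, so over a small square it
  equals h*h times a nearby value of either mixed derivative. Continuity then excludes different
  limits.\<close>

lemma pd_commute:
  assumes U: "open U" "x \<in> U" and f: "smooth_on U f"
  shows "pd i (pd j f) x = pd j (pd i f) x"
proof (rule ccontr)
  assume neq: "\<not> ?thesis"
  \<comment> \<open>Half of the gap: one number cannot be within \<open>e\<close> of both mixed
    derivatives.\<close>
  define e where "e = \<bar>pd i (pd j f) x - pd j (pd i f) x\<bar> / 2"
  have e: "e > 0" using neq by (simp add: e_def)
  have "isCont (pd i (pd j f)) x" "isCont (pd j (pd i f)) x"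
    using smooth_on_continuous[OF smooth_on_pd[OF smooth_on_pd[OF f]]] U
    by (auto simp: continuous_on_eq_continuous_at)
  then obtain d1 d2 where d: "d1 > 0" "d2 > 0"
    "\<And>y. dist y x < d1 \<Longrightarrow> \<bar>pd i (pd j f) y - pd i (pd j f) x\<bar> < e"
    "\<And>y. dist y x < d2 \<Longrightarrow> \<bar>pd j (pd i f) y - pd j (pd i f) x\<bar> < e"
    unfolding continuous_at_eps_delta dist_real_def using e by metis
  obtain d3 where d3: "d3 > 0" "ball x d3 \<subseteq> U"
    using U openE by blast
  \<comment> \<open>Points of the square have distance at most 2 h from \<open>x\<close>; dividing
    by 3 keeps this strictly below all three radii.\<close>
  define h where "h = min d1 (min d2 d3) / 3"
  have h: "h > 0" "2 * h < d1" "2 * h < d2" "2 * h < d3"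
    using d d3 by (auto simp: h_def min_def)
  have near: "dist (x + s *\<^sub>R axis k 1 + r *\<^sub>R axis l 1) x \<le> 2 * h"
    if "0 \<le> s" "s \<le> h" "0 \<le> r" "r \<le> h" for s r and k l :: 2
    using norm_triangle_ineq[of "s *\<^sub>R axis k 1 :: pt" "r *\<^sub>R axis l 1"] that
    by (simp add: dist_norm add.assoc)
  have inU: "x + s *\<^sub>R axis k 1 + r *\<^sub>R axis l 1 \<in> U"
    if "0 \<le> s" "s \<le> h" "0 \<le> r" "r \<le> h" for s r and k l :: 2
    using near[OF that, of k l] h d3 by (auto simp: dist_commute subset_iff)
  obtain s r where 1: "0 < s" "s < h" "0 < r" "r < h"
    "f (x + h *\<^sub>R axis i 1 + h *\<^sub>R axis j 1) - f (x + h *\<^sub>R axis i 1) - f (x + h *\<^sub>R axis j 1) + f x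
       = h * h * pd j (pd i f) (x + s *\<^sub>R axis i 1 + r *\<^sub>R axis j 1)"
    by (rule second_difference[OF h(1) inU f, of i j])
  obtain s' r' where 2: "0 < s'" "s' < h" "0 < r'" "r' < h"
    "f (x + h *\<^sub>R axis j 1 + h *\<^sub>R axis i 1) - f (x + h *\<^sub>R axis j 1) - f (x + h *\<^sub>R axis i 1) + f x
       = h * h * pd i (pd j f) (x + s' *\<^sub>R axis j 1 + r' *\<^sub>R axis i 1)"
    by (rule second_difference[OF h(1) inU f, of j i])
  have *: "x + h *\<^sub>R axis j 1 + h *\<^sub>R axis i 1 = x + h *\<^sub>R axis i 1 + h *\<^sub>R axis j 1"
    by (simp add: add.assoc add.commute[of "h *\<^sub>R axis j 1"])
  have "h * h * pd j (pd i f) (x + s *\<^sub>R axis i 1 + r *\<^sub>R axis j 1)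
      = h * h * pd i (pd j f) (x + s' *\<^sub>R axis j 1 + r' *\<^sub>R axis i 1)"
    using 1(5) 2(5) unfolding * by linarith
  then have "pd j (pd i f) (x + s *\<^sub>R axis i 1 + r *\<^sub>R axis j 1)
      = pd i (pd j f) (x + s' *\<^sub>R axis j 1 + r' *\<^sub>R axis i 1)"
    using h(1) by simp
  moreover have "\<bar>pd j (pd i f) (x + s *\<^sub>R axis i 1 + r *\<^sub>R axis j 1) - pd j (pd i f) x\<bar> < e"
    by (rule d(4)) (use near[of s r i j] 1 h in auto)
  moreover have "\<bar>pd i (pd j f) (x + s' *\<^sub>R axis j 1 + r' *\<^sub>R axis i 1) - pd i (pd j f) x\<bar> < e"
    by (rule d(3)) (use near[of s' r' j i] 2 h in auto)
  ultimately show False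
    unfolding e_def by (simp add: abs_if split: if_splits)
qed

section \<open>Complex functions on a surface\<close>

text \<open>This is a real partial derivative of a complex valued function, not complex
  differentiation; working on both parts separately reuses the real calculus above.\<close>

definition cpd :: "2 \<Rightarrow> (pt \<Rightarrow> complex) \<Rightarrow> pt \<Rightarrow> complex" where
  "cpd i f x = Complex (pd i (\<lambda>y. Re (f y)) x) (pd i (\<lambda>y. Im (f y)) x)"

definition csmooth :: "pt set \<Rightarrow> (pt \<Rightarrow> complex) \<Rightarrow> bool" where
  "csmooth U f \<longleftrightarrow> smooth_on U (\<lambda>x. Re (f x)) \<and> smooth_on U (\<lambda>x. Im (f x))"

locale open_domain =
  fixes U :: "pt set"
  assumes open_U: "open U"
begin

lemma csmooth_const [intro]: "csmooth U (\<lambda>x. c)"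
  by (simp add: csmooth_def smooth_on_const)

lemma csmooth_of_real [intro]: "smooth_on U f \<Longrightarrow> csmooth U (\<lambda>x. of_real (f x))"
  by (simp add: csmooth_def smooth_on_const)

lemma csmooth_add [intro]: "csmooth U f \<Longrightarrow> csmooth U g \<Longrightarrow> csmooth U (\<lambda>x. f x + g x)"
  by (simp add: csmooth_def smooth_on_add open_U)

lemma csmooth_minus [intro]: "csmooth U f \<Longrightarrow> csmooth U (\<lambda>x. - f x)"
  by (simp add: csmooth_def smooth_on_minus open_U)

lemma csmooth_diff [intro]: "csmooth U f \<Longrightarrow> csmooth U g \<Longrightarrow> csmooth U (\<lambda>x. f x - g x)"
  by (simp add: csmooth_def smooth_on_diff open_U)

lemma csmooth_mult [intro]: "csmooth U f \<Longrightarrow> csmooth U g \<Longrightarrow> csmooth U (\<lambda>x. f x * g x)"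
  by (simp add: csmooth_def smooth_on_diff smooth_on_add smooth_on_mult open_U)

lemma csmooth_divide_const [intro]: "csmooth U f \<Longrightarrow> csmooth U (\<lambda>x. f x / c)"
  by (simp only: divide_inverse) (intro csmooth_mult csmooth_const)

lemma csmooth_cnj [intro]: "csmooth U f \<Longrightarrow> csmooth U (\<lambda>x. cnj (f x))"
  by (simp add: csmooth_def smooth_on_minus open_U)

lemma csmooth_sum [intro]: "(\<And>i. i \<in> I \<Longrightarrow> csmooth U (f i)) \<Longrightarrow> csmooth U (\<lambda>x. \<Sum>i\<in>I. f i x)"
  by (simp add: csmooth_def smooth_on_sum open_U)

lemma csmooth_cpd [intro]: "csmooth U f \<Longrightarrow> csmooth U (cpd i f)"
  by (simp add: csmooth_def cpd_def smooth_on_pd)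

lemma csmooth_cong: "csmooth U f \<Longrightarrow> (\<And>x. x \<in> U \<Longrightarrow> f x = g x) \<Longrightarrow> csmooth U g"
  unfolding csmooth_def
  using smooth_on_cong[OF open_U, of "\<lambda>x. Re (f x)" "\<lambda>x. Re (g x)"]
    smooth_on_cong[OF open_U, of "\<lambda>x. Im (f x)" "\<lambda>x. Im (g x)"] by simp

lemma smooth_on_Re: "csmooth U f \<Longrightarrow> smooth_on U (\<lambda>x. Re (f x))"
  and smooth_on_Im: "csmooth U f \<Longrightarrow> smooth_on U (\<lambda>x. Im (f x))"
  by (auto simp: csmooth_def)

lemma csmooth_differentiable:
  assumes "csmooth U f" "x \<in> U"
  shows "(\<lambda>x. Re (f x)) differentiable (at x)" "(\<lambda>x. Im (f x)) differentiable (at x)"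
  using assms smooth_on_differentiable by (auto simp: csmooth_def)

lemma cpd_const [simp]: "cpd i (\<lambda>x. c) x = 0"
  by (simp add: cpd_def complex_eq_iff)

lemma cpd_of_real: "cpd i (\<lambda>x. of_real (f x)) x = of_real (pd i f x)"
  by (simp add: cpd_def complex_eq_iff)

lemma cpd_add:
  "csmooth U f \<Longrightarrow> csmooth U g \<Longrightarrow> x \<in> U \<Longrightarrow> cpd i (\<lambda>x. f x + g x) x = cpd i f x + cpd i g x"
  by (simp add: cpd_def complex_eq_iff pd_add csmooth_differentiable)

lemma cpd_minus: "csmooth U f \<Longrightarrow> x \<in> U \<Longrightarrow> cpd i (\<lambda>x. - f x) x = - cpd i f x"
  by (simp add: cpd_def complex_eq_iff pd_minus csmooth_differentiable)

lemma cpd_diff: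
  "csmooth U f \<Longrightarrow> csmooth U g \<Longrightarrow> x \<in> U \<Longrightarrow> cpd i (\<lambda>x. f x - g x) x = cpd i f x - cpd i g x"
  by (simp add: cpd_def complex_eq_iff pd_diff csmooth_differentiable)

lemma cpd_mult:
  "csmooth U f \<Longrightarrow> csmooth U g \<Longrightarrow> x \<in> U \<Longrightarrow>
    cpd i (\<lambda>x. f x * g x) x = cpd i f x * g x + f x * cpd i g x"
  by (simp add: cpd_def complex_eq_iff pd_add pd_diff pd_mult differentiable_mult
      csmooth_differentiable)

lemma cpd_cnj: "csmooth U f \<Longrightarrow> x \<in> U \<Longrightarrow> cpd i (\<lambda>x. cnj (f x)) x = cnj (cpd i f x)"
  by (simp add: cpd_def complex_eq_iff pd_minus csmooth_differentiable)

lemma cpd_cong: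
  assumes "x \<in> U" "\<And>y. y \<in> U \<Longrightarrow> f y = g y"
  shows "cpd i f x = cpd i g x"
proof -
  have "pd i (\<lambda>y. Re (f y)) x = pd i (\<lambda>y. Re (g y)) x"
    by (rule pd_cong[OF open_U assms(1)]) (simp add: assms(2))
  moreover have "pd i (\<lambda>y. Im (f y)) x = pd i (\<lambda>y. Im (g y)) x"
    by (rule pd_cong[OF open_U assms(1)]) (simp add: assms(2))
  ultimately show ?thesis by (simp add: cpd_def)
qed

lemma cpd_commute: "csmooth U f \<Longrightarrow> x \<in> U \<Longrightarrow> cpd i (cpd j f) x = cpd j (cpd i f) x"
  using pd_commute[OF open_U, of x "\<lambda>x. Re (f x)" i j] pd_commute[OF open_U, of x "\<lambda>x. Im (f x)" i j]
  by (simp add: cpd_def csmooth_def)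

lemmas csmooth_intros = csmooth_const csmooth_add csmooth_minus csmooth_diff csmooth_mult
  csmooth_cnj csmooth_sum csmooth_cpd csmooth_of_real csmooth_divide_const

section \<open>Derivations along complex vector fields\<close>

definition dv :: "(2 \<Rightarrow> pt \<Rightarrow> complex) \<Rightarrow> (pt \<Rightarrow> complex) \<Rightarrow> pt \<Rightarrow> complex" where
  "dv u f x = (\<Sum>i\<in>UNIV. u i x * cpd i f x)"

lemma csmooth_dv [intro]: "(\<And>i. csmooth U (u i)) \<Longrightarrow> csmooth U f \<Longrightarrow> csmooth U (dv u f)"
  unfolding dv_def by (intro csmooth_intros)

lemma dv_const [simp]: "dv u (\<lambda>x. c) x = 0"
  by (simp add: dv_def)

lemma dv_add:
  "csmooth U f \<Longrightarrow> csmooth U g \<Longrightarrow> x \<in> U \<Longrightarrow> dv u (\<lambda>x. f x + g x) x = dv u f x + dv u g x"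
  by (simp add: dv_def cpd_add sum_2 algebra_simps)

lemma dv_minus: "csmooth U f \<Longrightarrow> x \<in> U \<Longrightarrow> dv u (\<lambda>x. - f x) x = - dv u f x"
  by (simp add: dv_def cpd_minus sum_2 algebra_simps)

lemma dv_diff:
  "csmooth U f \<Longrightarrow> csmooth U g \<Longrightarrow> x \<in> U \<Longrightarrow> dv u (\<lambda>x. f x - g x) x = dv u f x - dv u g x"
  by (simp add: dv_def cpd_diff sum_2 algebra_simps)

lemma dv_mult:
  "csmooth U f \<Longrightarrow> csmooth U g \<Longrightarrow> x \<in> U \<Longrightarrow>
    dv u (\<lambda>x. f x * g x) x = dv u f x * g x + f x * dv u g x"
  by (simp add: dv_def cpd_mult sum_2 algebra_simps)

lemma dv_cong: "x \<in> U \<Longrightarrow> (\<And>y. y \<in> U \<Longrightarrow> f y = g y) \<Longrightarrow> dv u f x = dv u g x"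
  unfolding dv_def by (metis cpd_cong)

lemma dv_cnj:
  "csmooth U f \<Longrightarrow> x \<in> U \<Longrightarrow> dv (\<lambda>i x. cnj (u i x)) (\<lambda>x. cnj (f x)) x = cnj (dv u f x)"
  by (simp add: dv_def cpd_cnj)

end

locale riemannian_domain =
  fixes U :: "pt set" and g :: metric
  assumes riem: "riemannian_surface U g"

sublocale riemannian_domain \<subseteq> open_domain U
  using riem by unfold_locales (simp add: riemannian_surface_def)

context riemannian_domain
begin

lemma smooth_g: "smooth_on U (\<lambda>x. g x $ i $ j)"
  using riem by (simp add: riemannian_surface_def)

lemma g_sym: "x \<in> U \<Longrightarrow> g x $ i $ j = g x $ j $ i"
proof -
  assume "x \<in> U"
  then have "transpose (g x) = g x"
    using riem by (simp add: riemannian_surface_def)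
  then have "transpose (g x) $ i $ j = g x $ i $ j" by simp
  then show ?thesis by (simp add: transpose_def)
qed

lemma g_sym21: "x \<in> U \<Longrightarrow> g x $ 2 $ 1 = g x $ 1 $ 2"
  by (rule g_sym)

lemma g_pos: "x \<in> U \<Longrightarrow> v \<noteq> 0 \<Longrightarrow> v \<bullet> (g x *v v) > 0"
  using riem by (simp add: riemannian_surface_def)

lemma g11_pos: "x \<in> U \<Longrightarrow> g x $ 1 $ 1 > 0"
proof -
  assume x: "x \<in> U"
  have "(axis 1 1 :: pt) \<noteq> 0" by simp
  from g_pos[OF x this] show ?thesis
    by (simp add: inner_vec_def matrix_vector_mult_def sum_2 axis_def)
qed

abbreviation detg :: "pt \<Rightarrow> real" where
  "detg x \<equiv> g x $ 1 $ 1 * g x $ 2 $ 2 - g x $ 1 $ 2 * g x $ 1 $ 2"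

lemma detg_pos:
  assumes "x \<in> U"
  shows "detg x > 0"
proof -
  \<comment> \<open>The vector orthogonal to the first coordinate vector, as in Gram-Schmidt; its
    squared length is \<open>g x $ 1 $ 1\<close> times the determinant.\<close>
  define v :: pt where "v = vector [- (g x $ 1 $ 2), g x $ 1 $ 1]"
  have "v $ 2 \<noteq> 0"
    using g11_pos[OF assms] by (simp add: v_def)
  then have "v \<noteq> 0" by auto
  from g_pos[OF assms this] have "g x $ 1 $ 1 * detg x > 0"
    by (simp add: v_def inner_vec_def matrix_vector_mult_def sum_2 g_sym21[OF assms] algebra_simps)
  then show ?thesis
    using g11_pos[OF assms] by (simp add: zero_less_mult_iff)
qed

lemma invertible_g:
  assumes "x \<in> U"
  shows "invertible (g x)"
  using detg_pos[OF assms] by (simp add: invertible_det_nz det_2 g_sym21[OF assms])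

lemma matrix_inv_g:
  assumes "x \<in> U"
  shows "g x ** matrix_inv (g x) = mat 1" "matrix_inv (g x) ** g x = mat 1"
  using someI_ex[OF invertible_g[OF assms, unfolded invertible_def]]
  by (simp_all add: matrix_inv_def)

lemma ginv_g:
  assumes "x \<in> U"
  shows "(\<Sum>k\<in>UNIV. ginv g x i k * g x $ k $ j) = (if i = j then 1 else 0)"
proof -
  have "(matrix_inv (g x) ** g x) $ i $ j = mat 1 $ i $ j"
    using matrix_inv_g[OF assms] by simp
  then show ?thesis
    by (simp add: matrix_matrix_mult_def mat_def ginv_def)
qed

lemma g_ginv:
  assumes "x \<in> U"
  shows "(\<Sum>k\<in>UNIV. g x $ i $ k * ginv g x k j) = (if i = j then 1 else 0)"
proof -
  have "(g x ** matrix_inv (g x)) $ i $ j = mat 1 $ i $ j"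
    using matrix_inv_g[OF assms] by simp
  then show ?thesis
    by (simp add: matrix_matrix_mult_def mat_def ginv_def)
qed

lemma ginv_explicit:
  assumes "x \<in> U"
  shows "ginv g x 1 1 = g x $ 2 $ 2 / detg x" (is ?P0) "ginv g x 1 2 = - (g x $ 1 $ 2) / detg x" (is ?P1)
    "ginv g x 2 1 = - (g x $ 1 $ 2) / detg x" (is ?P2) "ginv g x 2 2 = g x $ 1 $ 1 / detg x" (is ?P3)
proof -
  have d: "detg x \<noteq> 0" using detg_pos[OF assms] by simp
  have 1: "ginv g x i 1 * g x $ 1 $ 1 + ginv g x i 2 * g x $ 1 $ 2 = (if i = 1 then 1 else 0)" for i
    using ginv_g[OF assms, of i 1] g_sym21[OF assms] by (simp add: sum_2)
  have 2: "ginv g x i 1 * g x $ 1 $ 2 + ginv g x i 2 * g x $ 2 $ 2 = (if i = 2 then 1 else 0)" for i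
    using ginv_g[OF assms, of i 2] by (simp add: sum_2)
  have 3: "ginv g x i 1 * detg x = (if i = 1 then g x $ 2 $ 2 else - (g x $ 1 $ 2))" for i
  proof -
    have "ginv g x i 1 * detg x = (if i = 1 then 1 else 0) * g x $ 2 $ 2 - (if i = 2 then 1 else 0) * g x $ 1 $ 2"
      unfolding 1[of i, symmetric] 2[of i, symmetric] by (simp add: algebra_simps)
    then show ?thesis using exhaust_2[of i] by auto
  qed
  have 4: "ginv g x i 2 * detg x = (if i = 1 then - (g x $ 1 $ 2) else g x $ 1 $ 1)" for i
  proof -
    have "ginv g x i 2 * detg x = (if i = 2 then 1 else 0) * g x $ 1 $ 1 - (if i = 1 then 1 else 0) * g x $ 1 $ 2"
      unfolding 1[of i, symmetric] 2[of i, symmetric] by (simp add: algebra_simps)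
    then show ?thesis using exhaust_2[of i] by auto
  qed
  show ?P0 ?P1
    ?P2 ?P3
    using 3[of 1] 3[of 2] 4[of 1] 4[of 2] by (simp_all only: nonzero_eq_divide_eq[OF d]) simp_all
qed

lemma ginv_sym: "x \<in> U \<Longrightarrow> ginv g x i j = ginv g x j i"
  using exhaust_2[of i] exhaust_2[of j] by (auto simp: ginv_explicit)

lemma smooth_ginv: "smooth_on U (\<lambda>x. ginv g x i j)"
proof -
  have d: "smooth_on U detg"
    by (intro smooth_on_intros open_U smooth_g)
  have nz: "detg x \<noteq> 0" if "x \<in> U" for x
    using detg_pos[OF that] by simp
  have "smooth_on U (\<lambda>x. g x $ 2 $ 2 / detg x)" "smooth_on U (\<lambda>x. - (g x $ 1 $ 2) / detg x)"
    "smooth_on U (\<lambda>x. g x $ 1 $ 1 / detg x)"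
    by (intro smooth_on_intros open_U smooth_g d nz; assumption)+
  then have "smooth_on U (\<lambda>x. ginv g x 1 1)" "smooth_on U (\<lambda>x. ginv g x 1 2)"
    "smooth_on U (\<lambda>x. ginv g x 2 1)" "smooth_on U (\<lambda>x. ginv g x 2 2)"
    by (auto intro: smooth_on_cong[OF open_U] simp: ginv_explicit)
  then show ?thesis
    using exhaust_2[of i] exhaust_2[of j] by auto
qed

lemma smooth_christoffel: "smooth_on U (\<lambda>x. christoffel g x k i j)"
  unfolding christoffel_def
  by (intro smooth_on_intros open_U smooth_ginv smooth_g) auto

lemma pd_g_sym: "x \<in> U \<Longrightarrow> pd l (\<lambda>y. g y $ i $ j) x = pd l (\<lambda>y. g y $ j $ i) x"
  by (rule pd_cong[OF open_U]) (auto intro: g_sym)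

lemma christoffel_sym: "x \<in> U \<Longrightarrow> christoffel g x k i j = christoffel g x k j i"
  unfolding christoffel_def
  by (intro arg_cong[of _ _ "\<lambda>t. t / 2"] sum.cong refl) (simp add: pd_g_sym[of x _ i j])

lemma christoffel_lower:
  assumes "x \<in> U"
  shows "(\<Sum>a\<in>UNIV. g x $ k $ a * christoffel g x a i j) =
     (pd i (\<lambda>y. g y $ k $ j) x + pd j (\<lambda>y. g y $ k $ i) x - pd k (\<lambda>y. g y $ i $ j) x) / 2"
proof -
  define f where "f l = (pd i (\<lambda>y. g y $ l $ j) x + pd j (\<lambda>y. g y $ l $ i) x - pd l (\<lambda>y. g y $ i $ j) x) / 2" for l
  have "christoffel g x a i j = (\<Sum>l\<in>UNIV. ginv g x a l * f l)" for a
    by (simp add: christoffel_def f_def sum_divide_distrib)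
  then have "(\<Sum>a\<in>UNIV. g x $ k $ a * christoffel g x a i j) =
      (\<Sum>l\<in>UNIV. (\<Sum>a\<in>UNIV. g x $ k $ a * ginv g x a l) * f l)"
    by (simp add: sum_2 algebra_simps)
  also have "\<dots> = f k"
    using exhaust_2[of k] by (simp only: g_ginv[OF assms]) (auto simp: sum_2)
  finally show ?thesis by (simp add: f_def)
qed

text \<open>In the sum of the two Koszul formulas every derivative of the metric except one cancels
  by symmetry of \<open>g\<close>.\<close>

lemma metric_compatible:
  assumes "x \<in> U"
  shows "pd l (\<lambda>y. g y $ i $ j) x =
    (\<Sum>a\<in>UNIV. g x $ j $ a * christoffel g x a l i) + (\<Sum>a\<in>UNIV. g x $ i $ a * christoffel g x a l j)"
  unfolding christoffel_lower[OF assms]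
  using pd_g_sym[OF assms, of l i j] pd_g_sym[OF assms, of i l j] pd_g_sym[OF assms, of j l i]
  by (simp add: field_simps)

end

section \<open>Null frames\<close>

text \<open>Equivalent to an orthonormal frame, the real and imaginary parts of \<open>m\<close>:
  nullity says that they are orthogonal of equal length, and the value 2 makes this length
  1.\<close>

locale null_frame = riemannian_domain U g for U :: "pt set" and g :: metric +
  fixes m :: "2 \<Rightarrow> pt \<Rightarrow> complex"
  assumes smooth_m [intro]: "csmooth U (m i)"
    and null_m: "x \<in> U \<Longrightarrow> (\<Sum>i\<in>UNIV. \<Sum>j\<in>UNIV. of_real (g x $ i $ j) * m i x * m j x) = 0"
    and norm_m: "x \<in> U \<Longrightarrow> (\<Sum>i\<in>UNIV. \<Sum>j\<in>UNIV. of_real (g x $ i $ j) * m i x * cnj (m j x)) = 2"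
begin

definition mb :: "2 \<Rightarrow> pt \<Rightarrow> complex" where
  "mb i x = cnj (m i x)"

lemma smooth_mb [intro]: "csmooth U (mb i)"
  unfolding mb_def by (intro csmooth_intros smooth_m)

lemma cnj_mb [simp]: "cnj (mb i x) = m i x" and cnj_m [simp]: "cnj (m i x) = mb i x"
  by (simp_all add: mb_def)

lemma gram:
  assumes "x \<in> U"
  shows "(\<Sum>i\<in>UNIV. \<Sum>j\<in>UNIV. of_real (g x $ i $ j) * m i x * m j x) = 0" (is ?P0)
    "(\<Sum>i\<in>UNIV. \<Sum>j\<in>UNIV. of_real (g x $ i $ j) * m i x * mb j x) = 2" (is ?P1)
    "(\<Sum>i\<in>UNIV. \<Sum>j\<in>UNIV. of_real (g x $ i $ j) * mb i x * m j x) = 2" (is ?P2)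
    "(\<Sum>i\<in>UNIV. \<Sum>j\<in>UNIV. of_real (g x $ i $ j) * mb i x * mb j x) = 0" (is ?P3)
proof -
  show 1: ?P0
    by (rule null_m[OF assms])
  show 2: ?P1
    using norm_m[OF assms] by simp
  show ?P2
    using 2 by (simp add: sum_2 g_sym21[OF assms] algebra_simps)
  show ?P3
    using arg_cong[OF 1, of cnj] by simp
qed

text \<open>The Gram determinant of the pair \<open>m\<close>, \<open>mb\<close> is 0*0 - 2*2 = -4,
  and it is also the determinant of \<open>g\<close> times the square of this expression.\<close>

lemma frame_independent:
  assumes "x \<in> U"
  shows "m 1 x * mb 2 x - m 2 x * mb 1 x \<noteq> 0"
proof
  assume *: "m 1 x * mb 2 x - m 2 x * mb 1 x = 0"
  note G = gram[OF assms, unfolded sum_2 g_sym21[OF assms]]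
  have "of_real (g x $ 1 $ 1 * g x $ 2 $ 2 - g x $ 1 $ 2 * g x $ 1 $ 2) * (m 1 x * mb 2 x - m 2 x * mb 1 x) ^ 2 = (-4 :: complex)"
    using G unfolding of_real_diff of_real_mult by algebra
  with * show False by simp
qed

lemma frame_zeroI:
  fixes X :: "2 \<Rightarrow> complex"
  assumes "x \<in> U" "(\<Sum>i\<in>UNIV. X i * m i x) = 0" "(\<Sum>i\<in>UNIV. X i * mb i x) = 0"
  shows "X i = 0"
proof -
  have "X 1 * (m 1 x * mb 2 x - m 2 x * mb 1 x) = 0" "X 2 * (m 1 x * mb 2 x - m 2 x * mb 1 x) = 0"
    using assms(2,3) unfolding sum_2 by algebra+
  then show ?thesis
    using frame_independent[OF assms(1)] exhaust_2[of i] by auto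
qed

text \<open>The right hand side times \<open>g\<close> fixes both \<open>m\<close> and
  \<open>mb\<close>, by the values in \<open>gram\<close>. These span, so the product is the
  identity, and a left inverse of \<open>g\<close> is the inverse.\<close>

lemma ginv_frame:
  assumes "x \<in> U"
  shows "of_real (ginv g x i j) = (m i x * mb j x + mb i x * m j x) / 2"
proof -
  define N where "N i j = (m i x * mb j x + mb i x * m j x) / 2" for i j
  define Y where "Y i c = (\<Sum>b\<in>UNIV. N i b * of_real (g x $ b $ c)) - (if i = c then 1 else 0)" for i c
  note G = gram[OF assms, unfolded sum_2]
  have "Y i c = 0" for i c
  proof (rule frame_zeroI[OF assms])
    show "(\<Sum>c\<in>UNIV. Y i c * m c x) = 0"
    proof -
      have "(\<Sum>c\<in>UNIV. Y i c * m c x) =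
        m i x * (\<Sum>i\<in>UNIV. \<Sum>j\<in>UNIV. of_real (g x $ i $ j) * mb i x * m j x) / 2 +
        mb i x * (\<Sum>i\<in>UNIV. \<Sum>j\<in>UNIV. of_real (g x $ i $ j) * m i x * m j x) / 2 - m i x"
        using exhaust_2[of i] unfolding Y_def N_def sum_2 by (auto simp: field_simps)
      then show ?thesis by (simp add: gram[OF assms])
    qed
    show "(\<Sum>c\<in>UNIV. Y i c * mb c x) = 0"
    proof -
      have "(\<Sum>c\<in>UNIV. Y i c * mb c x) =
        m i x * (\<Sum>i\<in>UNIV. \<Sum>j\<in>UNIV. of_real (g x $ i $ j) * mb i x * mb j x) / 2 +
        mb i x * (\<Sum>i\<in>UNIV. \<Sum>j\<in>UNIV. of_real (g x $ i $ j) * m i x * mb j x) / 2 - mb i x"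
        using exhaust_2[of i] unfolding Y_def N_def sum_2 by (auto simp: field_simps)
      then show ?thesis by (simp add: gram[OF assms])
    qed
  qed
  then have Ng: "(\<Sum>b\<in>UNIV. N i b * of_real (g x $ b $ c)) = (if i = c then 1 else 0)" for i c
    by (simp add: Y_def)
  have gg: "(\<Sum>k\<in>UNIV. of_real (g x $ b $ k) * of_real (ginv g x k j)) = (if b = j then 1 else 0 :: complex)" for b
    using arg_cong[OF g_ginv[OF assms, of b j], of complex_of_real] by simp
  have "of_real (ginv g x i j) = (\<Sum>c\<in>UNIV. (if i = c then 1 else 0) * complex_of_real (ginv g x c j))"
    using exhaust_2[of i] by (auto simp: sum_2)
  also have "\<dots> = (\<Sum>c\<in>UNIV. (\<Sum>b\<in>UNIV. N i b * of_real (g x $ b $ c)) * complex_of_real (ginv g x c j))"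
    by (simp only: Ng)
  also have "\<dots> = (\<Sum>b\<in>UNIV. N i b * (\<Sum>k\<in>UNIV. of_real (g x $ b $ k) * of_real (ginv g x k j)))"
    by (simp add: sum_2 algebra_simps)
  also have "\<dots> = N i j"
    using exhaust_2[of j] by (auto simp: gg sum_2)
  finally show ?thesis by (simp add: N_def)
qed

section \<open>Connection form, commutator and curvature of the frame\<close>

definition covd :: "2 \<Rightarrow> (2 \<Rightarrow> pt \<Rightarrow> complex) \<Rightarrow> pt \<Rightarrow> 2 \<Rightarrow> complex" where
  "covd l u x j = cpd l (u j) x + (\<Sum>k\<in>UNIV. of_real (christoffel g x j l k) * u k x)"

lemma covd_product:
  assumes "x \<in> U" and u: "\<And>i. csmooth U (u i)" and v: "\<And>i. csmooth U (v i)"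
  shows "cpd l (\<lambda>y. \<Sum>i\<in>UNIV. \<Sum>j\<in>UNIV. of_real (g y $ i $ j) * u i y * v j y) x =
    (\<Sum>i\<in>UNIV. \<Sum>j\<in>UNIV. of_real (g x $ i $ j) * (covd l u x i * v j x + u i x * covd l v x j))"
proof -
  note s = csmooth_of_real[OF smooth_g] u v
  have p: "cpd l (\<lambda>y. of_real (g y $ i $ j) * u i y * v j y) x =
    of_real (\<Sum>a\<in>UNIV. g x $ j $ a * christoffel g x a l i) * u i x * v j x
    + of_real (\<Sum>a\<in>UNIV. g x $ i $ a * christoffel g x a l j) * u i x * v j x
    + of_real (g x $ i $ j) * (cpd l (u i) x * v j x + u i x * cpd l (v j) x)" for i j
    using s by (simp add: cpd_mult csmooth_intros assms cpd_of_real metric_compatible[OF assms(1), of l i j] algebra_simps)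
  show ?thesis
    by (simp only: sum_2 cpd_add csmooth_intros s assms(1) p)
       (simp add: covd_def sum_2 g_sym21[OF assms(1)] algebra_simps)
qed

text \<open>The connection form of the rotation group: the \<open>m\<close>-coefficient of the
  covariant derivative of \<open>m\<close>, found by pairing with \<open>mb\<close> and dividing by
  g(m,mb) = 2.\<close>

definition omega :: "2 \<Rightarrow> pt \<Rightarrow> complex" where
  "omega l x = (\<Sum>i\<in>UNIV. \<Sum>j\<in>UNIV. of_real (g x $ i $ j) * covd l m x i * mb j x) / 2"

lemma smooth_omega [intro]: "csmooth U (omega l)"
  unfolding omega_def covd_def
  by (intro csmooth_intros smooth_m smooth_mb smooth_christoffel smooth_g)

text \<open>Differentiating g(m,m) = 0 shows that the derivative of \<open>m\<close> is orthogonal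
  to \<open>m\<close>, which kills its \<open>mb\<close>-coefficient.\<close>

lemma covd_m:
  assumes x: "x \<in> U"
  shows "covd l m x i = omega l x * m i x"
proof -
  have z: "cpd l (\<lambda>y. \<Sum>i\<in>UNIV. \<Sum>j\<in>UNIV. of_real (g y $ i $ j) * m i y * m j y) x = cpd l (\<lambda>y. 0) x"
    by (rule cpd_cong[OF x]) (rule gram)
  have "(\<Sum>i\<in>UNIV. \<Sum>j\<in>UNIV. of_real (g x $ i $ j) * covd l m x i * m j x) = 0"
    using z[unfolded covd_product[OF x smooth_m smooth_m] cpd_const] unfolding sum_2 g_sym21[OF x]
    by algebra
  then have 1: "(\<Sum>i\<in>UNIV. \<Sum>j\<in>UNIV. of_real (g x $ j $ i) * covd l m x i * m j x) = 0"
    by (simp add: g_sym[OF x])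
  have d: "(\<Sum>k\<in>UNIV. ginv g x i k * g x $ k $ j) = (if i = j then 1 else 0)" for j
    by (rule ginv_g[OF x])
  have "covd l m x i = (\<Sum>j\<in>UNIV. of_real (if i = j then 1 else 0) * covd l m x j)"
    using exhaust_2[of i] by (auto simp: sum_2)
  also have "\<dots> = (\<Sum>j\<in>UNIV. (\<Sum>k\<in>UNIV. of_real (ginv g x i k) * of_real (g x $ k $ j)) * covd l m x j)"
    unfolding d[symmetric] by simp
  also have "\<dots> = m i x * (\<Sum>j\<in>UNIV. \<Sum>k\<in>UNIV. of_real (g x $ k $ j) * covd l m x j * mb k x) / 2
      + mb i x * (\<Sum>j\<in>UNIV. \<Sum>k\<in>UNIV. of_real (g x $ k $ j) * covd l m x j * m k x) / 2"
    by (simp add: ginv_frame[OF x] sum_2 field_simps)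
  also have "\<dots> = omega l x * m i x"
    unfolding 1 by (simp add: omega_def g_sym21[OF x] sum_2)
  finally show ?thesis .
qed

lemma cnj_covd:
  assumes x: "x \<in> U" and u: "\<And>i. csmooth U (u i)"
  shows "covd l (\<lambda>i y. cnj (u i y)) x i = cnj (covd l u x i)"
  using u x by (simp add: covd_def cpd_cnj)

lemma mb_alt: "mb = (\<lambda>i y. cnj (m i y))"
  by (simp add: fun_eq_iff)

lemma covd_mb:
  assumes x: "x \<in> U"
  shows "covd l mb x i = cnj (omega l x) * mb i x"
  unfolding mb_alt cnj_covd[OF x smooth_m] by (simp add: covd_m[OF x])

text \<open>Derivative of the constant g(m,mb) = 2; the connection form takes values in the Lie
  algebra of the circle.\<close>

lemma cnj_omega:
  assumes x: "x \<in> U"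
  shows "cnj (omega l x) = - omega l x"
proof -
  have z: "cpd l (\<lambda>y. \<Sum>i\<in>UNIV. \<Sum>j\<in>UNIV. of_real (g y $ i $ j) * m i y * mb j y) x = cpd l (\<lambda>y. 2) x"
    by (rule cpd_cong[OF x]) (rule gram)
  have "(\<Sum>i\<in>UNIV. \<Sum>j\<in>UNIV. of_real (g x $ i $ j) * m i x * mb j x) * (omega l x + cnj (omega l x)) = 0"
    using z[unfolded covd_product[OF x smooth_m smooth_mb] cpd_const]
    unfolding covd_m[OF x] covd_mb[OF x] sum_2 by algebra
  then have "omega l x + cnj (omega l x) = 0"
    unfolding gram(2)[OF x] by algebra
  then show ?thesis by (simp add: eq_neg_iff_add_eq_0 add.commute)
qed

lemma cpd_m:
  assumes "x \<in> U"
  shows "cpd l (m j) x = omega l x * m j x - (\<Sum>k\<in>UNIV. of_real (christoffel g x j l k) * m k x)"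
  using covd_m[OF assms, of l j] by (simp add: covd_def algebra_simps)

lemma cpd_mb:
  assumes "x \<in> U"
  shows "cpd l (mb j) x = - omega l x * mb j x - (\<Sum>k\<in>UNIV. of_real (christoffel g x j l k) * mb k x)"
  using covd_mb[OF assms, of l j] by (simp add: covd_def cnj_omega[OF assms] algebra_simps)

text \<open>By \<open>cnj_omega\<close> the value of the connection form on \<open>mb\<close> is
  \<open>- cnj (aa x)\<close>, so this one function carries the whole connection.\<close>

definition aa :: "pt \<Rightarrow> complex" where
  "aa x = (\<Sum>l\<in>UNIV. m l x * omega l x)"

lemma smooth_aa [intro]: "csmooth U aa"
  unfolding aa_def by (intro csmooth_intros smooth_m smooth_omega)

lemma omega_mb: "x \<in> U \<Longrightarrow> (\<Sum>l\<in>UNIV. mb l x * omega l x) = - cnj (aa x)"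
  by (simp add: aa_def cnj_omega sum_2)

lemma dm_mb:
  assumes x: "x \<in> U"
  shows "dv m (mb j) x = - aa x * mb j x - (\<Sum>i\<in>UNIV. \<Sum>k\<in>UNIV. of_real (christoffel g x j i k) * m i x * mb k x)"
  by (simp add: dv_def cpd_mb[OF x] aa_def sum_2 algebra_simps)

lemma dmb_m:
  assumes x: "x \<in> U"
  shows "dv mb (m j) x = - cnj (aa x) * m j x - (\<Sum>i\<in>UNIV. \<Sum>k\<in>UNIV. of_real (christoffel g x j i k) * m i x * mb k x)"
  unfolding omega_mb[OF x, symmetric]
  by (simp add: dv_def cpd_m[OF x] sum_2 algebra_simps christoffel_sym[OF x, of j 2 1])

lemma dv_dv:
  assumes x: "x \<in> U" and u: "\<And>i. csmooth U (u i)" and v: "\<And>i. csmooth U (v i)" and f: "csmooth U f"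
  shows "dv u (dv v f) x - dv v (dv u f) x = (\<Sum>j\<in>UNIV. (dv u (v j) x - dv v (u j) x) * cpd j f x)"
proof -
  have c: "cpd 2 (cpd 1 f) x = cpd 1 (cpd 2 f) x"
    by (rule cpd_commute[OF f x])
  show ?thesis
    unfolding dv_def sum_2
    by (simp add: cpd_add cpd_mult csmooth_intros u v f x c algebra_simps)
qed

text \<open>Torsion-freeness: \<open>dm_mb\<close> and \<open>dmb_m\<close> contain the same
  Christoffel sum, so only the connection form survives.\<close>

lemma frame_commutator:
  assumes x: "x \<in> U" and f: "csmooth U f"
  shows "dv m (dv mb f) x - dv mb (dv m f) x = cnj (aa x) * dv m f x - aa x * dv mb f x"
  unfolding dv_dv[OF x smooth_m smooth_mb f] dm_mb[OF x] dmb_m[OF x]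
  by (simp add: dv_def sum_2 algebra_simps)

text \<open>Compare the mixed second derivatives of the components of \<open>m\<close>. The terms
  quadratic in \<open>omega\<close> cancel because rotations of the plane commute, leaving the
  exterior derivative of \<open>omega\<close>.\<close>

lemma riemann_m:
  assumes x: "x \<in> U"
  shows "(\<Sum>l\<in>UNIV. of_real (riemann g x k l i j) * m l x) = (cpd i (omega j) x - cpd j (omega i) x) * m k x"
proof -
  have d: "cpd i (cpd j (m k)) x = cpd i (omega j) x * m k x + omega j x * cpd i (m k) x
     - (\<Sum>l\<in>UNIV. of_real (pd i (\<lambda>y. christoffel g y k j l) x) * m l x + of_real (christoffel g x k j l) * cpd i (m l) x)" for i j
  proof -
    have "cpd i (cpd j (m k)) x = cpd i (\<lambda>y. omega j y * m k y - (\<Sum>l\<in>UNIV. of_real (christoffel g y k j l) * m l y)) x"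
      by (rule cpd_cong[OF x cpd_m])
    then show ?thesis
      by (simp add: sum_2 cpd_add cpd_diff cpd_mult cpd_of_real csmooth_intros smooth_m smooth_omega smooth_christoffel x)
  qed
  have "cpd i (cpd j (m k)) x = cpd j (cpd i (m k)) x"
    by (rule cpd_commute[OF smooth_m x])
  then show ?thesis
    unfolding d cpd_m[OF x]
    by (simp add: riemann_def sum_2 algebra_simps)
qed

text \<open>\<open>F\<close> is the curvature two-form. It is purely imaginary, so it acts on
  \<open>mb\<close> by the opposite factor, and the double trace reduces to \<open>F 1 2\<close>
  times the frame determinant. Inserting the frame derivatives then turns this into derivatives of
  \<open>aa\<close>.\<close>

lemma scalar_curvature_frame:
  assumes x: "x \<in> U"
  shows "of_real (scalar_curvature g x) = - dv m (\<lambda>x. cnj (aa x)) x - dv mb aa x - 2 * aa x * cnj (aa x)"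
proof -
  define F where "F i j = cpd i (omega j) x - cpd j (omega i) x" for i j
  have cF: "cnj (F i j) = - F i j" for i j
  proof -
    have "cnj (cpd i (omega j) x) = cpd i (\<lambda>y. - omega j y) x" for i j
      unfolding cpd_cnj[OF smooth_omega x, symmetric] by (rule cpd_cong[OF x cnj_omega])
    then have "cnj (cpd i (omega j) x) = - cpd i (omega j) x" for i j
      by (simp add: cpd_minus[OF smooth_omega x])
    then show ?thesis by (simp add: F_def)
  qed
  have 1: "(\<Sum>l\<in>UNIV. of_real (riemann g x k l i j) * m l x) = F i j * m k x" for i j k
    by (simp add: riemann_m[OF x] F_def)
  have 2: "(\<Sum>l\<in>UNIV. of_real (riemann g x k l i j) * mb l x) = - F i j * mb k x" for i j k
    using arg_cong[OF 1[of k i j], of cnj] by (simp add: cF)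
  have 3: "F i i = 0" "F 2 1 = - F 1 2" for i by (simp_all add: F_def)
  have "of_real (scalar_curvature g x) = (\<Sum>l\<in>UNIV. \<Sum>j\<in>UNIV. of_real (ginv g x l j) * (\<Sum>k\<in>UNIV. of_real (riemann g x k l k j)))"
    by (simp add: scalar_curvature_def ricci_def)
  also have "\<dots> = (\<Sum>j\<in>UNIV. \<Sum>k\<in>UNIV. mb j x * (\<Sum>l\<in>UNIV. of_real (riemann g x k l k j) * m l x)
       + m j x * (\<Sum>l\<in>UNIV. of_real (riemann g x k l k j) * mb l x)) / 2"
    by (simp add: ginv_frame[OF x] sum_2 field_simps)
  also have "\<dots> = F 1 2 * (m 1 x * mb 2 x - m 2 x * mb 1 x)"
    unfolding 1 2 by (simp add: sum_2 3 field_simps)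
  finally have R: "of_real (scalar_curvature g x) = F 1 2 * (m 1 x * mb 2 x - m 2 x * mb 1 x)" .
  have "dv m (\<lambda>x. cnj (aa x)) x = dv m (\<lambda>x. - (\<Sum>l\<in>UNIV. mb l x * omega l x)) x"
    by (rule dv_cong[OF x]) (simp add: omega_mb)
  also have "\<dots> = - (\<Sum>l\<in>UNIV. dv m (mb l) x * omega l x + mb l x * dv m (omega l) x)"
    by (simp add: sum_2 dv_add dv_diff dv_mult dv_minus csmooth_intros smooth_mb smooth_omega x)
  finally have A: "dv m (\<lambda>x. cnj (aa x)) x = - (\<Sum>l\<in>UNIV. dv m (mb l) x * omega l x + mb l x * dv m (omega l) x)" .
  have B: "dv mb aa x = (\<Sum>l\<in>UNIV. dv mb (m l) x * omega l x + m l x * dv mb (omega l) x)"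
    unfolding aa_def by (simp add: sum_2 dv_add dv_mult dv_minus csmooth_intros smooth_m smooth_omega x)
  have C: "aa x * (\<Sum>l\<in>UNIV. mb l x * omega l x) + aa x * cnj (aa x) = 0"
    "cnj (aa x) * (\<Sum>l\<in>UNIV. m l x * omega l x) = aa x * cnj (aa x)"
    by (simp_all add: omega_mb[OF x]) (simp add: aa_def)
  show ?thesis
    using C unfolding R A B dm_mb[OF x] dmb_m[OF x]
    by (simp add: sum_2 F_def dv_def algebra_simps)
qed

end

section \<open>Weighted quantities\<close>

context null_frame
begin

text \<open>The contractions \<open>K1\<close> to \<open>K4\<close> are complex multilinear, without
  hidden conjugation; conjugating a component of a real tensor exchanges \<open>m\<close> and
  \<open>mb\<close> in all slots.\<close>

definition K1 :: "tensor1 \<Rightarrow> (2 \<Rightarrow> pt \<Rightarrow> complex) \<Rightarrow> pt \<Rightarrow> complex" where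
  "K1 X u x = (\<Sum>i\<in>UNIV. of_real (X x i) * u i x)"

definition K2 :: "tensor2 \<Rightarrow> (2 \<Rightarrow> pt \<Rightarrow> complex) \<Rightarrow> (2 \<Rightarrow> pt \<Rightarrow> complex) \<Rightarrow> pt \<Rightarrow> complex" where
  "K2 X u v x = (\<Sum>i\<in>UNIV. \<Sum>j\<in>UNIV. of_real (X x i j) * u i x * v j x)"

definition K3 :: "tensor3 \<Rightarrow> (2 \<Rightarrow> pt \<Rightarrow> complex) \<Rightarrow> (2 \<Rightarrow> pt \<Rightarrow> complex) \<Rightarrow>
    (2 \<Rightarrow> pt \<Rightarrow> complex) \<Rightarrow> pt \<Rightarrow> complex" where
  "K3 X u v w x = (\<Sum>i\<in>UNIV. \<Sum>j\<in>UNIV. \<Sum>k\<in>UNIV. of_real (X x i j k) * u i x * v j x * w k x)"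

definition K4 :: "(pt \<Rightarrow> 2 \<Rightarrow> 2 \<Rightarrow> 2 \<Rightarrow> 2 \<Rightarrow> real) \<Rightarrow> (2 \<Rightarrow> pt \<Rightarrow> complex) \<Rightarrow> (2 \<Rightarrow> pt \<Rightarrow> complex) \<Rightarrow>
    (2 \<Rightarrow> pt \<Rightarrow> complex) \<Rightarrow> (2 \<Rightarrow> pt \<Rightarrow> complex) \<Rightarrow> pt \<Rightarrow> complex" where
  "K4 X u v w z x = (\<Sum>l\<in>UNIV. \<Sum>i\<in>UNIV. \<Sum>j\<in>UNIV. \<Sum>k\<in>UNIV.
     of_real (X x l i j k) * u l x * v i x * w j x * z k x)"

lemmas K_defs = K1_def K2_def K3_def K4_def

lemma cnj_K1: "cnj (K1 X m x) = K1 X mb x" "cnj (K1 X mb x) = K1 X m x"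
  by (simp_all add: K_defs)

lemma cnj_K2: "cnj (K2 X m m x) = K2 X mb mb x" "cnj (K2 X mb mb x) = K2 X m m x"
  "cnj (K2 X m mb x) = K2 X mb m x" "cnj (K2 X mb m x) = K2 X m mb x"
  by (simp_all add: K_defs)

lemma cnj_K3: "cnj (K3 X m m m x) = K3 X mb mb mb x" "cnj (K3 X mb mb mb x) = K3 X m m m x"
  "cnj (K3 X m m mb x) = K3 X mb mb m x" "cnj (K3 X mb mb m x) = K3 X m m mb x"
  "cnj (K3 X mb m m x) = K3 X m mb mb x" "cnj (K3 X m mb mb x) = K3 X mb m m x"
  "cnj (K3 X m mb m x) = K3 X mb m mb x" "cnj (K3 X mb m mb x) = K3 X m mb m x"
  by (simp_all add: K_defs)

lemma smooth_K1 [intro]: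
  "(\<And>i. smooth_on U (\<lambda>x. X x i)) \<Longrightarrow> (\<And>i. csmooth U (u i)) \<Longrightarrow> csmooth U (K1 X u)"
  unfolding K_defs by (intro csmooth_intros)

lemma smooth_K2 [intro]:
  "(\<And>i j. smooth_on U (\<lambda>x. X x i j)) \<Longrightarrow> (\<And>i. csmooth U (u i)) \<Longrightarrow> (\<And>i. csmooth U (v i)) \<Longrightarrow>
    csmooth U (K2 X u v)"
  unfolding K_defs by (intro csmooth_intros)

lemma smooth_K3 [intro]:
  "(\<And>i j k. smooth_on U (\<lambda>x. X x i j k)) \<Longrightarrow> (\<And>i. csmooth U (u i)) \<Longrightarrow> (\<And>i. csmooth U (v i)) \<Longrightarrow>
    (\<And>i. csmooth U (w i)) \<Longrightarrow> csmooth U (K3 X u v w)"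
  unfolding K_defs by (intro csmooth_intros)

lemma K1_zeroI:
  assumes "x \<in> U" "K1 X m x = 0"
  shows "X x i = 0"
proof -
  have "K1 X mb x = 0" using assms(2) cnj_K1(1)[of X x] by simp
  then have "complex_of_real (X x i) = 0"
    using frame_zeroI[OF assms(1), of "\<lambda>i. of_real (X x i)" i] assms(2) by (simp add: K_defs)
  then show ?thesis by simp
qed

lemma array2_zeroI:
  fixes X :: "2 \<Rightarrow> 2 \<Rightarrow> complex"
  assumes "x \<in> U"
    and "\<And>u v. u \<in> {m, mb} \<Longrightarrow> v \<in> {m, mb} \<Longrightarrow> (\<Sum>i\<in>UNIV. \<Sum>j\<in>UNIV. X i j * u i x * v j x) = 0"
  shows "X i j = 0"
proof -
  have "(\<Sum>i\<in>UNIV. X i j * u i x) = 0" if u: "u \<in> {m, mb}" for u j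
  proof (rule frame_zeroI[OF assms(1), of "\<lambda>j. \<Sum>i\<in>UNIV. X i j * u i x"])
    have *: "(\<Sum>j\<in>UNIV. (\<Sum>i\<in>UNIV. X i j * u i x) * v j x) = (\<Sum>i\<in>UNIV. \<Sum>j\<in>UNIV. X i j * u i x * v j x)" for v
      by (simp add: sum_2 algebra_simps)
    show "(\<Sum>j\<in>UNIV. (\<Sum>i\<in>UNIV. X i j * u i x) * m j x) = 0"
      unfolding * by (rule assms(2)[OF u]) simp
    show "(\<Sum>j\<in>UNIV. (\<Sum>i\<in>UNIV. X i j * u i x) * mb j x) = 0"
      unfolding * by (rule assms(2)[OF u]) simp
  qed
  then show ?thesis
    by (intro frame_zeroI[OF assms(1), of "\<lambda>i. X i j"]) blast+
qed

text \<open>A real tensor is determined by half of its frame components, the others being their conjugates.\<close>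

lemma K2_zeroI:
  assumes "x \<in> U" "K2 X m m x = 0" "K2 X m mb x = 0"
  shows "X x i j = 0"
proof -
  have "K2 X mb m x = 0" "K2 X mb mb x = 0"
    using assms(2,3) cnj_K2[of X x] by simp_all
  with assms(2,3) have "complex_of_real (X x i j) = 0"
    by (intro array2_zeroI[OF assms(1), of "\<lambda>i j. of_real (X x i j)"]) (auto simp: K_defs)
  then show ?thesis by simp
qed

lemma K3_zeroI:
  assumes x: "x \<in> U" and z: "\<And>v w. v \<in> {m, mb} \<Longrightarrow> w \<in> {m, mb} \<Longrightarrow> K3 X m v w x = 0"
  shows "X x i j k = 0"
proof -
  have "K3 X mb v w x = 0" if "v \<in> {m, mb}" "w \<in> {m, mb}" for v w
    using z[of m m] z[of m mb] z[of mb m] z[of mb mb] cnj_K3[of X x] that by auto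
  with z have z: "K3 X u v w x = 0" if "u \<in> {m, mb}" "v \<in> {m, mb}" "w \<in> {m, mb}" for u v w
    using that by blast
  have "(\<Sum>i\<in>UNIV. of_real (X x i j k) * u i x) = 0" if u: "u \<in> {m, mb}" for u j k
  proof (rule array2_zeroI[OF x, of "\<lambda>j k. \<Sum>i\<in>UNIV. of_real (X x i j k) * u i x"])
    fix v w assume vw: "v \<in> {m, mb}" "w \<in> {m, mb}"
    have "(\<Sum>j\<in>UNIV. \<Sum>k\<in>UNIV. (\<Sum>i\<in>UNIV. of_real (X x i j k) * u i x) * v j x * w k x) = K3 X u v w x"
      by (simp add: K_defs sum_2 algebra_simps)
    then show "(\<Sum>j\<in>UNIV. \<Sum>k\<in>UNIV. (\<Sum>i\<in>UNIV. of_real (X x i j k) * u i x) * v j x * w k x) = 0"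
      using z[OF u vw] by simp
  qed
  then have "complex_of_real (X x i j k) = 0"
    by (intro frame_zeroI[OF x, of "\<lambda>i. of_real (X x i j k)"]) blast+
  then show ?thesis by simp
qed

lemma K4_zeroI:
  assumes x: "x \<in> U"
    and z: "\<And>u v w. u \<in> {m, mb} \<Longrightarrow> v \<in> {m, mb} \<Longrightarrow> w \<in> {m, mb} \<Longrightarrow> K4 X m u v w x = 0"
  shows "X x l i j k = 0"
proof -
  have c: "cnj (K4 X m u v w x) = K4 X mb (\<lambda>i x. cnj (u i x)) (\<lambda>i x. cnj (v i x)) (\<lambda>i x. cnj (w i x)) x" for u v w
    by (simp add: K_defs)
  have cc: "(\<lambda>i x. cnj (m i x)) = mb" "(\<lambda>i x. cnj (mb i x)) = m"
    by (simp_all add: fun_eq_iff)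
  have zb: "K4 X mb u v w x = 0" if "u \<in> {m, mb}" "v \<in> {m, mb}" "w \<in> {m, mb}" for u v w
  proof -
    have "(\<lambda>i x. cnj (u i x)) \<in> {m, mb}" if "u \<in> {m, mb}" for u
      using that cc by auto
    from z[OF this this this, OF that] show ?thesis
      using c[of "\<lambda>i x. cnj (u i x)" "\<lambda>i x. cnj (v i x)" "\<lambda>i x. cnj (w i x)"] by simp
  qed
  have z: "K4 X s u v w x = 0" if "s \<in> {m, mb}" "u \<in> {m, mb}" "v \<in> {m, mb}" "w \<in> {m, mb}" for s u v w
    using that(1) z[OF that(2-4)] zb[OF that(2-4)] by auto
  have "(\<Sum>l\<in>UNIV. \<Sum>i\<in>UNIV. of_real (X x l i j k) * s l x * u i x) = 0"
    if s: "s \<in> {m, mb}" and u: "u \<in> {m, mb}" for s u j k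
  proof (rule array2_zeroI[OF x, of "\<lambda>j k. \<Sum>l\<in>UNIV. \<Sum>i\<in>UNIV. of_real (X x l i j k) * s l x * u i x"])
    fix v w assume vw: "v \<in> {m, mb}" "w \<in> {m, mb}"
    have "(\<Sum>j\<in>UNIV. \<Sum>k\<in>UNIV. (\<Sum>l\<in>UNIV. \<Sum>i\<in>UNIV. of_real (X x l i j k) * s l x * u i x) * v j x * w k x)
        = K4 X s u v w x"
      by (simp add: K_defs sum_2 algebra_simps)
    then show "(\<Sum>j\<in>UNIV. \<Sum>k\<in>UNIV. (\<Sum>l\<in>UNIV. \<Sum>i\<in>UNIV. of_real (X x l i j k) * s l x * u i x) * v j x * w k x) = 0"
      using z[OF s u vw] by simp
  qed
  then have "complex_of_real (X x l i j k) = 0"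
    by (intro array2_zeroI[OF x, of "\<lambda>l i. of_real (X x l i j k)"]) blast
  then show ?thesis by simp
qed

text \<open>The weight is the exponent s in the response exp(i s \<phi>) to a rotation of the frame
  by \<phi>. As a relation it lets one lemma cover every choice of \<open>m\<close> and
  \<open>mb\<close> in the slots of a tensor.\<close>

definition frame_weight :: "(2 \<Rightarrow> pt \<Rightarrow> complex) \<Rightarrow> int \<Rightarrow> bool" where
  "frame_weight u s \<longleftrightarrow> (u = m \<and> s = 1) \<or> (u = mb \<and> s = - 1)"

lemma frame_weight_m [intro, simp]: "frame_weight m 1" and frame_weight_mb [intro, simp]: "frame_weight mb (- 1)"
  by (simp_all add: frame_weight_def)

lemma frame_weight_smooth: "frame_weight u s \<Longrightarrow> csmooth U (u i)"
  by (auto simp: frame_weight_def)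

lemma cpd_frame_weight:
  "frame_weight u s \<Longrightarrow> x \<in> U \<Longrightarrow>
    cpd l (u j) x = of_int s * omega l x * u j x - (\<Sum>k\<in>UNIV. of_real (christoffel g x j l k) * u k x)"
  by (auto simp: frame_weight_def cpd_m cpd_mb)

text \<open>Differentiating the frame vectors in a component reproduces precisely the Christoffel
  terms of the covariant derivative; the excess is \<open>omega\<close> times the total weight. The
  next two lemmas repeat this for more slots.\<close>

lemma K2_nabla1:
  assumes x: "x \<in> U" and X: "\<And>i. smooth_on U (\<lambda>x. X x i)" and u: "frame_weight u s"
  shows "K2 (nabla1 g X) n u x = dv n (K1 X u) x - of_int s * (\<Sum>l\<in>UNIV. n l x * omega l x) * K1 X u x"
proof -
  note sm = csmooth_intros csmooth_of_real[OF X] frame_weight_smooth[OF u] x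
  have "cpd l (K1 X u) x = of_int s * omega l x * K1 X u x + (\<Sum>i\<in>UNIV. of_real (nabla1 g X x l i) * u i x)" for l
    unfolding K1_def nabla1_def sum_2
    by (simp add: cpd_add cpd_mult cpd_of_real cpd_frame_weight[OF u x] sm sum_2 algebra_simps)
  then show ?thesis
    by (simp add: K_defs dv_def sum_2 algebra_simps)
qed

lemma K3_nabla2:
  assumes x: "x \<in> U" and X: "\<And>i j. smooth_on U (\<lambda>x. X x i j)"
    and u: "frame_weight u s" and v: "frame_weight v r"
  shows "K3 (nabla2 g X) n u v x =
    dv n (K2 X u v) x - of_int (s + r) * (\<Sum>l\<in>UNIV. n l x * omega l x) * K2 X u v x"
proof -
  note sm = csmooth_intros csmooth_of_real[OF X] frame_weight_smooth[OF u] frame_weight_smooth[OF v] x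
  have "cpd l (K2 X u v) x = of_int (s + r) * omega l x * K2 X u v x
      + (\<Sum>i\<in>UNIV. \<Sum>j\<in>UNIV. of_real (nabla2 g X x l i j) * u i x * v j x)" for l
    unfolding K2_def nabla2_def sum_2
    by (simp add: cpd_add cpd_mult cpd_of_real cpd_frame_weight[OF u x] cpd_frame_weight[OF v x]
        sm sum_2 algebra_simps)
  then show ?thesis
    by (simp add: K_defs dv_def sum_2 algebra_simps)
qed

lemma K4_nabla3:
  assumes x: "x \<in> U" and X: "\<And>i j k. smooth_on U (\<lambda>x. X x i j k)"
    and u: "frame_weight u s" and v: "frame_weight v r" and w: "frame_weight w q"
  shows "K4 (nabla3 g X) n u v w x =
    dv n (K3 X u v w) x - of_int (s + r + q) * (\<Sum>l\<in>UNIV. n l x * omega l x) * K3 X u v w x"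
proof -
  note sm = csmooth_intros csmooth_of_real[OF X] frame_weight_smooth[OF u] frame_weight_smooth[OF v]
    frame_weight_smooth[OF w] x
  have "cpd l (K3 X u v w) x = of_int (s + r + q) * omega l x * K3 X u v w x
      + (\<Sum>i\<in>UNIV. \<Sum>j\<in>UNIV. \<Sum>k\<in>UNIV. of_real (nabla3 g X x l i j k) * u i x * v j x * w k x)" for l
    unfolding K3_def nabla3_def sum_2
    by (simp add: cpd_add cpd_mult cpd_of_real cpd_frame_weight[OF u x] cpd_frame_weight[OF v x]
        cpd_frame_weight[OF w x] sm sum_2) (simp add: algebra_simps)
  then show ?thesis
    by (simp add: K_defs dv_def sum_2 algebra_simps)
qed

text \<open>The edth operators of Newman and Penrose on weight \<open>s\<close>: frame components of
  the covariant derivative. The opposite sign in \<open>ethb\<close> stems from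
  \<open>omega_mb\<close>. \<open>eth\<close> raises the weight by one and \<open>ethb\<close>
  lowers it, hence the shifted arguments in compositions.\<close>

definition eth :: "int \<Rightarrow> (pt \<Rightarrow> complex) \<Rightarrow> pt \<Rightarrow> complex" where
  "eth s f x = dv m f x - of_int s * aa x * f x"

definition ethb :: "int \<Rightarrow> (pt \<Rightarrow> complex) \<Rightarrow> pt \<Rightarrow> complex" where
  "ethb s f x = dv mb f x + of_int s * cnj (aa x) * f x"

lemma smooth_eth [intro]: "csmooth U f \<Longrightarrow> csmooth U (eth s f)"
  and smooth_ethb [intro]: "csmooth U f \<Longrightarrow> csmooth U (ethb s f)"
  unfolding eth_def ethb_def
  by (intro csmooth_intros csmooth_dv smooth_m smooth_mb smooth_aa; assumption)+

lemma nabla1_eth: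
  assumes "x \<in> U" "\<And>i. smooth_on U (\<lambda>x. X x i)" "frame_weight u s"
  shows "K2 (nabla1 g X) m u x = eth s (K1 X u) x" "K2 (nabla1 g X) mb u x = ethb s (K1 X u) x"
  by (simp_all add: K2_nabla1[OF assms] eth_def ethb_def omega_mb[OF assms(1)]) (simp add: aa_def)

lemma nabla2_eth:
  assumes "x \<in> U" "\<And>i j. smooth_on U (\<lambda>x. X x i j)" "frame_weight u s" "frame_weight v r"
  shows "K3 (nabla2 g X) m u v x = eth (s + r) (K2 X u v) x"
    "K3 (nabla2 g X) mb u v x = ethb (s + r) (K2 X u v) x"
  by (simp_all add: K3_nabla2[OF assms] eth_def ethb_def omega_mb[OF assms(1)]) (simp add: aa_def)

lemma nabla3_eth:
  assumes "x \<in> U" "\<And>i j k. smooth_on U (\<lambda>x. X x i j k)"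
    "frame_weight u s" "frame_weight v r" "frame_weight w q"
  shows "K4 (nabla3 g X) m u v w x = eth (s + r + q) (K3 X u v w) x"
    "K4 (nabla3 g X) mb u v w x = ethb (s + r + q) (K3 X u v w) x"
  by (simp_all add: K4_nabla3[OF assms] eth_def ethb_def omega_mb[OF assms(1)]) (simp add: aa_def)

lemma eth_cong: "x \<in> U \<Longrightarrow> (\<And>y. y \<in> U \<Longrightarrow> f y = h y) \<Longrightarrow> eth s f x = eth s h x"
  and ethb_cong: "x \<in> U \<Longrightarrow> (\<And>y. y \<in> U \<Longrightarrow> f y = h y) \<Longrightarrow> ethb s f x = ethb s h x"
  unfolding eth_def ethb_def using dv_cong[of x f h] by simp_all

text \<open>\<open>h\<close> is a separate function because the named conjugates, or a real function
  such as \<open>lap V\<close>, agree with the conjugate of \<open>f\<close> only on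
  \<open>U\<close>.\<close>

lemma cnj_eth:
  assumes "x \<in> U" "csmooth U f" "\<And>y. y \<in> U \<Longrightarrow> h y = cnj (f y)"
  shows "cnj (eth s f x) = ethb (- s) h x" "cnj (ethb s f x) = eth (- s) h x"
proof -
  have m: "(\<lambda>i x. cnj (m i x)) = mb" "(\<lambda>i x. cnj (mb i x)) = m" by (simp_all add: fun_eq_iff)
  have "dv n h x = dv n (\<lambda>y. cnj (f y)) x" for n
    by (rule dv_cong[OF assms(1,3)])
  then show "cnj (eth s f x) = ethb (- s) h x" "cnj (ethb s f x) = eth (- s) h x"
    using dv_cnj[OF assms(2,1), of m] dv_cnj[OF assms(2,1), of mb] assms(1,3)
    by (simp_all add: m eth_def ethb_def)
qed

lemma eth_0: "eth s (\<lambda>x. 0) x = 0" and ethb_0: "ethb s (\<lambda>x. 0) x = 0"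
  by (simp_all add: eth_def ethb_def)

text \<open>First-order terms produced by \<open>aa\<close> cancel against
  \<open>frame_commutator\<close>; what remains is \<open>s\<close> times the expression in
  \<open>scalar_curvature_frame\<close>.\<close>

lemma eth_commutator:
  assumes x: "x \<in> U" and f: "csmooth U f"
  shows "eth (s - 1) (ethb s f) x - ethb (s + 1) (eth s f) x
    = - of_int s * of_real (scalar_curvature g x) * f x"
proof -
  note sm = csmooth_intros smooth_aa f csmooth_dv[OF smooth_m f] csmooth_dv[OF smooth_mb f] x
  have "dv m (ethb s f) x = dv m (dv mb f) x + of_int s * (dv m (\<lambda>x. cnj (aa x)) x * f x + cnj (aa x) * dv m f x)"
    unfolding ethb_def by (simp add: dv_add dv_mult sm algebra_simps)
  moreover have "dv mb (eth s f) x = dv mb (dv m f) x - of_int s * (dv mb aa x * f x + aa x * dv mb f x)"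
    unfolding eth_def by (simp add: dv_diff dv_mult sm algebra_simps)
  ultimately show ?thesis
    unfolding scalar_curvature_frame[OF x] eth_def[of _ _ x] ethb_def[of _ _ x]
    using frame_commutator[OF x f] by (simp add: algebra_simps)
qed

end

section \<open>Structure tensors in a null frame\<close>

context null_frame
begin

lemma ginv_trace:
  assumes "x \<in> U"
  shows "of_real (\<Sum>a\<in>UNIV. \<Sum>b\<in>UNIV. ginv g x a b * X x a b) = (K2 X m mb x + K2 X mb m x) / 2"
  by (simp add: ginv_frame[OF assms] K_defs sum_2 field_simps)

lemma raise1_frame:
  assumes "x \<in> U"
  shows "of_real (raise1 g X x i) = (m i x * K1 X mb x + mb i x * K1 X m x) / 2"
  by (simp add: raise1_def ginv_frame[OF assms] K_defs sum_2 field_simps)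

lemma raise2_frame:
  assumes "x \<in> U"
  shows "of_real (raise2 g X x i j) = (m i x * m j x * K2 X mb mb x + mb i x * mb j x * K2 X m m x
    + m i x * mb j x * K2 X mb m x + mb i x * m j x * K2 X m mb x) / 4"
proof -
  have *: "of_real (raise2 g X x i j) =
    (\<Sum>a\<in>UNIV. \<Sum>b\<in>UNIV. ((m i x * mb a x + mb i x * m a x) / 2) * ((m j x * mb b x + mb j x * m b x) / 2) * of_real (X x a b))"
    unfolding raise2_def of_real_sum of_real_mult ginv_frame[OF assms] ..
  show ?thesis
    unfolding * by (simp add: K_defs sum_2 field_simps)
qed

lemma raise3_frame:
  assumes "x \<in> U"
  shows "of_real (raise3 g X x i j k) =
    (m i x * m j x * m k x * K3 X mb mb mb x + m i x * m j x * mb k x * K3 X mb mb m x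
     + m i x * mb j x * m k x * K3 X mb m mb x + m i x * mb j x * mb k x * K3 X mb m m x
     + mb i x * m j x * m k x * K3 X m mb mb x + mb i x * m j x * mb k x * K3 X m mb m x
     + mb i x * mb j x * m k x * K3 X m m mb x + mb i x * mb j x * mb k x * K3 X m m m x) / 8"
proof -
  have *: "of_real (raise3 g X x i j k) =
    (\<Sum>a\<in>UNIV. \<Sum>b\<in>UNIV. \<Sum>c\<in>UNIV. ((m i x * mb a x + mb i x * m a x) / 2) * ((m j x * mb b x + mb j x * m b x) / 2)
      * ((m k x * mb c x + mb k x * m c x) / 2) * of_real (X x a b c))"
    unfolding raise3_def of_real_sum of_real_mult ginv_frame[OF assms] ..
  show ?thesis
    unfolding * by (simp add: K_defs sum_2 field_simps)
qed

abbreviation gt :: tensor2 where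
  "gt \<equiv> \<lambda>x i j. g x $ i $ j"

lemma K2_g: "x \<in> U \<Longrightarrow> K2 gt m m x = 0" "x \<in> U \<Longrightarrow> K2 gt m mb x = 2"
  "x \<in> U \<Longrightarrow> K2 gt mb m x = 2" "x \<in> U \<Longrightarrow> K2 gt mb mb x = 0"
  by (simp_all only: K2_def gram)

definition cR :: "pt \<Rightarrow> complex" where
  "cR x = of_real (scalar_curvature g x)"

lemma smooth_scalar_curvature: "smooth_on U (scalar_curvature g)"
proof -
  have "csmooth U (\<lambda>x. - dv m (\<lambda>x. cnj (aa x)) x - dv mb aa x - 2 * aa x * cnj (aa x))"
    by (intro csmooth_intros csmooth_dv smooth_m smooth_mb smooth_aa)
  then have "csmooth U (\<lambda>x. of_real (scalar_curvature g x))"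
    by (rule csmooth_cong) (simp add: scalar_curvature_frame)
  from smooth_on_Re[OF this] show ?thesis by simp
qed

lemma smooth_cR [intro]: "csmooth U cR"
  using smooth_scalar_curvature unfolding cR_def by (rule csmooth_of_real)

lemma cnj_cR [simp]: "cnj (cR x) = cR x"
  by (simp add: cR_def)

lemma commutator:
  assumes "x \<in> U" "csmooth U f"
  shows "ethb (s + 1) (eth s f) x = eth (s - 1) (ethb s f) x + of_int s * cR x * f x"
  using eth_commutator[OF assms, of s] by (simp add: cR_def algebra_simps)

lemma smooth_grad: "smooth_on U f \<Longrightarrow> smooth_on U (\<lambda>x. grad f x i)"
  by (simp add: grad_def smooth_on_pd)

lemma K1_grad: "K1 (grad f) m x = eth 0 (\<lambda>x. of_real (f x)) x"
  "K1 (grad f) mb x = ethb 0 (\<lambda>x. of_real (f x)) x"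
  by (simp_all add: K_defs grad_def eth_def ethb_def dv_def cpd_of_real algebra_simps)

lemma K1_grad': "K1 (grad f) m = eth 0 (\<lambda>x. of_real (f x))"
  "K1 (grad f) mb = ethb 0 (\<lambda>x. of_real (f x))"
  by (simp_all add: fun_eq_iff K1_grad)

lemma hess_frame:
  assumes "x \<in> U" "smooth_on U f"
  shows "K2 (hess g f) m m x = eth 1 (eth 0 (\<lambda>x. of_real (f x))) x"
    "K2 (hess g f) mb m x = ethb 1 (eth 0 (\<lambda>x. of_real (f x))) x"
    "K2 (hess g f) m mb x = eth (- 1) (ethb 0 (\<lambda>x. of_real (f x))) x"
    "K2 (hess g f) mb mb x = ethb (- 1) (ethb 0 (\<lambda>x. of_real (f x))) x"
  unfolding hess_def
  using nabla1_eth[where X="grad f", OF assms(1) smooth_grad[OF assms(2)] frame_weight_m]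
    nabla1_eth[where X="grad f", OF assms(1) smooth_grad[OF assms(2)] frame_weight_mb] by (simp_all add: K1_grad')

lemma eth_ethb_0:
  assumes "x \<in> U" "csmooth U f"
  shows "eth (- 1) (ethb 0 f) x = ethb 1 (eth 0 f) x"
  using commutator[OF assms, of 0] by simp

lemma laplacian_frame:
  assumes "x \<in> U" "smooth_on U f"
  shows "of_real (laplacian g f x) = ethb 1 (eth 0 (\<lambda>x. of_real (f x))) x"
  unfolding laplacian_def ginv_trace[OF assms(1)] hess_frame[OF assms]
  by (simp add: eth_ethb_0[OF assms(1) csmooth_of_real[OF assms(2)]])

lemma eth_linear_rules:
  assumes "x \<in> U" "csmooth U f"
  shows "csmooth U h \<Longrightarrow> eth s (\<lambda>x. f x + h x) x = eth s f x + eth s h x"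
    "csmooth U h \<Longrightarrow> ethb s (\<lambda>x. f x + h x) x = ethb s f x + ethb s h x"
    "csmooth U h \<Longrightarrow> eth s (\<lambda>x. f x - h x) x = eth s f x - eth s h x"
    "csmooth U h \<Longrightarrow> ethb s (\<lambda>x. f x - h x) x = ethb s f x - ethb s h x"
    "eth s (\<lambda>x. - f x) x = - eth s f x" "ethb s (\<lambda>x. - f x) x = - ethb s f x"
    "eth s (\<lambda>x. c * f x) x = c * eth s f x" "ethb s (\<lambda>x. c * f x) x = c * ethb s f x"
    "eth s (\<lambda>x. f x / c) x = eth s f x / c" "ethb s (\<lambda>x. f x / c) x = ethb s f x / c"
  using assms
  by (simp_all add: eth_def ethb_def dv_add dv_diff dv_minus dv_mult csmooth_intros divide_inverse algebra_simps)

lemma eth_mult: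
  assumes "x \<in> U" "csmooth U f" "csmooth U h" "s = q + r"
  shows "eth s (\<lambda>x. f x * h x) x = eth q f x * h x + f x * eth r h x"
    and "ethb s (\<lambda>x. f x * h x) x = ethb q f x * h x + f x * ethb r h x"
  using assms by (simp_all add: eth_def ethb_def dv_mult algebra_simps)

end

locale structured_frame = null_frame U g m for U g m +
  fixes \<V> :: "(pt \<Rightarrow> real) set" and T S :: tensor3 and \<tau> :: tensor2 and t :: "pt \<Rightarrow> real"
  assumes str: "structure_tensors U g \<V> T \<tau>"
    and con: "conformal_structure U g T S t"
begin

lemma smooth_t: "smooth_on U t" and smooth_S: "smooth_on U (\<lambda>x. S x i j k)"
  and smooth_tau: "smooth_on U (\<lambda>x. \<tau> x i j)"
  and S_sym: "x \<in> U \<Longrightarrow> S x i j k = S x j i k" "x \<in> U \<Longrightarrow> S x i j k = S x i k j"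
  and S_trace: "x \<in> U \<Longrightarrow> (\<Sum>a\<in>UNIV. \<Sum>b\<in>UNIV. ginv g x a b * S x a b k) = 0"
  and T_S: "x \<in> U \<Longrightarrow> T x i j k =
        S x i j k + pd i t x * g x $ j $ k + pd j t x * g x $ i $ k - g x $ i $ j * pd k t x"
  and tau_sym: "x \<in> U \<Longrightarrow> \<tau> x i j = \<tau> x j i"
  and tau_trace: "x \<in> U \<Longrightarrow> (\<Sum>a\<in>UNIV. \<Sum>b\<in>UNIV. ginv g x a b * \<tau> x a b) = 0"
  and hess_V: "x \<in> U \<Longrightarrow> V \<in> \<V> \<Longrightarrow> hess g V x i j =
          (\<Sum>k\<in>UNIV. T x i j k * raise1 g (grad V) x k)
          + g x $ i $ j * laplacian g V x / 2
          + \<tau> x i j * V x"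
proof -
  have c: "smooth_on U t" "\<forall>i j k. smooth_on U (\<lambda>x. S x i j k)"
    "\<forall>x\<in>U. \<forall>i j k. S x i j k = S x j i k \<and> S x i j k = S x i k j"
    "\<forall>x\<in>U. \<forall>k. (\<Sum>a\<in>UNIV. \<Sum>b\<in>UNIV. ginv g x a b * S x a b k) = 0"
    "\<forall>x\<in>U. \<forall>i j k. T x i j k =
        S x i j k + pd i t x * g x $ j $ k + pd j t x * g x $ i $ k - g x $ i $ j * pd k t x"
    using con unfolding conformal_structure_def by - (elim conjE; assumption)+
  have s: "\<forall>i j. smooth_on U (\<lambda>x. \<tau> x i j)" "\<forall>x\<in>U. \<forall>i j. \<tau> x i j = \<tau> x j i"
    "\<forall>x\<in>U. (\<Sum>a\<in>UNIV. \<Sum>b\<in>UNIV. ginv g x a b * \<tau> x a b) = 0"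
    "\<forall>V\<in>\<V>. \<forall>x\<in>U. \<forall>i j. hess g V x i j =
          (\<Sum>k\<in>UNIV. T x i j k * raise1 g (grad V) x k)
          + g x $ i $ j * laplacian g V x / 2
          + \<tau> x i j * V x"
    using str unfolding structure_tensors_def by - (elim conjE; assumption)+
  show "smooth_on U t" "smooth_on U (\<lambda>x. S x i j k)" "smooth_on U (\<lambda>x. \<tau> x i j)"
    using c(1,2) s(1) by auto
  assume x: "x \<in> U"
  show "S x i j k = S x j i k" "S x i j k = S x i k j"
    "(\<Sum>a\<in>UNIV. \<Sum>b\<in>UNIV. ginv g x a b * S x a b k) = 0"
    by (rule bspec[OF c(3) x, THEN spec, THEN spec, THEN spec, THEN conjunct1]
      bspec[OF c(3) x, THEN spec, THEN spec, THEN spec, THEN conjunct2]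
      bspec[OF c(4) x, THEN spec])+
  show "T x i j k = S x i j k + pd i t x * g x $ j $ k + pd j t x * g x $ i $ k - g x $ i $ j * pd k t x"
    by (rule bspec[OF c(5) x, THEN spec, THEN spec, THEN spec])
  show "\<tau> x i j = \<tau> x j i" "(\<Sum>a\<in>UNIV. \<Sum>b\<in>UNIV. ginv g x a b * \<tau> x a b) = 0"
    by (rule bspec[OF s(2) x, THEN spec, THEN spec] bspec[OF s(3) x])+
  assume "V \<in> \<V>"
  from bspec[OF bspec[OF s(4) this] x, THEN spec, THEN spec]
  show "hess g V x i j = (\<Sum>k\<in>UNIV. T x i j k * raise1 g (grad V) x k)
          + g x $ i $ j * laplacian g V x / 2 + \<tau> x i j * V x" .
qed

text \<open>These are the sole independent components of dt, \<open>S\<close>, \<open>\<tau>\<close>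
  and \<open>\<Xi>\<close>, of weights 1, 3, 2, 2. The names ending in b are their conjugates, of
  opposite weight.\<close>

definition p :: "pt \<Rightarrow> complex" where "p = K1 (grad t) m"
definition pb :: "pt \<Rightarrow> complex" where "pb = K1 (grad t) mb"
definition sg :: "pt \<Rightarrow> complex" where "sg = K3 S m m m"
definition sgb :: "pt \<Rightarrow> complex" where "sgb = K3 S mb mb mb"
definition th :: "pt \<Rightarrow> complex" where "th = K2 \<tau> m m"
definition thb :: "pt \<Rightarrow> complex" where "thb = K2 \<tau> mb mb"
definition xi :: "pt \<Rightarrow> complex" where "xi = K2 (Xi g S t) m m"
definition xib :: "pt \<Rightarrow> complex" where "xib = K2 (Xi g S t) mb mb"

lemma smooth_Xi: "smooth_on U (\<lambda>x. Xi g S t x i j)"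
  unfolding Xi_def nabla3_def
  by (intro smooth_on_intros open_U smooth_ginv smooth_christoffel smooth_S smooth_t)

lemma smooth_comps [intro, simp]: "csmooth U p" "csmooth U pb" "csmooth U sg" "csmooth U sgb"
  "csmooth U th" "csmooth U thb" "csmooth U xi" "csmooth U xib"
  unfolding p_def pb_def sg_def sgb_def th_def thb_def xi_def xib_def
  by (intro smooth_K1 smooth_K2 smooth_K3 smooth_grad smooth_t smooth_S smooth_tau smooth_Xi smooth_m smooth_mb)+

lemma cnj_comps [simp]: "cnj (p x) = pb x" "cnj (pb x) = p x" "cnj (sg x) = sgb x" "cnj (sgb x) = sg x"
  "cnj (th x) = thb x" "cnj (thb x) = th x" "cnj (xi x) = xib x" "cnj (xib x) = xi x"
  by (simp_all add: p_def pb_def sg_def sgb_def th_def thb_def xi_def xib_def cnj_K1 cnj_K2 cnj_K3)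

lemma K3_S_sym:
  assumes x: "x \<in> U"
  shows "K3 S u v w x = K3 S v u w x" "K3 S u v w x = K3 S u w v x"
proof -
  have s: "S x 1 2 1 = S x 1 1 2" "S x 2 1 1 = S x 1 1 2" "S x 2 1 2 = S x 1 2 2" "S x 2 2 1 = S x 1 2 2"
    using S_sym[OF x] by metis+
  show "K3 S u v w x = K3 S v u w x" "K3 S u v w x = K3 S u w v x"
    by (simp_all add: K_defs sum_2 s algebra_simps)
qed

text \<open>By \<open>ginv_trace\<close> and symmetry the trace is the mixed component, so it
  vanishes in the first two slots; total symmetry moves it to any other pair.\<close>

lemma K3_S_mixed:
  assumes x: "x \<in> U"
  shows "K3 S m mb u x = 0" "K3 S mb m u x = 0" "K3 S m u mb x = 0" (is ?P0) "K3 S mb u m x = 0" (is ?P1)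
    "K3 S u m mb x = 0" "K3 S u mb m x = 0"
proof -
  have "0 = (\<Sum>k\<in>UNIV. of_real (\<Sum>a\<in>UNIV. \<Sum>b\<in>UNIV. ginv g x a b * S x a b k) * u k x)"
    by (simp add: S_trace[OF x])
  also have "\<dots> = (\<Sum>k\<in>UNIV. (K2 (\<lambda>x a b. S x a b k) m mb x + K2 (\<lambda>x a b. S x a b k) mb m x) / 2 * u k x)"
    unfolding ginv_trace[OF x, of "\<lambda>x a b. S x a b _"] ..
  also have "\<dots> = (K3 S m mb u x + K3 S mb m u x) / 2"
    by (simp add: K_defs sum_2 field_simps)
  finally show 1: "K3 S m mb u x = 0"
    using K3_S_sym(1)[OF x, of mb m u] by simp
  show 2: "K3 S mb m u x = 0"
    using K3_S_sym(1)[OF x, of mb m u] 1 by simp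
  show 3: ?P0
    using K3_S_sym(2)[OF x, of m u mb] 1 by simp
  show 4: ?P1
    using K3_S_sym(2)[OF x, of mb u m] 2 by simp
  show "K3 S u m mb x = 0" "K3 S u mb m x = 0"
    using K3_S_sym(1)[OF x, of u m mb] K3_S_sym(1)[OF x, of u mb m] 3 4 by simp_all
qed

lemma K2_tau_mixed:
  assumes x: "x \<in> U"
  shows "K2 \<tau> m mb x = 0" "K2 \<tau> mb m x = 0"
proof -
  have s: "K2 \<tau> mb m x = K2 \<tau> m mb x"
    by (simp add: K_defs sum_2 tau_sym[OF x, of 2 1] algebra_simps)
  have "(K2 \<tau> m mb x + K2 \<tau> mb m x) / 2 = 0"
    unfolding ginv_trace[OF x, of \<tau>, symmetric] tau_trace[OF x] by simp
  with s show "K2 \<tau> m mb x = 0" "K2 \<tau> mb m x = 0" by simp_all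
qed

lemma K2_Xi:
  assumes x: "x \<in> U"
  shows "K2 (Xi g S t) u v x = (K4 (nabla3 g S) m u v mb x + K4 (nabla3 g S) mb u v m x
      + 2/3 * (p x * K3 S u v mb x + pb x * K3 S u v m x)) / 2"
proof -
  have "complex_of_real (Xi g S t x i j) = (K2 (\<lambda>x a b. nabla3 g S x b i j a) m mb x
      + K2 (\<lambda>x a b. nabla3 g S x b i j a) mb m x
      + 2/3 * (K2 (\<lambda>x a b. pd b t x * S x i j a) m mb x + K2 (\<lambda>x a b. pd b t x * S x i j a) mb m x)) / 2" for i j
    unfolding Xi_def ginv_trace[OF x, of "\<lambda>x a b. nabla3 g S x b i j a + 2/3 * pd b t x * S x i j a"]
    by (simp add: K_defs sum_2 field_simps)
  note * = this
  show ?thesis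
    unfolding K2_def[of "Xi g S t"] * by (simp add: p_def pb_def K_defs sum_2 grad_def field_simps)
qed

lemma sg_mixed_eth:
  assumes x: "x \<in> U"
  shows "eth s (K3 S m mb u) x = 0" "ethb s (K3 S m mb u) x = 0"
    "eth s (K3 S mb m u) x = 0" "ethb s (K3 S mb m u) x = 0"
    "eth s (K3 S m u mb) x = 0" "ethb s (K3 S m u mb) x = 0"
    "eth s (K3 S mb u m) x = 0" "ethb s (K3 S mb u m) x = 0"
    "eth s (K3 S u m mb) x = 0" "ethb s (K3 S u m mb) x = 0"
    "eth s (K3 S u mb m) x = 0" "ethb s (K3 S u mb m) x = 0"
  by (simp_all add: eth_cong[OF x, of _ "\<lambda>x. 0"] ethb_cong[OF x, of _ "\<lambda>x. 0"] K3_S_mixed eth_0 ethb_0)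

lemma nabla3_S:
  assumes x: "x \<in> U"
  shows "K4 (nabla3 g S) m m m m x = eth 3 sg x" "K4 (nabla3 g S) mb m m m x = ethb 3 sg x"
    "frame_weight n s \<Longrightarrow> frame_weight u r \<Longrightarrow> K4 (nabla3 g S) n m mb u x = 0"
    "frame_weight n s \<Longrightarrow> frame_weight u r \<Longrightarrow> K4 (nabla3 g S) n mb m u x = 0"
    "frame_weight n s \<Longrightarrow> frame_weight u r \<Longrightarrow> K4 (nabla3 g S) n m u mb x = 0"
    "frame_weight n s \<Longrightarrow> frame_weight u r \<Longrightarrow> K4 (nabla3 g S) n mb u m x = 0"
    "frame_weight n s \<Longrightarrow> frame_weight u r \<Longrightarrow> K4 (nabla3 g S) n u m mb x = 0"
    "frame_weight n s \<Longrightarrow> frame_weight u r \<Longrightarrow> K4 (nabla3 g S) n u mb m x = 0"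
proof -
  note n = nabla3_eth[where X=S, OF x smooth_S]
  show "K4 (nabla3 g S) m m m m x = eth 3 sg x" "K4 (nabla3 g S) mb m m m x = ethb 3 sg x"
    using n[of m 1 m 1 m 1] by (simp_all add: sg_def)
  have f: "frame_weight n s \<Longrightarrow> n = m \<or> n = mb" for n s
    by (auto simp: frame_weight_def)
  assume "frame_weight n s" and u: "frame_weight u r"
  then have nn: "n = m \<or> n = mb" using f by blast
  show "K4 (nabla3 g S) n m mb u x = 0" "K4 (nabla3 g S) n mb m u x = 0"
    "K4 (nabla3 g S) n m u mb x = 0" "K4 (nabla3 g S) n mb u m x = 0"
    "K4 (nabla3 g S) n u m mb x = 0" "K4 (nabla3 g S) n u mb m x = 0"
    using nn n[OF frame_weight_m frame_weight_mb u] n[OF frame_weight_mb frame_weight_m u]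
      n[OF frame_weight_m u frame_weight_mb] n[OF frame_weight_mb u frame_weight_m]
      n[OF u frame_weight_m frame_weight_mb] n[OF u frame_weight_mb frame_weight_m]
    by (auto simp: sg_mixed_eth[OF x])
qed

text \<open>In the divergence, differentiation along \<open>m\<close> meets a mixed component of
  \<open>S\<close>, which is zero. Only \<open>ethb\<close> of \<open>sg\<close> is left, with the
  factor 1/2 from \<open>ginv_frame\<close>.\<close>

lemma xi_eq:
  assumes x: "x \<in> U"
  shows "xi x = ethb 3 sg x / 2 + pb x * sg x / 3"
  unfolding xi_def K2_Xi[OF x]
  using nabla3_S(2)[OF x] nabla3_S(7)[OF x frame_weight_m frame_weight_m]
  by (simp add: K3_S_mixed[OF x] sg_def[symmetric] field_simps)

lemma K2_Xi_mixed:
  assumes x: "x \<in> U"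
  shows "K2 (Xi g S t) m mb x = 0" "K2 (Xi g S t) mb m x = 0"
  unfolding K2_Xi[OF x]
  using nabla3_S(3)[OF x frame_weight_m frame_weight_mb] nabla3_S(3)[OF x frame_weight_mb frame_weight_m]
   nabla3_S(4)[OF x frame_weight_m frame_weight_mb] nabla3_S(4)[OF x frame_weight_mb frame_weight_m]
  by (simp_all add: K3_S_mixed[OF x])

lemma ethb_sg:
  assumes x: "x \<in> U"
  shows "ethb 3 sg x = 2 * xi x - 2/3 * pb x * sg x"
  unfolding xi_eq[OF x] by simp

text \<open>The Laplacian term drops out as g(m,m) = 0. From \<open>T\<close> there remain
  \<open>sg\<close> and, through g(m,mb) = 2, the component 4 p; raising the index halves
  both.\<close>

lemma hess_V_frame:
  assumes x: "x \<in> U" and V: "V \<in> \<V>"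
  shows "K2 (hess g V) m m x = sg x * K1 (grad V) mb x / 2 + 2 * p x * K1 (grad V) m x + th x * of_real (V x)"
proof -
  have T: "K3 T m m u x = K3 S m m u x + 2 * p x * K2 gt m u x - K2 gt m m x * K1 (grad t) u x" for u
    by (simp add: K_defs sum_2 T_S[OF x] p_def grad_def algebra_simps)
  have Tr: "of_real (\<Sum>k\<in>UNIV. T x i j k * raise1 g (grad V) x k) =
      (K1 (\<lambda>x. T x i j) m x * K1 (grad V) mb x + K1 (\<lambda>x. T x i j) mb x * K1 (grad V) m x) / 2" for i j
    by (simp add: raise1_frame[OF x] K_defs sum_2 field_simps)
  have h: "complex_of_real (hess g V x i j) =
      (K1 (\<lambda>x. T x i j) m x * K1 (grad V) mb x + K1 (\<lambda>x. T x i j) mb x * K1 (grad V) m x) / 2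
      + of_real (g x $ i $ j) * of_real (laplacian g V x) / 2 + of_real (\<tau> x i j) * of_real (V x)" for i j
    unfolding hess_V[OF x V] of_real_add Tr by simp
  have "K2 (hess g V) m m x = (K3 T m m m x * K1 (grad V) mb x + K3 T m m mb x * K1 (grad V) m x) / 2
     + K2 gt m m x * of_real (laplacian g V x) / 2 + th x * of_real (V x)"
    unfolding K2_def[of "hess g V"] h th_def
    by (simp add: K2_def K3_def K1_def[of "\<lambda>x. T x _ _"] sum_2 field_simps)
  then show ?thesis
    unfolding T K2_g[OF x] sg_def K3_S_mixed[OF x] by (simp add: field_simps)
qed

end

section \<open>The jets of the potentials\<close>

lemma frechet_pd:
  fixes f :: "pt \<Rightarrow> real"
  assumes "f differentiable (at x)"
  shows "frechet_derivative f (at x) v = v $ 1 * pd 1 f x + v $ 2 * pd 2 f x"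
proof -
  have "v = v $ 1 *\<^sub>R axis 1 1 + v $ 2 *\<^sub>R axis 2 1"
    by (simp add: vec_eq_iff forall_2 axis_def)
  then have "frechet_derivative f (at x) v = frechet_derivative f (at x) (v $ 1 *\<^sub>R axis 1 1 + v $ 2 *\<^sub>R axis 2 1)"
    by simp
  then show ?thesis
    using linear_frechet_derivative[OF assms] by (simp add: linear_add linear_cmul pd_def)
qed

text \<open>Gronwall: \<open>\<phi>\<close> times exp(- K s) is nonincreasing, so it cannot rise
  above its initial value 0.\<close>

lemma nonneg_gronwall:
  fixes \<phi> :: "real \<Rightarrow> real"
  assumes der: "\<And>s. 0 \<le> s \<Longrightarrow> s \<le> 1 \<Longrightarrow> (\<phi> has_real_derivative \<phi>' s) (at s)"
    and bound: "\<And>s. 0 \<le> s \<Longrightarrow> s \<le> 1 \<Longrightarrow> \<phi>' s \<le> K * \<phi> s"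
    and nonneg: "\<phi> 1 \<ge> 0" and 0: "\<phi> 0 = 0"
  shows "\<phi> 1 = 0"
proof -
  define \<psi> where "\<psi> s = \<phi> s * exp (- K * s)" for s
  have "\<psi> 1 \<le> \<psi> 0"
  proof (rule DERIV_nonpos_imp_nonincreasing[of 0 1 \<psi>])
    fix s :: real assume s: "0 \<le> s" "s \<le> 1"
    have "(\<psi> has_real_derivative (\<phi>' s - K * \<phi> s) * exp (- K * s)) (at s)"
      unfolding \<psi>_def using der[OF s] by (auto intro!: derivative_eq_intros simp: algebra_simps)
    moreover have "(\<phi>' s - K * \<phi> s) * exp (- K * s) \<le> 0"
      using bound[OF s] by (simp add: mult_le_0_iff)
    ultimately show "\<exists>y. (\<psi> has_real_derivative y) (at s) \<and> y \<le> 0" by blast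
  qed simp
  then have "\<phi> 1 \<le> 0"
    using 0 by (simp add: \<psi>_def mult_le_0_iff)
  with nonneg show ?thesis by simp
qed

text \<open>The zero set of \<open>N\<close> is closed by continuity. It is open because
  \<open>M\<close> is bounded on a small closed ball, so Gronwall applies along each radius from a
  zero. Connectedness finishes.\<close>

lemma vanishing_of_gradient_bound:
  fixes N :: "pt \<Rightarrow> real"
  assumes U: "open U" "connected U" and x0: "x0 \<in> U" "N x0 = 0"
    and diff: "\<And>x. x \<in> U \<Longrightarrow> N differentiable (at x)"
    and nonneg: "\<And>x. x \<in> U \<Longrightarrow> N x \<ge> 0"
    and M: "continuous_on U M"
    and bound: "\<And>x i. x \<in> U \<Longrightarrow> \<bar>pd i N x\<bar> \<le> M x * N x"
    and y: "y \<in> U"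
  shows "N y = 0"
proof -
  have cont: "continuous_on U N"
    using diff by (auto intro!: continuous_at_imp_continuous_on differentiable_imp_continuous_within)
  have "openin (top_of_set U) {x \<in> U. N x = 0}"
  proof (subst openin_open_eq[OF U(1)], intro conjI)
    show "open {x \<in> U. N x = 0}"
      unfolding open_contains_ball
    proof
      fix x assume x: "x \<in> {x \<in> U. N x = 0}"
      then obtain r where r: "r > 0" "cball x r \<subseteq> U"
        using U(1) open_contains_cball by blast
      have "compact (M ` cball x r)"
        using continuous_on_subset[OF M r(2)] by (intro compact_continuous_image) auto
      then obtain B where B: "\<And>y. y \<in> cball x r \<Longrightarrow> M y \<le> B"
        by (meson bounded_imp_bdd_above bdd_above_def compact_imp_bounded imageI)
      have "N z = 0" if z: "z \<in> ball x r" for z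
      proof -
        define w where "w = z - x"
        define \<phi> where "\<phi> s = N (x + s *\<^sub>R w)" for s
        define \<phi>' where "\<phi>' s = w $ 1 * pd 1 N (x + s *\<^sub>R w) + w $ 2 * pd 2 N (x + s *\<^sub>R w)" for s
        have inb: "x + s *\<^sub>R w \<in> cball x r" if "0 \<le> s" "s \<le> 1" for s
        proof -
          have "norm (s *\<^sub>R w) \<le> 1 * norm w"
            using that by (simp add: mult_left_le_one_le)
          also have "\<dots> \<le> r"
            using z by (simp add: w_def dist_norm norm_minus_commute)
          finally show ?thesis by (simp add: dist_norm)
        qed
        have d: "(\<phi> has_real_derivative \<phi>' s) (at s)" if "0 \<le> s" "s \<le> 1" for s
        proof -
          have dN: "N differentiable (at (x + s *\<^sub>R w))"
            using diff inb[OF that] r by blast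
          have "((\<lambda>s. x + s *\<^sub>R w) has_derivative (\<lambda>h. h *\<^sub>R w)) (at s)"
            by (auto intro!: derivative_eq_intros)
          from has_derivative_compose[OF this dN[unfolded frechet_derivative_works]]
          have "(\<phi> has_derivative (\<lambda>h. frechet_derivative N (at (x + s *\<^sub>R w)) (h *\<^sub>R w))) (at s)"
            unfolding \<phi>_def .
          moreover have "(\<lambda>h. frechet_derivative N (at (x + s *\<^sub>R w)) (h *\<^sub>R w)) = (*) (\<phi>' s)"
            by (simp add: fun_eq_iff frechet_pd[OF dN] \<phi>'_def algebra_simps)
          ultimately show ?thesis
            by (simp add: has_field_derivative_def)
        qed
        have b: "\<phi>' s \<le> (\<bar>w $ 1\<bar> + \<bar>w $ 2\<bar>) * B * \<phi> s" if "0 \<le> s" "s \<le> 1" for s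
        proof -
          let ?y = "x + s *\<^sub>R w"
          have yU: "?y \<in> U" using inb[OF that] r by blast
          have "\<bar>pd i N ?y\<bar> \<le> B * N ?y" for i
            using order_trans[OF bound[OF yU, of i] mult_right_mono[OF B[OF inb[OF that]] nonneg[OF yU]]] .
          then have "\<bar>w $ i\<bar> * \<bar>pd i N ?y\<bar> \<le> \<bar>w $ i\<bar> * (B * N ?y)" for i
            by (rule mult_left_mono) simp
          from this[of 1] this[of 2] show ?thesis
            unfolding \<phi>'_def \<phi>_def abs_mult[symmetric] by (simp add: algebra_simps abs_le_iff)
        qed
        have "x + w \<in> U" using inb[of 1] r by auto
        then have "\<phi> 1 = 0"
          using nonneg_gronwall[of \<phi> \<phi>', OF d b] nonneg x by (simp add: \<phi>_def)
        then show ?thesis by (simp add: \<phi>_def w_def)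
      qed
      with r show "\<exists>e>0. ball x e \<subseteq> {x \<in> U. N x = 0}"
        by (intro exI[of _ r]) (use ball_subset_cball in blast)
    qed
  qed auto
  moreover have "closedin (top_of_set U) {x \<in> U. N x = 0}"
    using continuous_closedin_preimage_constant[OF cont, of 0] by simp
  ultimately have "{x \<in> U. N x = 0} = {} \<or> {x \<in> U. N x = 0} = U"
    using U(2) connected_clopen by blast
  then show ?thesis using x0 y by blast
qed

context structured_frame
begin

lemmas smooth_rules = csmooth_intros smooth_eth smooth_ethb smooth_comps smooth_aa smooth_cR

definition cf :: "(pt \<Rightarrow> real) \<Rightarrow> pt \<Rightarrow> complex" where "cf V = (\<lambda>x. of_real (V x))"

lemma cnj_cf [simp]: "cnj (cf V x) = cf V x"
  by (simp add: cf_def)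

lemma smooth_cf: "smooth_on U V \<Longrightarrow> csmooth U (cf V)"
  by (simp add: cf_def csmooth_of_real)

definition lap :: "(pt \<Rightarrow> real) \<Rightarrow> pt \<Rightarrow> complex" where "lap V = ethb 1 (eth 0 (cf V))"

lemma lap_laplacian: "x \<in> U \<Longrightarrow> smooth_on U V \<Longrightarrow> lap V x = of_real (laplacian g V x)"
  using laplacian_frame[of x V] by (simp add: lap_def cf_def)

lemma cnj_lap: "x \<in> U \<Longrightarrow> smooth_on U V \<Longrightarrow> cnj (lap V x) = lap V x"
  by (simp add: lap_laplacian)

lemma smooth_lap: "smooth_on U V \<Longrightarrow> csmooth U (lap V)"
  unfolding lap_def by (intro smooth_eth smooth_ethb smooth_cf)

lemma cnj_eth_cf:
  assumes "x \<in> U" "smooth_on U V"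
  shows "cnj (eth 0 (cf V) x) = ethb 0 (cf V) x" "cnj (ethb 0 (cf V) x) = eth 0 (cf V) x"
  using cnj_eth[OF assms(1) smooth_cf[OF assms(2)], of "cf V" 0] by (simp_all add: cf_def)

lemma potential_eth:
  assumes x: "x \<in> U" and V: "V \<in> \<V>" "smooth_on U V"
  shows "eth 1 (eth 0 (cf V)) x = 1/2 * sg x * ethb 0 (cf V) x + 2 * p x * eth 0 (cf V) x + th x * cf V x" (is ?P0)
    "ethb (- 1) (ethb 0 (cf V)) x = 1/2 * sgb x * eth 0 (cf V) x + 2 * pb x * ethb 0 (cf V) x + thb x * cf V x" (is ?P1)
    "eth (- 1) (ethb 0 (cf V)) x = lap V x" (is ?P2) "ethb 1 (eth 0 (cf V)) x = lap V x" (is ?P3)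
proof -
  show 1: ?P0
    using hess_V_frame[OF x V(1)] by (simp add: hess_frame[OF x V(2)] K1_grad cf_def)
  have "cnj (eth 1 (eth 0 (cf V)) x) = ethb (- 1) (ethb 0 (cf V)) x"
    by (rule cnj_eth[OF x]) (simp_all add: smooth_eth smooth_cf V cnj_eth_cf)
  then show ?P1
    unfolding 1 by (simp add: cnj_eth_cf[OF x V(2)])
  show ?P2 ?P3
    by (simp_all add: lap_def eth_ethb_0[OF x smooth_cf[OF V(2)]])
qed

text \<open>The coefficients of the closed system in \<open>eth_lap\<close>: \<open>cA\<close> and
  \<open>cB\<close> multiply the two components of dV, \<open>cE\<close> multiplies V. The term
  \<open>- cR\<close> in \<open>cA\<close> is the commutator on weight 1.\<close>

definition cA :: "pt \<Rightarrow> complex" where "cA x = 1/4 * sg x * sgb x + 2 * ethb 1 p x - cR x"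
definition cB :: "pt \<Rightarrow> complex" where "cB x = 1/2 * ethb 3 sg x + sg x * pb x + th x"
definition cE :: "pt \<Rightarrow> complex" where "cE x = 1/2 * sg x * thb x + ethb 2 th x"

lemma smooth_ABE: "csmooth U cA" "csmooth U cB" "csmooth U cE"
  unfolding cA_def cB_def cE_def by (intro smooth_rules)+

text \<open>\<open>ethb\<close> of the equation for \<open>eth 1 (eth 0 (cf V))\<close> is computed
  in two ways: by the product rule, and by commuting \<open>ethb\<close> inwards, where it produces
  \<open>lap V\<close>. Thus third derivatives add no new unknown to V, dV, \<Delta>V.\<close>

lemma eth_lap:
  assumes x: "x \<in> U" and V: "V \<in> \<V>" "smooth_on U V"
  shows "eth 0 (lap V) x = cA x * eth 0 (cf V) x + cB x * ethb 0 (cf V) x + 2 * p x * lap V x + cE x * cf V x"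
proof -
  note sV = smooth_cf[OF V(2)]
  have "ethb 2 (eth 1 (eth 0 (cf V))) x =
      ethb 2 (\<lambda>x. 1/2 * sg x * ethb 0 (cf V) x + 2 * p x * eth 0 (cf V) x + th x * cf V x) x"
    by (rule ethb_cong[OF x potential_eth(1)[OF _ V]])
  also have "\<dots> = 1/2 * (ethb 3 sg x * ethb 0 (cf V) x + sg x * ethb (- 1) (ethb 0 (cf V)) x)
      + 2 * (ethb 1 p x * eth 0 (cf V) x + p x * ethb 1 (eth 0 (cf V)) x)
      + ethb 2 th x * cf V x + th x * ethb 0 (cf V) x"
    using eth_mult(2)[OF x smooth_comps(3) smooth_ethb[OF sV], of 2 3 "- 1" 0]
      eth_mult(2)[OF x smooth_comps(1) smooth_eth[OF sV], of 2 1 1 0]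
      eth_mult(2)[OF x smooth_comps(5) sV, of 2 2 0]
    by (simp add: eth_linear_rules smooth_rules sV x mult.assoc)
  finally have 1: "ethb 2 (eth 1 (eth 0 (cf V))) x = \<dots>" .
  have "ethb (1 + 1) (eth 1 (eth 0 (cf V))) x = eth (1 - 1) (ethb 1 (eth 0 (cf V))) x + of_int 1 * cR x * eth 0 (cf V) x"
    by (rule commutator[OF x smooth_eth[OF sV]])
  then have 2: "ethb 2 (eth 1 (eth 0 (cf V))) x = eth 0 (lap V) x + cR x * eth 0 (cf V) x"
    by (simp add: lap_def)
  show ?thesis
    using 2 unfolding 1 potential_eth[OF x V] cA_def cB_def cE_def by (simp add: algebra_simps)
qed

text \<open>The square of the Euclidean norm of (V, dV, \<Delta>V); unlike the norm itself it is
  differentiable at zeros.\<close>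

definition jet_norm :: "(pt \<Rightarrow> real) \<Rightarrow> pt \<Rightarrow> real" where
  "jet_norm V x = (V x)\<^sup>2 + (cmod (eth 0 (cf V) x))\<^sup>2 + (laplacian g V x)\<^sup>2"

lemma of_real_jet_norm:
  assumes x: "x \<in> U" and V: "smooth_on U V"
  shows "of_real (jet_norm V x) = cf V x * cf V x + eth 0 (cf V) x * ethb 0 (cf V) x + lap V x * lap V x"
  unfolding jet_norm_def of_real_add complex_norm_square cnj_eth_cf[OF x V] lap_laplacian[OF x V]
  by (simp add: power2_eq_square) (simp add: cf_def)

text \<open>Sum of the moduli of the coefficients in the derivative of \<open>jet_norm\<close>: 3 =
  2 + 1 from the products V dV and dV \<Delta>V, and 6 = 2 + 4 from the two terms with
  \<open>p\<close>.\<close>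

definition jet_rate :: "pt \<Rightarrow> real" where
  "jet_rate x = 3 + 1/2 * cmod (sg x) + 6 * cmod (p x) + cmod (th x)
     + 2 * (cmod (cA x) + cmod (cB x) + cmod (cE x))"

text \<open>After substituting the closed system, every term is a coefficient times a product of two
  entries of the jet, and each such product is at most \<open>N\<close> because 2ab \<le> a^2 +
  b^2.\<close>

lemma eth_jet_norm:
  assumes x: "x \<in> U" and V: "V \<in> \<V>" "smooth_on U V"
  shows "cmod (eth 0 (cf (jet_norm V)) x) \<le> jet_rate x * jet_norm V x"
proof -
  note sV = smooth_cf[OF V(2)] smooth_lap[OF V(2)]
  define v where "v = cmod (eth 0 (cf V) x)"
  define w where "w = cmod (cf V x)"
  define l where "l = cmod (lap V x)"
  define N where "N = jet_norm V x"
  have vb: "cmod (ethb 0 (cf V) x) = v"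
    unfolding v_def cnj_eth_cf(1)[OF x V(2), symmetric] by simp
  have N: "N = w * w + v * v + l * l"
    by (simp add: N_def jet_norm_def w_def v_def l_def lap_laplacian[OF x V(2)] cf_def power2_eq_square)
  have nn: "v \<ge> 0" "w \<ge> 0" "l \<ge> 0" by (simp_all add: v_def w_def l_def)
  have sq: "0 \<le> w * w" "0 \<le> v * v" "0 \<le> l * l" by simp_all
  have "2 * (w * v) \<le> w * w + v * v" "2 * (v * l) \<le> v * v + l * l" "2 * (w * l) \<le> w * w + l * l"
    using sum_squares_bound[of w v] sum_squares_bound[of v l] sum_squares_bound[of w l]
    by (simp_all add: power2_eq_square mult.assoc)
  then have "2 * (w * v) \<le> N" "2 * (v * l) \<le> N" "2 * (w * l) \<le> N"
    and "v * v \<le> N" "l * l \<le> N" "w * w \<le> N"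
    using sq unfolding N by linarith+
  then have prod: "w * v \<le> N / 2" "v * l \<le> N / 2" "w * l \<le> N / 2" "v * v \<le> N" "l * l \<le> N" "w * w \<le> N"
    by simp_all
  have N0: "N \<ge> 0" unfolding N by simp
  have "eth 0 (cf (jet_norm V)) x = eth 0 (\<lambda>x. cf V x * cf V x + eth 0 (cf V) x * ethb 0 (cf V) x + lap V x * lap V x) x"
    by (rule eth_cong[OF x]) (simp add: cf_def[of "jet_norm V"] of_real_jet_norm V)
  also have "\<dots> = 2 * cf V x * eth 0 (cf V) x + eth 1 (eth 0 (cf V)) x * ethb 0 (cf V) x
      + eth 0 (cf V) x * eth (- 1) (ethb 0 (cf V)) x + 2 * lap V x * eth 0 (lap V) x"
    using eth_mult(1)[OF x sV(1) sV(1), of 0 0 0] eth_mult(1)[OF x sV(2) sV(2), of 0 0 0]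
      eth_mult(1)[OF x smooth_eth[OF sV(1)] smooth_ethb[OF sV(1)], of 0 1 "- 1" 0 0]
    by (simp add: eth_linear_rules smooth_rules sV x)
  finally have e: "eth 0 (cf (jet_norm V)) x = 2 * cf V x * eth 0 (cf V) x
      + 1/2 * sg x * ethb 0 (cf V) x * ethb 0 (cf V) x + 2 * p x * eth 0 (cf V) x * ethb 0 (cf V) x
      + th x * cf V x * ethb 0 (cf V) x
      + eth 0 (cf V) x * lap V x
      + 2 * cA x * eth 0 (cf V) x * lap V x + 2 * cB x * ethb 0 (cf V) x * lap V x
      + 4 * p x * lap V x * lap V x + 2 * cE x * cf V x * lap V x"
    unfolding potential_eth[OF x V] eth_lap[OF x V] by (simp add: algebra_simps)
  have b: "cmod (a * b * c) \<le> cmod a * N" if "cmod b * cmod c \<le> N" for a b c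
    using mult_left_mono[OF that norm_ge_zero[of a]] by (simp add: norm_mult mult.assoc)
  have vw: "v * w \<le> N" "v * l \<le> N" "w * l \<le> N" "w * v \<le> N"
    using prod N0 by (auto simp: mult.commute)
  have "cmod (eth 0 (cf (jet_norm V)) x) \<le> cmod 2 * N + cmod (1/2 * sg x) * N + cmod (2 * p x) * N
      + cmod (th x) * N + cmod 1 * N + cmod (2 * cA x) * N + cmod (2 * cB x) * N + cmod (4 * p x) * N + cmod (2 * cE x) * N"
    unfolding e
    by (intro order_trans[OF norm_triangle_ineq] add_mono b order_trans[OF _ b[of "eth 0 (cf V) x" "lap V x" 1]])
       (simp_all add: v_def[symmetric] w_def[symmetric] l_def[symmetric] vb prod vw norm_mult)
  also have "\<dots> = jet_rate x * N"
    by (simp add: jet_rate_def norm_mult algebra_simps)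
  finally show ?thesis by (simp add: N_def)
qed

lemma cmod_mb: "cmod (mb j x) = cmod (m j x)"
  by (simp only: mb_def complex_mod_cnj)

text \<open>Lowering the index of the gradient, whose raised components are (m cnj n + mb n)/2,
  recovers the coordinate derivative from the frame derivative \<open>n\<close>.\<close>

lemma pd_frame_bound:
  assumes x: "x \<in> U"
  shows "\<bar>pd i f x\<bar> \<le> (\<Sum>j\<in>UNIV. \<bar>g x $ i $ j\<bar> * cmod (m j x)) * cmod (eth 0 (cf f) x)"
proof -
  define n where "n = eth 0 (cf f) x"
  have n: "n = K1 (grad f) m x" "cnj n = K1 (grad f) mb x"
    by (simp_all add: n_def cf_def K1_grad[symmetric] cnj_K1)
  have "grad f x i = (\<Sum>j\<in>UNIV. g x $ i $ j * raise1 g (grad f) x j)"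
  proof -
    have "(\<Sum>j\<in>UNIV. g x $ i $ j * raise1 g (grad f) x j)
      = (\<Sum>k\<in>UNIV. (\<Sum>j\<in>UNIV. g x $ i $ j * ginv g x j k) * grad f x k)"
      by (simp add: raise1_def sum_2 algebra_simps)
    then show ?thesis
      using exhaust_2[of i] by (auto simp: g_ginv[OF x] sum_2)
  qed
  then have "complex_of_real (pd i f x) = (\<Sum>j\<in>UNIV. of_real (g x $ i $ j) * of_real (raise1 g (grad f) x j))"
    unfolding of_real_mult[symmetric] of_real_sum[symmetric] by (simp add: grad_def)
  then have c: "complex_of_real (pd i f x) = (\<Sum>j\<in>UNIV. of_real (g x $ i $ j) * ((m j x * cnj n + mb j x * n) / 2))"
    by (simp only: raise1_frame[OF x] n(2)[symmetric] n(1)[symmetric])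
  have t: "cmod (of_real (g x $ i $ j) * ((m j x * cnj n + mb j x * n) / 2)) \<le> \<bar>g x $ i $ j\<bar> * cmod (m j x) * cmod n" for j
  proof -
    have "cmod (m j x * cnj n + mb j x * n) \<le> 2 * (cmod (m j x) * cmod n)"
      using norm_triangle_ineq[of "m j x * cnj n" "mb j x * n"] by (simp add: norm_mult cmod_mb mult.commute)
    then have "cmod ((m j x * cnj n + mb j x * n) / 2) \<le> cmod (m j x) * cmod n"
      by (simp add: norm_divide)
    then show ?thesis
      unfolding norm_mult norm_of_real mult.assoc by (rule mult_left_mono) simp
  qed
  have "cmod (complex_of_real (pd i f x)) \<le> (\<Sum>j\<in>UNIV. \<bar>g x $ i $ j\<bar> * cmod (m j x) * cmod n)"
    unfolding c by (rule sum_norm_le) (rule t)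
  then show ?thesis
    unfolding norm_of_real sum_distrib_right n_def .
qed

lemma continuous_csmooth: "csmooth U f \<Longrightarrow> continuous_on U (\<lambda>x. cmod (f x))"
  unfolding cmod_def
  by (intro continuous_intros smooth_on_continuous smooth_on_Re smooth_on_Im)

lemma jet_vanishing:
  assumes V: "V \<in> \<V>" "smooth_on U V" and x0: "x0 \<in> U"
    and z: "V x0 = 0" "eth 0 (cf V) x0 = 0" "lap V x0 = 0" and y: "y \<in> U"
  shows "V y = 0"
proof -
  have conn: "connected U" using riem by (simp add: riemannian_surface_def)
  have sN: "smooth_on U (jet_norm V)"
  proof -
    have "csmooth U (\<lambda>x. cf V x * cf V x + eth 0 (cf V) x * ethb 0 (cf V) x + lap V x * lap V x)"
      by (intro smooth_rules smooth_cf smooth_lap V)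
    from smooth_on_Re[OF this] show ?thesis
      by (rule smooth_on_cong[OF open_U]) (simp add: of_real_jet_norm[OF _ V(2), symmetric])
  qed
  define M where "M x = (\<Sum>i\<in>UNIV. \<Sum>j\<in>UNIV. \<bar>g x $ i $ j\<bar> * cmod (m j x)) * jet_rate x" for x
  have "jet_norm V y = 0"
  proof (rule vanishing_of_gradient_bound[OF open_U conn x0 _ _ _ _ _ y])
    show "jet_norm V x0 = 0"
      using z lap_laplacian[OF x0 V(2)] by (simp add: jet_norm_def)
    show "continuous_on U M"
      unfolding M_def jet_rate_def
      by (intro continuous_on_sum continuous_on_mult continuous_on_add continuous_on_const continuous_on_rabs
          continuous_csmooth smooth_comps smooth_ABE smooth_m smooth_on_continuous smooth_g)
    fix x assume x: "x \<in> U"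
    show "jet_norm V differentiable (at x)"
      using sN x smooth_on_differentiable by blast
    show N0: "jet_norm V x \<ge> 0" by (simp add: jet_norm_def)
    fix i
    let ?c = "\<lambda>i. \<Sum>j\<in>UNIV. \<bar>g x $ i $ j\<bar> * cmod (m j x)"
    have c0: "?c i \<ge> 0" for i by (intro sum_nonneg) simp
    have r0: "jet_rate x \<ge> 0" by (simp add: jet_rate_def)
    have "\<bar>pd i (jet_norm V) x\<bar> \<le> ?c i * cmod (eth 0 (cf (jet_norm V)) x)"
      by (rule pd_frame_bound[OF x])
    also have "\<dots> \<le> ?c i * (jet_rate x * jet_norm V x)"
      by (rule mult_left_mono[OF eth_jet_norm[OF x V] c0])
    also have "\<dots> \<le> (\<Sum>i\<in>UNIV. ?c i) * (jet_rate x * jet_norm V x)"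
      by (rule mult_right_mono) (use c0 r0 N0 exhaust_2[of i] in \<open>auto simp: sum_2\<close>)
    finally show "\<bar>pd i (jet_norm V) x\<bar> \<le> M x * jet_norm V x"
      by (simp add: M_def mult.assoc)
  qed
  then show ?thesis
    by (simp add: jet_norm_def add_nonneg_eq_0_iff)
qed

lemma eth_linear:
  assumes x: "x \<in> U" and f: "\<And>k. csmooth U (f k)"
  shows "eth s (\<lambda>x. \<Sum>k<(n::nat). of_real (c k) * f k x) x = (\<Sum>k<n. of_real (c k) * eth s (f k) x)"
    "ethb s (\<lambda>x. \<Sum>k<n. of_real (c k) * f k x) x = (\<Sum>k<n. of_real (c k) * ethb s (f k) x)"
proof -
  have "dv u (\<lambda>x. \<Sum>k<n. of_real (c k) * f k x) x = (\<Sum>k<n. of_real (c k) * dv u (f k) x)" for u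
    by (induction n) (simp_all add: dv_add dv_mult csmooth_intros f x)
  then show "eth s (\<lambda>x. \<Sum>k<n. of_real (c k) * f k x) x = (\<Sum>k<n. of_real (c k) * eth s (f k) x)"
    "ethb s (\<lambda>x. \<Sum>k<n. of_real (c k) * f k x) x = (\<Sum>k<n. of_real (c k) * ethb s (f k) x)"
    unfolding eth_def ethb_def
    by (simp_all add: sum_distrib_left sum_subtractf sum.distrib algebra_simps)
qed

text \<open>\<open>jet_vanishing\<close> and linear independence of the basis make \<open>J\<close>
  injective on a four-dimensional space. Since \<open>lap V\<close> is real, the jet has exactly
  four real entries, so \<open>J\<close> is onto as well.\<close>

lemma jets_surjective:
  assumes basis: "basis_on U 4 B \<V>" and sm: "\<forall>V\<in>\<V>. smooth_on U V" and x0: "x0 \<in> U"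
  obtains V where "V \<in> \<V>" "smooth_on U V" "cf V x0 = of_real a" "eth 0 (cf V) x0 = b" "lap V x0 = of_real d"
proof -
  have VV: "\<V> = {f. \<exists>c. \<forall>z\<in>U. f z = (\<Sum>m<4. c m * B m z)}"
    and indep: "\<And>c. (\<forall>z\<in>U. (\<Sum>m<4. c m * B m z) = 0) \<Longrightarrow> (\<forall>m<4. c m = 0)"
    using basis unfolding basis_on_def by blast+
  define V where "V c = (\<lambda>z. \<Sum>m<4. c m * (if m < 4 then B m z else 0))" for c :: "nat \<Rightarrow> real"
  \<comment> \<open>The cutoff makes \<open>B' k\<close> smooth for every \<open>k\<close>, as
    \<open>eth_linear\<close> demands.\<close>
  define B' where "B' m = (\<lambda>z. if m < 4 then B m z else 0)" for m :: nat
  have V_mem: "V c \<in> \<V>" for c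
    unfolding VV V_def by (auto intro!: exI[of _ c])
  have sV: "smooth_on U (V c)" for c using sm V_mem by blast
  have sB: "smooth_on U (B' k)" for k
  proof (cases "k < 4")
    case True
    have "B k \<in> \<V>"
      unfolding VV using True by (auto intro!: exI[of _ "\<lambda>j. if j = k then 1 else 0"] simp: if_distrib[of "\<lambda>c. c * _"] cong: if_cong)
    with True sm show ?thesis by (simp add: B'_def)
  qed (simp add: B'_def smooth_on_const)
  have cfV: "cf (V c) = (\<lambda>x. \<Sum>k<4. of_real (c k) * cf (B' k) x)" for c
    by (simp add: cf_def V_def B'_def fun_eq_iff)
  have Vx: "V c x = (\<Sum>k<4. c k * B' k x)" for c x
    by (simp add: V_def B'_def)
  have e: "eth 0 (cf (V c)) x = (\<Sum>k<4. of_real (c k) * eth 0 (cf (B' k)) x)" if "x \<in> U" for c x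
    unfolding cfV by (rule eth_linear(1)[OF that smooth_cf[OF sB]])
  have l: "lap (V c) x0 = (\<Sum>k<4. of_real (c k) * lap (B' k) x0)" for c
  proof -
    have "lap (V c) x0 = ethb 1 (\<lambda>x. \<Sum>k<4. of_real (c k) * eth 0 (cf (B' k)) x) x0"
      unfolding lap_def by (rule ethb_cong[OF x0 e])
    then show ?thesis
      unfolding eth_linear(2)[OF x0 smooth_eth[OF smooth_cf[OF sB]]] lap_def .
  qed
  define coef :: "real^4 \<Rightarrow> nat \<Rightarrow> real" where
    "coef c k = (if k = 0 then c $ 1 else if k = 1 then c $ 2 else if k = 2 then c $ 3 else c $ 4)" for c k
  define J :: "real^4 \<Rightarrow> real^4" where
    "J c = (\<chi> i. if i = 1 then V (coef c) x0 else if i = 2 then Re (eth 0 (cf (V (coef c))) x0)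
       else if i = 3 then Im (eth 0 (cf (V (coef c))) x0) else Re (lap (V (coef c)) x0))" for c
  have four: "(\<Sum>k<4. h k) = h 0 + h 1 + h 2 + h 3" for h :: "nat \<Rightarrow> 'z::comm_monoid_add"
    by (simp add: eval_nat_numeral)
  have lin: "linear J"
    by (rule linearI)
       (simp_all add: J_def vec_eq_iff forall_4 e[OF x0] l Vx four coef_def algebra_simps)
  have "inj J"
  proof (rule linear_injective_0[OF lin, THEN iffD2], intro allI impI)
    fix c assume J0: "J c = 0"
    then have "V (coef c) x0 = 0" "Re (eth 0 (cf (V (coef c))) x0) = 0" "Im (eth 0 (cf (V (coef c))) x0) = 0"
      "Re (lap (V (coef c)) x0) = 0"
      unfolding J_def vec_eq_iff forall_4 by simp_all
    moreover have "lap (V (coef c)) x0 = of_real (Re (lap (V (coef c)) x0))"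
      using lap_laplacian[OF x0 sV] by simp
    ultimately have "V (coef c) y = 0" if "y \<in> U" for y
      by (intro jet_vanishing[OF V_mem sV x0 _ _ _ that]) (simp_all add: complex_eq_iff)
    then have "\<forall>k<4. coef c k = 0"
      by (intro indep) (simp add: V_def)
    then have "coef c 0 = 0" "coef c 1 = 0" "coef c 2 = 0" "coef c 3 = 0" by simp_all
    then show "c = 0" by (simp add: coef_def vec_eq_iff forall_4)
  qed
  then have "surj J" using lin linear_injective_imp_surjective by blast
  then obtain c where c: "(\<chi> i. if i = 1 then a else if i = 2 then Re b else if i = 3 then Im b else d) = J c"
    by (meson surjD)
  have r: "lap (V (coef c)) x0 = of_real (Re (lap (V (coef c)) x0))"
    using lap_laplacian[OF x0 sV] by simp
  show thesis
    by (rule that[OF V_mem sV, of "coef c"])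
       (use c r in \<open>simp_all add: J_def vec_eq_iff forall_4 complex_eq_iff cf_def\<close>)
qed

end

section \<open>Conformal Killing tensors\<close>

lemma quadratic_has_derivative:
  fixes C :: "pt \<Rightarrow> real^2^2"
  assumes C: "\<And>j k. (\<lambda>y. C y $ j $ k) differentiable (at x)" and W: "W differentiable (at x)"
  shows "(quadratic C W has_derivative (\<lambda>h.
      (\<Sum>j\<in>UNIV. \<Sum>k\<in>UNIV. frechet_derivative (\<lambda>y. C y $ j $ k) (at x) (fst h) * q $ j * q $ k
        + C x $ j $ k * (snd h $ j * q $ k + q $ j * snd h $ k))
      + frechet_derivative W (at x) (fst h))) (at (x, q))"
proof -
  have q: "quadratic C W = (\<lambda>z. (\<Sum>j\<in>UNIV. \<Sum>k\<in>UNIV. C (fst z) $ j $ k * snd z $ j * snd z $ k) + W (fst z))"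
    by (auto simp: fun_eq_iff quadratic_def inner_vec_def matrix_vector_mult_def sum_2 algebra_simps)
  have f: "(fst has_derivative fst) (at (x, q))"
    by (intro derivative_intros)
  have 1: "((\<lambda>z. C (fst z) $ j $ k) has_derivative (\<lambda>h. frechet_derivative (\<lambda>y. C y $ j $ k) (at x) (fst h))) (at (x, q))" for j k
    using has_derivative_compose[OF f, of "\<lambda>y. C y $ j $ k"] C[of j k] unfolding frechet_derivative_works by simp
  have 2: "((\<lambda>z. W (fst z)) has_derivative (\<lambda>h. frechet_derivative W (at x) (fst h))) (at (x, q))"
    using has_derivative_compose[OF f, of W] W unfolding frechet_derivative_works by simp
  have 3: "((\<lambda>z. snd z $ j) has_derivative (\<lambda>h. snd h $ j)) (at (x, q))" for j :: 2
    by (intro bounded_linear_imp_has_derivative bounded_linear_compose[OF bounded_linear_vec_nth bounded_linear_snd])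
  show ?thesis
    unfolding q
    by (rule has_derivative_eq_rhs[OF has_derivative_add[OF has_derivative_sum[OF has_derivative_sum[OF
        has_derivative_mult[OF has_derivative_mult[OF 1 3] 3]]] 2]])
       (simp add: fun_eq_iff sum_2 algebra_simps)
qed

lemma poisson_quadratic:
  fixes C D :: "pt \<Rightarrow> real^2^2"
  assumes C: "\<And>j k. (\<lambda>y. C y $ j $ k) differentiable (at x)" and W: "W differentiable (at x)"
    and D: "\<And>j k. (\<lambda>y. D y $ j $ k) differentiable (at x)" and V: "V differentiable (at x)"
    and sym: "C x $ 2 $ 1 = C x $ 1 $ 2" "D x $ 2 $ 1 = D x $ 1 $ 2"
  shows "poisson (quadratic C W) (quadratic D V) (x, q) =
    (\<Sum>i\<in>UNIV. ((\<Sum>j\<in>UNIV. \<Sum>k\<in>UNIV. pd i (\<lambda>y. C y $ j $ k) x * q $ j * q $ k) + pd i W x)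
        * (2 * (\<Sum>l\<in>UNIV. D x $ i $ l * q $ l))
      - (2 * (\<Sum>l\<in>UNIV. C x $ i $ l * q $ l))
        * ((\<Sum>j\<in>UNIV. \<Sum>k\<in>UNIV. pd i (\<lambda>y. D y $ j $ k) x * q $ j * q $ k) + pd i V x))"
proof -
  have z: "frechet_derivative f (at x) 0 = 0" if "f differentiable (at x)" for f :: "pt \<Rightarrow> real"
    using linear_frechet_derivative[OF that] by (rule linear_0)
  have d: "frechet_derivative (quadratic E X) (at (x, q)) = (\<lambda>h.
      (\<Sum>j\<in>UNIV. \<Sum>k\<in>UNIV. frechet_derivative (\<lambda>y. E y $ j $ k) (at x) (fst h) * q $ j * q $ k
        + E x $ j $ k * (snd h $ j * q $ k + q $ j * snd h $ k))
      + frechet_derivative X (at x) (fst h))"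
    if "\<And>j k. (\<lambda>y. E y $ j $ k) differentiable (at x)" "X differentiable (at x)" for E :: "pt \<Rightarrow> real^2^2" and X
    using frechet_derivative_at[OF quadratic_has_derivative[OF that]] by simp
  show ?thesis
    unfolding poisson_def d[OF C W] d[OF D V]
    by (simp add: z C W D V pd_def sum_2 axis_def sym algebra_simps)
qed

text \<open>Scaling \<open>q\<close> separates the cubic from the linear part, and sign changes
  separate the mixed monomials. The symmetrised coefficients vanish, so the form vanishes at complex
  arguments too.\<close>

lemma cubic_form_zero:
  fixes F :: "2 \<Rightarrow> 2 \<Rightarrow> 2 \<Rightarrow> real" and u :: "2 \<Rightarrow> complex"
  assumes "\<And>q :: real^2. (\<Sum>l\<in>UNIV. \<Sum>j\<in>UNIV. \<Sum>k\<in>UNIV. F l j k * q $ l * q $ j * q $ k) + (\<Sum>l\<in>UNIV. G l * q $ l) = 0"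
  shows "(\<Sum>l\<in>UNIV. \<Sum>j\<in>UNIV. \<Sum>k\<in>UNIV. of_real (F l j k) * u l * u j * u k) = 0"
proof -
  have e: "F 1 1 1 * a * a * a + (F 1 1 2 + F 1 2 1 + F 2 1 1) * a * a * b
      + (F 1 2 2 + F 2 1 2 + F 2 2 1) * a * b * b + F 2 2 2 * b * b * b + G 1 * a + G 2 * b = 0" for a b
    using assms[of "vector [a, b]"] by (simp add: sum_2 algebra_simps)
  have 1: "F 1 1 1 = 0" using e[of 1 0] e[of 2 0] by simp
  have 2: "F 2 2 2 = 0" using e[of 0 1] e[of 0 2] by simp
  have 3: "F 1 1 2 + F 1 2 1 + F 2 1 1 = 0" "F 1 2 2 + F 2 1 2 + F 2 2 1 = 0"
    using e[of 1 1] e[of 2 2] e[of 1 "-1"] e[of 2 "-2"] 1 2 by (simp_all add: algebra_simps)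
  have "(\<Sum>l\<in>UNIV. \<Sum>j\<in>UNIV. \<Sum>k\<in>UNIV. of_real (F l j k) * u l * u j * u k) =
     of_real (F 1 1 1) * u 1 * u 1 * u 1 + of_real (F 1 1 2 + F 1 2 1 + F 2 1 1) * u 1 * u 1 * u 2
      + of_real (F 1 2 2 + F 2 1 2 + F 2 2 1) * u 1 * u 2 * u 2 + of_real (F 2 2 2) * u 2 * u 2 * u 2"
    by (simp add: sum_2 algebra_simps)
  then show ?thesis by (simp only: 1 2 3 of_real_0 mult_zero_left add_0)
qed

locale framed_killing = null_frame U g m for U g m +
  fixes C :: "pt \<Rightarrow> real^2^2"
  assumes smooth_C: "smooth_on U (\<lambda>x. C x $ i $ j)"
    and sym_C: "x \<in> U \<Longrightarrow> transpose (C x) = C x"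
    and trace_C: "x \<in> U \<Longrightarrow> trace (C x ** g x) = 0"
begin

lemma C_sym: "x \<in> U \<Longrightarrow> C x $ i $ j = C x $ j $ i"
  using arg_cong[OF sym_C, of x "\<lambda>A. A $ j $ i"] by (simp add: transpose_def)

lemma C_sym21: "x \<in> U \<Longrightarrow> C x $ 2 $ 1 = C x $ 1 $ 2"
  by (rule C_sym)

definition low :: tensor2 where "low = lower2 g C"

lemma low_eq: "low x i j = (\<Sum>a\<in>UNIV. \<Sum>b\<in>UNIV. g x $ i $ a * C x $ a $ b * g x $ b $ j)"
  by (simp add: low_def lower2_def matrix_matrix_mult_def sum_2 algebra_simps)

lemma smooth_low: "smooth_on U (\<lambda>x. low x i j)"
  unfolding low_eq by (intro smooth_on_intros open_U smooth_g smooth_C)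

text \<open>The covector belonging to \<open>m\<close>. It serves as a complex momentum on which the
  kinetic term of the Hamiltonian is zero.\<close>

definition ml :: "2 \<Rightarrow> pt \<Rightarrow> complex" where
  "ml j x = (\<Sum>a\<in>UNIV. of_real (g x $ j $ a) * m a x)"

definition c :: "pt \<Rightarrow> complex" where "c = K2 low m m"
definition cb :: "pt \<Rightarrow> complex" where "cb = K2 low mb mb"

lemma smooth_ml: "csmooth U (ml j)"
  unfolding ml_def by (intro csmooth_intros smooth_g smooth_m)

lemma smooth_c [intro, simp]: "csmooth U c" "csmooth U cb"
  unfolding c_def cb_def by (intro smooth_K2 smooth_low smooth_m smooth_mb)+

lemma cnj_c [simp]: "cnj (c x) = cb x" "cnj (cb x) = c x"
  by (simp_all add: c_def cb_def cnj_K2)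

lemma low_mixed:
  assumes x: "x \<in> U"
  shows "K2 low m mb x = 0" "K2 low mb m x = 0"
proof -
  have s: "K2 low mb m x = K2 low m mb x"
    by (simp add: K_defs sum_2 low_eq g_sym21[OF x] C_sym21[OF x] algebra_simps)
  have t: "(\<Sum>a\<in>UNIV. \<Sum>b\<in>UNIV. ginv g x a b * low x a b) = 0"
  proof -
    have "(\<Sum>a\<in>UNIV. \<Sum>b\<in>UNIV. ginv g x a b * low x a b) =
       (\<Sum>b\<in>UNIV. \<Sum>c\<in>UNIV. \<Sum>d\<in>UNIV. (\<Sum>a\<in>UNIV. ginv g x b a * g x $ a $ c) * C x $ c $ d * g x $ d $ b)"
      by (simp add: low_eq sum_2 g_sym21[OF x] ginv_sym[OF x, of 2 1] algebra_simps)
    also have "\<dots> = trace (C x ** g x)"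
      by (simp only: ginv_g[OF x]) (simp add: sum_2 trace_def matrix_matrix_mult_def)
    finally show ?thesis using trace_C[OF x] by simp
  qed
  have "(K2 low m mb x + K2 low mb m x) / 2 = 0"
    unfolding ginv_trace[OF x, of low, symmetric] t by simp
  with s show "K2 low m mb x = 0" "K2 low mb m x = 0" by simp_all
qed

text \<open>With vanishing mixed component, \<open>C\<close> sends the covector of \<open>m\<close>
  to a multiple of \<open>mb\<close>; this is what being symmetric and trace-free means in the
  frame.\<close>

lemma C_ml:
  assumes x: "x \<in> U"
  shows "(\<Sum>l\<in>UNIV. of_real (C x $ i $ l) * ml l x) = c x * mb i x / 2"
proof -
  define w where "w i = (\<Sum>l\<in>UNIV. of_real (C x $ i $ l) * ml l x)" for i
  have "w i = (\<Sum>j\<in>UNIV. of_real (if i = j then 1 else 0) * w j)"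
    using exhaust_2[of i] by (auto simp: sum_2)
  also have "\<dots> = (\<Sum>j\<in>UNIV. of_real (\<Sum>k\<in>UNIV. ginv g x i k * g x $ k $ j) * w j)"
    unfolding ginv_g[OF x] ..
  also have "\<dots> = (\<Sum>j\<in>UNIV. (\<Sum>k\<in>UNIV. of_real (ginv g x i k) * of_real (g x $ k $ j)) * w j)"
    by simp
  also have "\<dots> = (m i x * K2 low mb m x + mb i x * K2 low m m x) / 2"
    unfolding ginv_frame[OF x] w_def ml_def K2_def low_eq sum_2 by (simp add: field_simps)
  finally show ?thesis
    unfolding w_def low_mixed[OF x] c_def by simp
qed

lemma ginv_ml:
  assumes x: "x \<in> U"
  shows "(\<Sum>l\<in>UNIV. of_real (ginv g x i l) * ml l x) = m i x"
proof -
  have "(\<Sum>l\<in>UNIV. of_real (ginv g x i l) * ml l x) = (\<Sum>j\<in>UNIV. of_real (\<Sum>k\<in>UNIV. ginv g x i k * g x $ k $ j) * m j x)"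
    by (simp add: ml_def sum_2 algebra_simps)
  also have "\<dots> = m i x"
    using exhaust_2[of i] by (auto simp: ginv_g[OF x] sum_2)
  finally show ?thesis .
qed

lemma m_ml: "x \<in> U \<Longrightarrow> (\<Sum>l\<in>UNIV. m l x * ml l x) = 0" "x \<in> U \<Longrightarrow> (\<Sum>l\<in>UNIV. mb l x * ml l x) = 2"
  using gram(1)[of x] gram(3)[of x] by (simp_all add: ml_def sum_2 algebra_simps)

lemma cpd_ml:
  assumes x: "x \<in> U"
  shows "cpd i (ml k) x = omega i x * ml k x + (\<Sum>a\<in>UNIV. of_real (christoffel g x a i k) * ml a x)"
proof -
  have "cpd i (ml k) x = (\<Sum>a\<in>UNIV. of_real (pd i (\<lambda>y. g y $ k $ a) x) * m a x + of_real (g x $ k $ a) * cpd i (m a) x)"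
    unfolding ml_def sum_2
    by (simp add: cpd_add cpd_mult cpd_of_real csmooth_intros smooth_g smooth_m x)
  then show ?thesis
    unfolding metric_compatible[OF x] cpd_m[OF x]
    by (simp add: ml_def sum_2 g_sym21[OF x] algebra_simps)
qed

lemma c_eq: "c x = (\<Sum>j\<in>UNIV. \<Sum>k\<in>UNIV. of_real (C x $ j $ k) * ml j x * ml k x)" if x: "x \<in> U"
  by (simp add: c_def K_defs low_eq ml_def sum_2 g_sym21[OF x] algebra_simps)

text \<open>The hypothesis is the Poisson bracket relation written out. Its cubic part at the
  complex momentum \<open>ml\<close> loses the unknown factor \<open>r\<close>, since that
  multiplies the inverse metric on a null covector. The rest is the derivative of \<open>c\<close>
  along \<open>m\<close>.\<close>

lemma eth_c_killing:
  assumes x: "x \<in> U"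
    and F: "\<And>q :: real^2. (\<Sum>i\<in>UNIV. ((\<Sum>j\<in>UNIV. \<Sum>k\<in>UNIV. pd i (\<lambda>y. C y $ j $ k) x * q $ j * q $ k) + pd i W x)
        * (2 * (\<Sum>l\<in>UNIV. ginv g x i l * q $ l))
      - (2 * (\<Sum>l\<in>UNIV. C x $ i $ l * q $ l))
        * ((\<Sum>j\<in>UNIV. \<Sum>k\<in>UNIV. pd i (\<lambda>y. ginv g y j k) x * q $ j * q $ k) + pd i V x))
      = (r \<bullet> q) * ((\<Sum>j\<in>UNIV. \<Sum>k\<in>UNIV. ginv g x j k * q $ j * q $ k) + V x)"
  shows "eth 2 c x = 0"
proof -
  define Fc where "Fc l j k = (\<Sum>i\<in>UNIV. 2 * pd i (\<lambda>y. C y $ j $ k) x * ginv g x i l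
      - 2 * C x $ i $ l * pd i (\<lambda>y. ginv g y j k) x) - r $ l * ginv g x j k" for l j k
  define Gc where "Gc l = (\<Sum>i\<in>UNIV. 2 * pd i W x * ginv g x i l - 2 * C x $ i $ l * pd i V x) - r $ l * V x" for l
  define P where "P i = (\<Sum>j\<in>UNIV. \<Sum>k\<in>UNIV. of_real (pd i (\<lambda>y. C y $ j $ k) x) * ml j x * ml k x)" for i
  define Q where "Q i = (\<Sum>j\<in>UNIV. \<Sum>k\<in>UNIV. of_real (pd i (\<lambda>y. ginv g y j k) x) * ml j x * ml k x)" for i
  have "(\<Sum>l\<in>UNIV. \<Sum>j\<in>UNIV. \<Sum>k\<in>UNIV. Fc l j k * q $ l * q $ j * q $ k) + (\<Sum>l\<in>UNIV. Gc l * q $ l) = 0" for q :: "real^2"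
    using F[of q] unfolding Fc_def Gc_def sum_2 inner_vec_def by (simp add: algebra_simps)
  from cubic_form_zero[of Fc Gc, OF this, of "\<lambda>j. ml j x"]
  have "0 = (\<Sum>i\<in>UNIV. 2 * P i * (\<Sum>l\<in>UNIV. of_real (ginv g x i l) * ml l x)
      - 2 * (\<Sum>l\<in>UNIV. of_real (C x $ i $ l) * ml l x) * Q i)
      - (\<Sum>l\<in>UNIV. of_real (r $ l) * ml l x) * (\<Sum>j\<in>UNIV. (\<Sum>k\<in>UNIV. of_real (ginv g x j k) * ml k x) * ml j x)"
    unfolding Fc_def P_def Q_def sum_2 by (simp add: algebra_simps)
  then have cubic: "(\<Sum>i\<in>UNIV. 2 * P i * m i x - c x * mb i x * Q i) = 0"
    unfolding ginv_ml[OF x] C_ml[OF x] m_ml(1)[OF x] by simp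
  have dc: "cpd i c x = P i + c x * (2 * omega i x + (\<Sum>j\<in>UNIV. \<Sum>a\<in>UNIV. mb j x * of_real (christoffel g x a i j) * ml a x))" for i
  proof -
    have "cpd i c x = cpd i (\<lambda>x. \<Sum>j\<in>UNIV. \<Sum>k\<in>UNIV. of_real (C x $ j $ k) * ml j x * ml k x) x"
      by (rule cpd_cong[OF x c_eq])
    also have "\<dots> = P i + 2 * (\<Sum>j\<in>UNIV. (\<Sum>l\<in>UNIV. of_real (C x $ j $ l) * ml l x) * cpd i (ml j) x)"
      unfolding P_def sum_2
      by (simp add: cpd_add cpd_mult cpd_of_real csmooth_intros smooth_C smooth_ml x C_sym21[OF x] algebra_simps)
    also have "\<dots> = P i + c x * ((\<Sum>j\<in>UNIV. mb j x * ml j x) * omega i x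
        + (\<Sum>j\<in>UNIV. \<Sum>a\<in>UNIV. mb j x * of_real (christoffel g x a i j) * ml a x))"
      unfolding C_ml[OF x] cpd_ml[OF x] by (simp add: sum_2 algebra_simps)
    finally show ?thesis unfolding m_ml(2)[OF x] .
  qed
  \<comment> \<open>The inverse metric is null on \<open>ml\<close> at every point; differentiating
    this identity expresses \<open>Q\<close> by Christoffel symbols.\<close>
  have dh: "Q i = - 2 * (\<Sum>k\<in>UNIV. \<Sum>a\<in>UNIV. m k x * of_real (christoffel g x a i k) * ml a x)" for i
  proof -
    have "0 = cpd i (\<lambda>x. \<Sum>j\<in>UNIV. \<Sum>k\<in>UNIV. of_real (ginv g x j k) * ml j x * ml k x) x"
    proof -
      have "cpd i (\<lambda>x. \<Sum>j\<in>UNIV. \<Sum>k\<in>UNIV. of_real (ginv g x j k) * ml j x * ml k x) x = cpd i (\<lambda>x. 0) x"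
      proof (rule cpd_cong[OF x])
        fix y assume y: "y \<in> U"
        have "(\<Sum>j\<in>UNIV. \<Sum>k\<in>UNIV. of_real (ginv g y j k) * ml j y * ml k y)
          = (\<Sum>j\<in>UNIV. (\<Sum>k\<in>UNIV. of_real (ginv g y j k) * ml k y) * ml j y)"
          by (simp add: sum_2 algebra_simps)
        then show "(\<Sum>j\<in>UNIV. \<Sum>k\<in>UNIV. of_real (ginv g y j k) * ml j y * ml k y) = 0"
          unfolding ginv_ml[OF y] m_ml(1)[OF y] .
      qed
      then show ?thesis by simp
    qed
    also have "\<dots> = Q i + 2 * (\<Sum>j\<in>UNIV. (\<Sum>l\<in>UNIV. of_real (ginv g x j l) * ml l x) * cpd i (ml j) x)"
      unfolding Q_def sum_2
      by (simp add: cpd_add cpd_mult cpd_of_real csmooth_intros smooth_ginv smooth_ml x ginv_sym[OF x, of 2 1] algebra_simps)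
    also have "\<dots> = Q i + 2 * ((\<Sum>j\<in>UNIV. m j x * ml j x) * omega i x
        + (\<Sum>j\<in>UNIV. \<Sum>a\<in>UNIV. m j x * of_real (christoffel g x a i j) * ml a x))"
      unfolding ginv_ml[OF x] cpd_ml[OF x] by (simp add: sum_2 algebra_simps)
    finally show ?thesis unfolding m_ml(1)[OF x] by (simp add: eq_neg_iff_add_eq_0)
  qed
  have s: "(\<Sum>i\<in>UNIV. P i * m i x) = - c x * (\<Sum>i\<in>UNIV. \<Sum>k\<in>UNIV. \<Sum>a\<in>UNIV. mb i x * m k x * of_real (christoffel g x a i k) * ml a x)" (is "_ = - c x * ?Y")
    using cubic unfolding dh sum_2 by algebra
  have "dv m c x = (\<Sum>i\<in>UNIV. P i * m i x) + 2 * c x * aa x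
    + c x * ?Y"
    unfolding dv_def dc
    by (simp add: aa_def sum_2 christoffel_sym[OF x, of _ 2 1] algebra_simps)
  then have "dv m c x = 2 * c x * aa x"
    unfolding s by simp
  then show ?thesis by (simp add: eth_def)
qed

lemma eth_c:
  assumes ci: "conformal_integral U (hamiltonian g V) C W" and V: "smooth_on U V" and x: "x \<in> U"
  shows "eth 2 c x = 0"
proof -
  obtain \<rho> where \<rho>: "\<And>q. poisson (quadratic C W) (hamiltonian g V) (x, q) = (\<rho> \<bullet> q) * hamiltonian g V (x, q)"
    using ci x unfolding conformal_integral_def by blast
  have W: "smooth_on U W"
    using ci by (simp add: conformal_integral_def)
  have h: "hamiltonian g V (x, q) = (\<Sum>j\<in>UNIV. \<Sum>k\<in>UNIV. ginv g x j k * q $ j * q $ k) + V x" for q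
    by (simp add: hamiltonian_def quadratic_def inner_vec_def matrix_vector_mult_def ginv_def sum_2 algebra_simps)
  note d = smooth_on_differentiable[OF _ x]
  note P = poisson_quadratic[of C x W "\<lambda>x. matrix_inv (g x)" V, OF d[OF smooth_C] d[OF W]
      d[OF smooth_ginv[unfolded ginv_def]] d[OF V] C_sym21[OF x] ginv_sym[OF x, of 2 1, unfolded ginv_def],
      folded hamiltonian_def ginv_def]
  show ?thesis
    by (rule eth_c_killing[OF x trans[OF P[symmetric] \<rho>[unfolded h]]])
qed

end

section \<open>The Bertrand-Darboux condition\<close>

locale framed_bd = structured_frame U g m \<V> T S \<tau> t + framed_killing U g m C
  for U g m \<V> T S \<tau> t C +
  fixes B :: "nat \<Rightarrow> pt \<Rightarrow> real"
  assumes basis: "basis_on U 4 B \<V>" and smooth_V: "\<forall>V\<in>\<V>. smooth_on U V"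
    and killing: "x \<in> U \<Longrightarrow> eth 2 c x = 0"
    and bd: "V \<in> \<V> \<Longrightarrow> bertrand_darboux U g C V"
begin

lemma nabla2_low:
  assumes x: "x \<in> U"
  shows "K3 (nabla2 g low) mb m m x = ethb 2 c x" "K3 (nabla2 g low) m mb m x = 0"
    "K3 (nabla2 g low) mb mb m x = 0"
  using nabla2_eth[where X=low, OF x smooth_low frame_weight_m frame_weight_m]
    nabla2_eth[where X=low, OF x smooth_low frame_weight_mb frame_weight_m]
  by (simp_all add: c_def eth_cong[OF x low_mixed(2)] ethb_cong[OF x low_mixed(2)] eth_0 ethb_0)

lemma smooth_bd_rho: "smooth_on U (\<lambda>x. bd_rho g C x k)"
  unfolding bd_rho_def low_def[symmetric] nabla2_def
  by (intro smooth_on_intros open_U smooth_ginv smooth_christoffel smooth_low) auto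

definition rho :: "pt \<Rightarrow> complex" where "rho = K1 (bd_rho g C) m"

lemma rho_eq:
  assumes x: "x \<in> U"
  shows "rho x = ethb 2 c x / 4"
proof -
  have *: "complex_of_real (bd_rho g C x k) = (K2 (\<lambda>x a b. nabla2 g low x a b k) m mb x + K2 (\<lambda>x a b. nabla2 g low x a b k) mb m x) / 4" for k
    unfolding bd_rho_def low_def[symmetric] of_real_divide ginv_trace[OF x, of "\<lambda>x a b. nabla2 g low x a b k"]
    by simp
  have "rho x = (K3 (nabla2 g low) m mb m x + K3 (nabla2 g low) mb m m x) / 4"
    unfolding rho_def K1_def * by (simp add: K_defs sum_2 field_simps)
  then show ?thesis
    using nabla2_low[OF x] by simp
qed

lemma bd_frame:
  assumes x: "x \<in> U" and V: "V \<in> \<V>"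
  shows "K2 (bd_expr g C V) m mb x = 1/2 * c x * ethb (- 1) (ethb 0 (cf V)) x
    + 1/2 * ethb 2 c x * ethb 0 (cf V) x - eth 0 (cf V) x * cnj (rho x) + cf V x * ethb 1 rho x"
proof -
  have sV: "smooth_on U V" using smooth_V V by blast
  have 1: "(\<Sum>a\<in>UNIV. \<Sum>b\<in>UNIV. ginv g x a b * low x b i * hess g V x a j) = (\<Sum>a\<in>UNIV. \<Sum>b\<in>UNIV. ginv g x a b * (low x b i * hess g V x a j))"
    "(\<Sum>a\<in>UNIV. \<Sum>b\<in>UNIV. ginv g x a b * nabla2 g low x j b i * pd a V x) = (\<Sum>a\<in>UNIV. \<Sum>b\<in>UNIV. ginv g x a b * (nabla2 g low x j b i * pd a V x))" for i j
    by (simp_all add: mult.assoc)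
  have bd: "complex_of_real (bd_expr g C V x i j) =
      (K2 (\<lambda>x a b. low x b i * hess g V x a j) m mb x + K2 (\<lambda>x a b. low x b i * hess g V x a j) mb m x) / 2
    + (K2 (\<lambda>x a b. nabla2 g low x j b i * pd a V x) m mb x + K2 (\<lambda>x a b. nabla2 g low x j b i * pd a V x) mb m x) / 2
    - of_real (grad V x i) * of_real (bd_rho g C x j) + of_real (V x) * of_real (nabla1 g (bd_rho g C) x j i)" for i j
    unfolding bd_expr_def low_def[symmetric] 1 of_real_add of_real_diff of_real_mult[of "pd i V x"] of_real_mult[of "V x"]
    unfolding ginv_trace[OF x, of "\<lambda>x a b. low x b i * hess g V x a j"]
      ginv_trace[OF x, of "\<lambda>x a b. nabla2 g low x j b i * pd a V x"] grad_def ..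
  have "K2 (bd_expr g C V) m mb x =
     (K2 low mb m x * K2 (hess g V) m mb x + K2 low m m x * K2 (hess g V) mb mb x) / 2
     + (K3 (nabla2 g low) mb mb m x * K1 (grad V) m x + K3 (nabla2 g low) mb m m x * K1 (grad V) mb x) / 2
     - K1 (grad V) m x * K1 (bd_rho g C) mb x + of_real (V x) * K2 (nabla1 g (bd_rho g C)) mb m x"
    unfolding K2_def[of "bd_expr g C V"] bd
    by (simp add: K_defs sum_2 grad_def field_simps)
  moreover have "K2 (nabla1 g (bd_rho g C)) mb m x = ethb 1 rho x"
    unfolding rho_def by (rule nabla1_eth(2)[where X="bd_rho g C", OF x smooth_bd_rho frame_weight_m])
  moreover have "K1 (bd_rho g C) mb x = cnj (rho x)"
    by (simp add: rho_def cnj_K1)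
  ultimately show ?thesis
    using nabla2_low[OF x]
    by (simp add: low_mixed[OF x] hess_frame[OF x sV] c_def K1_grad cf_def)
qed

text \<open>In dimension two the antisymmetric part of a real tensor is a single number, visible as
  the imaginary part of its (m, mb) component.\<close>

lemma bd_real:
  assumes x: "x \<in> U" and V: "V \<in> \<V>"
  shows "cnj (K2 (bd_expr g C V) m mb x) = K2 (bd_expr g C V) m mb x"
proof -
  have "bd_expr g C V x 2 1 = bd_expr g C V x 1 2"
    using bd[OF V] x by (simp add: bertrand_darboux_def)
  then show ?thesis
    unfolding cnj_K2 by (simp add: K_defs sum_2 algebra_simps)
qed

text \<open>The values a of V and b of dV are free, so reality must hold separately for the
  coefficient of \<open>a\<close>, the second claim, and for the part linear in \<open>b\<close>,
  which is equivalent to the first.\<close>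

lemma bd_jets:
  assumes x: "x \<in> U"
  shows "ethb 2 c x = 1/3 * sg x * cb x - 4/3 * pb x * c x" (is ?P0)
    "cnj (1/2 * c x * thb x + ethb 1 rho x) = 1/2 * c x * thb x + ethb 1 rho x" (is ?P1)
proof -
  define k where "k = ethb 2 c x"
  have E: "cnj (1/2 * c x * (1/2 * sgb x * b + 2 * pb x * cnj b + thb x * of_real a) + 1/2 * k * cnj b - b * cnj k / 4 + of_real a * ethb 1 rho x)
    = 1/2 * c x * (1/2 * sgb x * b + 2 * pb x * cnj b + thb x * of_real a) + 1/2 * k * cnj b - b * cnj k / 4 + of_real a * ethb 1 rho x" for a b
  proof -
    obtain V where V: "V \<in> \<V>" "smooth_on U V" "cf V x = of_real a" "eth 0 (cf V) x = b" "lap V x = of_real 0"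
      by (rule jets_surjective[OF basis smooth_V x])
    have vb: "ethb 0 (cf V) x = cnj b"
      using cnj_eth_cf(1)[OF x V(2)] V(4) by simp
    have "K2 (bd_expr g C V) m mb x = 1/2 * c x * (1/2 * sgb x * b + 2 * pb x * cnj b + thb x * of_real a) + 1/2 * k * cnj b - b * cnj k / 4 + of_real a * ethb 1 rho x"
      unfolding bd_frame[OF x V(1)] potential_eth(2)[OF x V(1,2)] V(3,4) vb rho_eq[OF x] k_def[symmetric]
      by (simp add: algebra_simps)
    then show ?thesis using bd_real[OF x V(1)] by simp
  qed
  show ?P1
    using E[of 0 1] by (simp add: algebra_simps)
  \<comment> \<open>If the part linear in \<open>b\<close> is A b + B cnj b, then this is B - cnj A,
    with A = (c sgb - cnj k)/4 and B = c pb + k/2.\<close>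
  define \<alpha> where "\<alpha> = c x * pb x + 3/4 * k - 1/4 * cb x * sg x"
  have "cnj \<alpha> * b = \<alpha> * cnj b" for b
    using E[of b 0] unfolding \<alpha>_def by (simp add: field_simps)
  from this[of 1] this[of \<i>] have "\<alpha> = 0" by (simp add: complex_eq_iff)
  then show ?P0
    unfolding k_def[symmetric] \<alpha>_def by algebra
qed

lemma eth_cb:
  assumes x: "x \<in> U"
  shows "ethb (- 2) cb x = 0" "eth (- 2) cb x = 1/3 * sgb x * c x - 4/3 * p x * cb x"
proof -
  have "cnj (eth 2 c x) = ethb (- 2) cb x" "cnj (ethb 2 c x) = eth (- 2) cb x"
    using cnj_eth[OF x smooth_c(1), of cb 2] by simp_all
  then show "ethb (- 2) cb x = 0" "eth (- 2) cb x = 1/3 * sgb x * c x - 4/3 * p x * cb x"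
    using killing[OF x] by (simp_all add: bd_jets[OF x])
qed

text \<open>Both derivatives of \<open>c\<close> are now known, \<open>eth\<close> by the Killing
  equation and \<open>ethb\<close> by Bertrand-Darboux, so the commutator is an algebraic relation
  between \<open>c\<close> and \<open>cb\<close>.\<close>

lemma killing_integrability:
  assumes x: "x \<in> U"
  shows "1/3 * (eth 3 sg x - 4/3 * p x * sg x) * cb x
    + (1/9 * sg x * sgb x - 4/3 * eth (- 1) pb x + 2 * cR x) * c x = 0"
proof -
  have "ethb 3 (eth 2 c) x = ethb 3 (\<lambda>x. 0) x"
    by (rule ethb_cong[OF x killing])
  then have 1: "eth 1 (ethb 2 c) x + 2 * cR x * c x = 0"
    using commutator[OF x smooth_c(1), of 2] by (simp add: ethb_0)
  have "eth 1 (ethb 2 c) x = eth 1 (\<lambda>x. 1/3 * (sg x * cb x) - 4/3 * (pb x * c x)) x"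
    by (rule eth_cong[OF x]) (simp add: bd_jets mult.assoc)
  also have "\<dots> = 1/3 * (eth 3 sg x * cb x + sg x * eth (- 2) cb x) - 4/3 * (eth (- 1) pb x * c x + pb x * eth 2 c x)"
    using eth_mult(1)[OF x smooth_comps(3) smooth_c(2), of 1 3 "- 2"]
      eth_mult(1)[OF x smooth_comps(2) smooth_c(1), of 1 "- 1" 2]
    by (simp add: eth_linear_rules csmooth_intros smooth_comps smooth_c x)
  finally have 2: "eth 1 (ethb 2 c) x = 1/3 * (eth 3 sg x * cb x + sg x * (1/3 * sgb x * c x - 4/3 * p x * cb x))
      - 4/3 * (eth (- 1) pb x * c x)"
    unfolding eth_cb[OF x] killing[OF x] by simp
  show ?thesis
    using 1 unfolding 2 by (simp add: algebra_simps)
qed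

text \<open>The real expression in \<open>bd_jets\<close> has the form A c + B cb. Subtracting its
  conjugate leaves (A - cnj B) c minus the conjugate, and \<open>Z\<close> is A - cnj B.\<close>

lemma bd_zeroth_order:
  assumes x: "x \<in> U"
  defines "Z \<equiv> 1/2 * thb x - 1/3 * ethb (- 1) pb x + 4/9 * pb x * pb x - cnj (1/12 * ethb 3 sg x - 1/9 * pb x * sg x)"
  shows "Z * c x - cnj Z * cb x = 0"
proof -
  have "ethb 1 rho x = ethb 1 (\<lambda>x. (1/3 * (sg x * cb x) - 4/3 * (pb x * c x)) / 4) x"
    by (rule ethb_cong[OF x]) (simp add: rho_eq bd_jets mult.assoc)
  also have "\<dots> = (1/3 * (ethb 3 sg x * cb x + sg x * ethb (- 2) cb x) - 4/3 * (ethb (- 1) pb x * c x + pb x * ethb 2 c x)) / 4"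
    using eth_mult(2)[OF x smooth_comps(3) smooth_c(2), of 1 3 "- 2"]
      eth_mult(2)[OF x smooth_comps(2) smooth_c(1), of 1 "- 1" 2]
    by (simp add: eth_linear_rules csmooth_intros smooth_comps smooth_c x)
  finally have r: "ethb 1 rho x = (1/3 * ethb 3 sg x * cb x - 4/3 * ethb (- 1) pb x * c x
     - 4/3 * pb x * (1/3 * sg x * cb x - 4/3 * pb x * c x)) / 4"
    unfolding eth_cb[OF x] bd_jets(1)[OF x] by (simp add: algebra_simps)
  have "Z * c x - cnj Z * cb x = (1/2 * c x * thb x + ethb 1 rho x) - cnj (1/2 * c x * thb x + ethb 1 rho x)"
    unfolding r Z_def by (simp add: algebra_simps add_divide_distrib diff_divide_distrib)
  then show ?thesis unfolding bd_jets(2)[OF x] by simp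
qed

end

section \<open>The structure equations\<close>

context framed_killing
begin

text \<open>Writing a real vector as the real part of l m, a trace-free symmetric endomorphism acts
  on the coordinate l by the antilinear map l \<mapsto> cnj(l c)/2.\<close>

lemma endomorphism_frame:
  assumes x: "x \<in> U"
  shows "((C x ** g x) *v (\<chi> i. Re (l * m i x))) $ i = Re (cnj (l * c x) * m i x) / 2"
proof -
  have "((C x ** g x) *v (\<chi> i. Re (l * m i x))) $ i = Re (l * (\<Sum>k\<in>UNIV. of_real (C x $ i $ k) * ml k x))"
    by (simp add: matrix_vector_mult_def matrix_matrix_mult_def ml_def sum_2 algebra_simps)
  also have "\<dots> = Re (l * c x * mb i x) / 2"
    unfolding C_ml[OF x] by (simp add: field_simps)
  also have "Re (l * c x * mb i x) = Re (cnj (l * c x * mb i x))"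
    by (rule cnj.simps(1)[symmetric])
  also have "cnj (l * c x * mb i x) = cnj (l * c x) * m i x"
    by simp
  finally show ?thesis .
qed

end

locale framed_system = structured_frame U g m \<V> T S \<tau> t
  + F1: framed_bd U g m \<V> T S \<tau> t C1 B + F2: framed_bd U g m \<V> T S \<tau> t C2 B
  for U g m \<V> T S \<tau> t C1 C2 B +
  assumes irreducible: "x \<in> U \<Longrightarrow> irreducible_endomorphisms {C1 x ** g x, C2 x ** g x}"
begin

text \<open>The determinant vanishes only if both components are real multiples of one \<gamma>.
  Then the two endomorphisms share an eigenvector, whose span contradicts irreducibility.\<close>

lemma independent:
  assumes x: "x \<in> U"
  shows "F1.c x * F2.cb x - F2.c x * F1.cb x \<noteq> 0"
proof
  assume dep: "F1.c x * F2.cb x - F2.c x * F1.cb x = 0"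
  have "\<exists>\<gamma> k1 k2. \<gamma> \<noteq> 0 \<and> F1.c x = of_real k1 * \<gamma> \<and> F2.c x = of_real k2 * \<gamma>"
  proof (cases "F2.c x = 0")
    \<comment> \<open>If both components vanish, any nonzero \<gamma> serves; 1 is taken, with zero
      multiples.\<close>
    case True
    then show ?thesis
      by (intro exI[of _ "if F1.c x = 0 then 1 else F1.c x"] exI[of _ "if F1.c x = 0 then 0 else 1"] exI[of _ 0]) simp
  next
    case False
    have "F2.cb x \<noteq> 0"
      unfolding F2.cnj_c(1)[symmetric] complex_cnj_zero_iff by (rule False)
    then have "cnj (F1.c x / F2.c x) = F1.c x / F2.c x"
      using dep False by (simp add: field_simps)
    then have "F1.c x / F2.c x = of_real (Re (F1.c x / F2.c x))"
      unfolding Reals_cnj_iff[symmetric] by (rule of_real_Re[symmetric])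
    then have "F1.c x = of_real (Re (F1.c x / F2.c x)) * F2.c x"
      using False by (simp add: nonzero_divide_eq_eq)
    then show ?thesis
      using False by (intro exI[of _ "F2.c x"] exI[of _ "Re (F1.c x / F2.c x)"] exI[of _ 1]) simp
  qed
  then obtain \<gamma> k1 k2 where \<gamma>: "\<gamma> \<noteq> 0" "F1.c x = of_real k1 * \<gamma>" "F2.c x = of_real k2 * \<gamma>" by blast
  \<comment> \<open>With l*l = cnj \<gamma> one has cnj(l \<gamma>) = cnj l * l * l, a positive
    multiple of l; so the real part of l m is an eigenvector of both endomorphisms.\<close>
  define l where "l = csqrt (cnj \<gamma>)"
  have l: "l * l = cnj \<gamma>" by (simp add: l_def power2_eq_square[symmetric])
  then have l0: "l \<noteq> 0" using \<gamma>(1) by auto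
  have cl: "cnj (l * (of_real k * \<gamma>)) = of_real (k * (cmod l)\<^sup>2) * l" for k
  proof -
    have "cnj (l * (of_real k * \<gamma>)) = cnj l * (of_real k * cnj \<gamma>)" by simp
    also have "\<dots> = of_real k * (l * cnj l) * l"
      unfolding l[symmetric] by (simp add: mult_ac)
    also have "\<dots> = of_real (k * (cmod l)\<^sup>2) * l"
      unfolding of_real_mult complex_norm_square ..
    finally show ?thesis .
  qed
  define w :: pt where "w = (\<chi> i. Re (l * m i x))"
  have ev1: "(C1 x ** g x) *v w = (k1 * (cmod l)\<^sup>2 / 2) *\<^sub>R w"
    by (simp only: vec_eq_iff w_def F1.endomorphism_frame[OF x] \<gamma>(2) cl) (simp add: field_simps)
  have ev2: "(C2 x ** g x) *v w = (k2 * (cmod l)\<^sup>2 / 2) *\<^sub>R w"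
    by (simp only: vec_eq_iff w_def F2.endomorphism_frame[OF x] \<gamma>(3) cl) (simp add: field_simps)
  have w0: "w \<noteq> 0"
  proof
    assume "w = 0"
    then have "Re (l * m i x) = 0" for i by (simp add: w_def vec_eq_iff)
    then have "l * m i x + cnj l * mb i x = 0" for i
      using complex_add_cnj[of "l * m i x"] by simp
    from this[of 1] this[of 2] have "l * (m 1 x * mb 2 x - m 2 x * mb 1 x) = 0" by algebra
    with l0 frame_independent[OF x] show False by simp
  qed
  have "(\<lambda>v. A *v v) ` span {w} \<subseteq> span {w}" if "A \<in> {C1 x ** g x, C2 x ** g x}" for A
  proof -
    have "\<exists>k. A *v w = k *\<^sub>R w" using that ev1 ev2 by auto
    then obtain k where "A *v w = k *\<^sub>R w" by blast
    then have "A *v (r *\<^sub>R w) = (r * k) *\<^sub>R w" for r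
      by (simp add: matrix_vector_mult_scaleR)
    then show ?thesis by (auto simp: span_singleton)
  qed
  then have "span {w} = {0} \<or> span {w} = UNIV"
    using irreducible[OF x] unfolding irreducible_endomorphisms_def by (meson subspace_span)
  then show False
  proof
    assume "span {w} = {0}"
    then show False using w0 span_base[of w "{w}"] by auto
  next
    assume "span {w} = UNIV"
    then have "dim (UNIV :: pt set) = dim {w}" by (metis dim_span)
    also have "\<dots> \<le> card {w}" by (rule dim_le_card') simp
    finally show False by simp
  qed
qed

text \<open>\<open>independent\<close> states that the determinant of this homogeneous system is
  nonzero.\<close>

lemma coefficients_vanish:
  assumes x: "x \<in> U" and "X * F1.cb x + Y * F1.c x = 0" "X * F2.cb x + Y * F2.c x = 0"
  shows "X = 0" "Y = 0"
proof -
  have "X * (F1.c x * F2.cb x - F2.c x * F1.cb x) = 0" "Y * (F1.c x * F2.cb x - F2.c x * F1.cb x) = 0"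
    using assms(2,3) by algebra+
  then show "X = 0" "Y = 0" using independent[OF x] by simp_all
qed

lemma eth_sg: "eth 3 sg x = 4/3 * p x * sg x" if x: "x \<in> U"
  using coefficients_vanish(1)[OF x F1.killing_integrability[OF x] F2.killing_integrability[OF x]]
  by simp

lemma eth_pb: "eth (- 1) pb x = 1/12 * sg x * sgb x + 3/2 * cR x" if x: "x \<in> U"
  using coefficients_vanish(2)[OF x F1.killing_integrability[OF x] F2.killing_integrability[OF x]]
  by (simp add: field_simps; algebra)

lemma p_alt: "p = eth 0 (cf t)" "pb = ethb 0 (cf t)"
  by (simp_all add: p_def pb_def cf_def K1_grad')

lemma ethb_p: "ethb 1 p x = 1/12 * sg x * sgb x + 3/2 * cR x" if x: "x \<in> U"
  using eth_ethb_0[OF x smooth_cf[OF smooth_t]] eth_pb[OF x] by (simp add: p_alt)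

lemma cnj_eth_p: "cnj (ethb (- 1) pb x) = eth 1 p x" "cnj (eth 1 p x) = ethb (- 1) pb x" if x: "x \<in> U"
  using cnj_eth[OF x smooth_comps(2), of p "- 1"] cnj_eth[OF x smooth_comps(1), of pb 1] by simp_all

text \<open>This is \<open>Z = 0\<close>, conjugated and solved for \<open>eth 1 p\<close>. The
  coefficient -1/12 of \<open>ethb 3 sg\<close> becomes -1/4, hence -1/2 for \<open>xi\<close>: here
  the minus sign of \<open>\<Xi>\<close> in the Hessian of \<open>t\<close> originates.\<close>

lemma eth_p: "eth 1 p x = 3/2 * th x + 4/3 * p x * p x - 1/2 * xi x + 1/2 * pb x * sg x" if x: "x \<in> U"
proof -
  have 1: "- cnj Z * F1.cb x + Z * F1.c x = 0 \<Longrightarrow> - cnj Z * F2.cb x + Z * F2.c x = 0 \<Longrightarrow> cnj Z = 0" for Z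
    using coefficients_vanish[OF x, of "- cnj Z" Z] by simp
  have "cnj (1/2 * thb x - 1/3 * ethb (- 1) pb x + 4/9 * pb x * pb x - cnj (1/12 * ethb 3 sg x - 1/9 * pb x * sg x)) = 0"
    by (rule 1) (use F1.bd_zeroth_order[OF x] F2.bd_zeroth_order[OF x] in \<open>simp_all only: add.commute minus_mult_left[symmetric] diff_conv_add_uminus\<close>)
  then have "1/2 * th x - 1/3 * eth 1 p x + 4/9 * p x * p x - (1/12 * ethb 3 sg x - 1/9 * pb x * sg x) = 0"
    by (simp add: cnj_eth_p[OF x])
  then show ?thesis
    unfolding ethb_sg[OF x] by (simp add: field_simps; algebra)
qed

lemma ethb_pb: "ethb (- 1) pb x = 3/2 * thb x + 4/3 * pb x * pb x - 1/2 * xib x + 1/2 * p x * sgb x" if x: "x \<in> U"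
  unfolding cnj_eth_p(2)[OF x, symmetric] eth_p[OF x] by simp

lemma eth_sgb: "eth (- 3) sgb x = 2 * xib x - 2/3 * p x * sgb x"
  "ethb (- 3) sgb x = 4/3 * pb x * sgb x" if x: "x \<in> U"
  using cnj_eth[OF x smooth_comps(3), of sgb 3] by (simp_all add: ethb_sg[OF x] eth_sg[OF x] flip: cnj_eth)

text \<open>The commutator on \<open>sg\<close>. One derivative of \<open>sg\<close> is known and
  the other defines \<open>xi\<close>, so the relation can be solved for \<open>eth 2 xi\<close>.
  Six permutations of 2/9 account for the coefficient 4/3.\<close>

lemma eth_xi: "eth 2 xi x = 4/3 * p x * xi x + 1/12 * sg x * sg x * sgb x" if x: "x \<in> U"
proof -
  have "ethb 4 (eth 3 sg) x = ethb 4 (\<lambda>x. 4/3 * (p x * sg x)) x"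
    by (rule ethb_cong[OF x]) (simp add: eth_sg)
  then have 1: "ethb 4 (eth 3 sg) x = 4/3 * (ethb 1 p x * sg x + p x * ethb 3 sg x)"
    using eth_mult(2)[OF x smooth_comps(1) smooth_comps(3), of 4 1 3]
    by (simp add: eth_linear_rules csmooth_intros smooth_comps x)
  have "eth 2 (ethb 3 sg) x = eth 2 (\<lambda>x. 2 * xi x - 2/3 * (pb x * sg x)) x"
    by (rule eth_cong[OF x]) (simp add: ethb_sg)
  then have 2: "eth 2 (ethb 3 sg) x = 2 * eth 2 xi x - 2/3 * (eth (- 1) pb x * sg x + pb x * eth 3 sg x)"
    using eth_mult(1)[OF x smooth_comps(2) smooth_comps(3), of 2 "- 1" 3]
    by (simp add: eth_linear_rules csmooth_intros smooth_comps x)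
  have 3: "ethb 4 (eth 3 sg) x = eth 2 (ethb 3 sg) x + 3 * cR x * sg x"
    using commutator[OF x smooth_comps(3), of 3] by simp
  show ?thesis
    using 3 unfolding 1 2 ethb_p[OF x] ethb_sg[OF x] eth_pb[OF x] eth_sg[OF x]
    by (simp add: field_simps; algebra)
qed

text \<open>The commutator on \<open>p\<close>, with the trace-free Hessian of \<open>t\<close> on
  one side and the gradient of its trace on the other; it links the divergences of
  \<open>\<tau>\<close> and \<open>\<Xi>\<close>.\<close>

lemma trace_integrability:
  assumes x: "x \<in> U"
  shows "3/2 * ethb 2 th x - 1/2 * ethb 2 xi x = - 5/12 * p x * sg x * sgb x - 3 * cR x * p x - 3/4 * sg x * thb x
     - 1/3 * pb x * pb x * sg x + 5/12 * sg x * xib x - pb x * xi x + 3/2 * eth 0 cR x"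
proof -
  have "ethb 2 (eth 1 p) x = ethb 2 (\<lambda>x. 3/2 * th x + 4/3 * (p x * p x) - 1/2 * xi x + 1/2 * (pb x * sg x)) x"
    by (rule ethb_cong[OF x]) (simp add: eth_p)
  then have 1: "ethb 2 (eth 1 p) x = 3/2 * ethb 2 th x + 4/3 * (2 * ethb 1 p x * p x) - 1/2 * ethb 2 xi x
      + 1/2 * (ethb (- 1) pb x * sg x + pb x * ethb 3 sg x)"
    using eth_mult(2)[OF x smooth_comps(1) smooth_comps(1), of 2 1 1]
      eth_mult(2)[OF x smooth_comps(2) smooth_comps(3), of 2 "- 1" 3]
    by (simp add: eth_linear_rules csmooth_intros smooth_comps x)
  have "eth 0 (ethb 1 p) x = eth 0 (\<lambda>x. 1/12 * (sg x * sgb x) + 3/2 * cR x) x"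
    by (rule eth_cong[OF x]) (simp add: ethb_p)
  then have 2: "eth 0 (ethb 1 p) x = 1/12 * (eth 3 sg x * sgb x + sg x * eth (- 3) sgb x) + 3/2 * eth 0 cR x"
    using eth_mult(1)[OF x smooth_comps(3) smooth_comps(4), of 0 3 "- 3"]
    by (simp add: eth_linear_rules csmooth_intros smooth_comps smooth_cR x)
  have 3: "ethb 2 (eth 1 p) x = eth 0 (ethb 1 p) x + cR x * p x"
    using commutator[OF x smooth_comps(1), of 1] by simp
  show ?thesis
    using 3 unfolding 1 2 ethb_p[OF x] ethb_sg[OF x] ethb_pb[OF x] eth_sg[OF x] eth_sgb[OF x]
    by (simp add: field_simps; algebra)
qed

text \<open>\<open>ethb 1 (eth 0 (lap V))\<close> is the Laplacian of the real function \<Delta>V.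
  On jets with V = \<Delta>V = 0 it equals X b + Y cnj b, and reality for all b gives Y = cnj X; the
  terms 2 pb cB then cancel.\<close>

lemma potential_integrability:
  assumes x: "x \<in> U"
  shows "eth 0 cA x + 1/2 * cnj (cB x) * sg x - ethb 2 cB x - 2 * p x * cA x - cE x = 0"
proof -
  have A: "cA y = 5/12 * (sg y * sgb y) + 2 * cR y" if "y \<in> U" for y
    unfolding cA_def ethb_p[OF that] by simp
  then have cnjA: "cnj (cA y) = cA y" if "y \<in> U" for y
    using that by simp
  define X where "X = ethb 0 cA x + 1/2 * cB x * sgb x + 2 * p x * cnj (cB x)"
  define Y where "Y = ethb 2 cB x + 2 * pb x * cB x + 2 * p x * cA x + cE x"
  have E: "cnj (X * b + Y * cnj b) = X * b + Y * cnj b" for b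
  proof -
    obtain V where V: "V \<in> \<V>" "smooth_on U V" "cf V x = of_real 0" "eth 0 (cf V) x = b" "lap V x = of_real 0"
      by (rule jets_surjective[OF F1.basis F1.smooth_V x])
    note sV = smooth_cf[OF V(2)] smooth_lap[OF V(2)]
    have vb: "ethb 0 (cf V) x = cnj b"
      using cnj_eth_cf(1)[OF x V(2)] V(4) by simp
    have eL: "cnj (eth 0 (lap V) y) = ethb 0 (lap V) y" if "y \<in> U" for y
      using cnj_eth(1)[OF that sV(2), of "lap V" 0] by (simp add: cnj_lap[OF _ V(2)])
    have "ethb 1 (eth 0 (lap V)) x = ethb 1 (\<lambda>x. cA x * eth 0 (cf V) x + cB x * ethb 0 (cf V) x + 2 * (p x * lap V x) + cE x * cf V x) x"
      by (rule ethb_cong[OF x]) (simp add: eth_lap[OF _ V(1,2)])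
    then have "ethb 1 (eth 0 (lap V)) x = ethb 0 cA x * eth 0 (cf V) x + cA x * ethb 1 (eth 0 (cf V)) x
        + (ethb 2 cB x * ethb 0 (cf V) x + cB x * ethb (- 1) (ethb 0 (cf V)) x)
        + 2 * (ethb 1 p x * lap V x + p x * ethb 0 (lap V) x)
        + (ethb 1 cE x * cf V x + cE x * ethb 0 (cf V) x)"
      using eth_mult(2)[OF x smooth_ABE(1) smooth_eth[OF sV(1)], of 1 0 1 0]
        eth_mult(2)[OF x smooth_ABE(2) smooth_ethb[OF sV(1)], of 1 2 "- 1" 0]
        eth_mult(2)[OF x smooth_comps(1) sV(2), of 1 1 0]
        eth_mult(2)[OF x smooth_ABE(3) sV(1), of 1 1 0]
      by (simp add: eth_linear_rules smooth_rules smooth_ABE sV x)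
    then have D: "ethb 1 (eth 0 (lap V)) x = X * b + Y * cnj b"
      unfolding eL[OF x, symmetric] eth_lap[OF x V(1,2)] potential_eth[OF x V(1,2)] V(3-5) vb X_def Y_def
      by (simp add: V vb cnjA[OF x] algebra_simps)
    have "cnj (ethb 1 (eth 0 (lap V)) x) = eth (- 1) (ethb 0 (lap V)) x"
      by (rule cnj_eth(2)[OF x smooth_eth[OF sV(2)]]) (simp add: eL)
    then show ?thesis
      unfolding eth_ethb_0[OF x sV(2)] D .
  qed
  from E[of 1] E[of \<i>] have "Y = cnj X"
    by (simp add: complex_eq_iff)
  moreover have "cnj (ethb 0 cA x) = eth 0 cA x"
    using cnj_eth(2)[OF x smooth_ABE(1), of cA 0] cnjA by simp
  ultimately show ?thesis
    unfolding X_def Y_def by (simp add: algebra_simps)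
qed

lemma divergence_integrability:
  assumes x: "x \<in> U"
  shows "ethb 2 xi x + 2 * ethb 2 th x = - 5/9 * p x * sg x * sgb x + 5/3 * sg x * xib x - sg x * thb x
     + 2 * eth 0 cR x - 4 * cR x * p x - 4/3 * pb x * xi x - 4/9 * pb x * pb x * sg x"
proof -
  have A: "cA y = 5/12 * (sg y * sgb y) + 2 * cR y" if "y \<in> U" for y
    unfolding cA_def ethb_p[OF that] by simp
  have Bq: "cB y = xi y + 2/3 * (sg y * pb y) + th y" if "y \<in> U" for y
    unfolding cB_def ethb_sg[OF that] by (simp add: field_simps; algebra)
  have "eth 0 cA x = eth 0 (\<lambda>y. 5/12 * (sg y * sgb y) + 2 * cR y) x"
    by (rule eth_cong[OF x A])
  then have 1: "eth 0 cA x = 5/12 * (eth 3 sg x * sgb x + sg x * eth (- 3) sgb x) + 2 * eth 0 cR x"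
    using eth_mult(1)[OF x smooth_comps(3) smooth_comps(4), of 0 3 "- 3"]
    by (simp add: eth_linear_rules csmooth_intros smooth_comps smooth_cR x)
  have "ethb 2 cB x = ethb 2 (\<lambda>y. xi y + 2/3 * (sg y * pb y) + th y) x"
    by (rule ethb_cong[OF x Bq])
  then have 2: "ethb 2 cB x = ethb 2 xi x + 2/3 * (ethb 3 sg x * pb x + sg x * ethb (- 1) pb x) + ethb 2 th x"
    using eth_mult(2)[OF x smooth_comps(3) smooth_comps(2), of 2 3 "- 1"]
    by (simp add: eth_linear_rules csmooth_intros smooth_comps x)
  have 3: "cnj (cB x) = xib x + 2/3 * (sgb x * p x) + thb x"
    unfolding Bq[OF x] by simp
  show ?thesis
    using potential_integrability[OF x]
    unfolding 1 2 3 A[OF x] cE_def eth_sg[OF x] eth_sgb[OF x] ethb_sg[OF x] ethb_pb[OF x]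
    by (simp add: field_simps; algebra)
qed

text \<open>Three quarters of \<open>divergence_integrability\<close> has the same
  \<open>ethb 2 th\<close> term as \<open>trace_integrability\<close>; in the difference the
  curvature terms cancel as well.\<close>

lemma ethb_xi: "ethb 2 xi x = 2/3 * sg x * xib x" if x: "x \<in> U"
  using trace_integrability[OF x] divergence_integrability[OF x] by (simp add: field_simps; algebra)

lemma ethb_th: "ethb 2 th x = - 1/2 * sg x * thb x + 1/2 * sg x * xib x - 2/3 * pb x * xi x
    - 2/9 * pb x * pb x * sg x - 5/18 * p x * sg x * sgb x + eth 0 cR x - 2 * cR x * p x" if x: "x \<in> U"
  using divergence_integrability[OF x] unfolding ethb_xi[OF x] by (simp add: field_simps; algebra)

end

section \<open>Conformal transformations\<close>

lemma smooth_on_coordinate: "smooth_on U (\<lambda>x::pt. x $ i)"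
proof -
  have d: "((\<lambda>x::pt. x $ i) has_derivative (\<lambda>h. h $ i)) (at x)" for x
    by (intro bounded_linear_imp_has_derivative bounded_linear_vec_nth)
  then have "pd j (\<lambda>x::pt. x $ i) = (\<lambda>x. axis j 1 $ i)" for j
    by (intro ext pd_has_derivative)
  then have "Ck_on (Suc k) U (\<lambda>x::pt. x $ i)" for k
    using d by (auto simp: Ck_on_const differentiable_def)
  then show ?thesis
    unfolding smooth_on_def using Ck_on_Suc_imp by blast
qed

lemma pd_coordinate: "pd j (\<lambda>x::pt. x $ i) x = (if i = j then 1 else 0)"
proof -
  have "((\<lambda>x::pt. x $ i) has_derivative (\<lambda>h. h $ i)) (at x)"
    by (intro bounded_linear_imp_has_derivative bounded_linear_vec_nth)
  from pd_has_derivative[OF this] show ?thesis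
    by (simp add: axis_def)
qed

lemma (in riemannian_domain) conformal_riemannian:
  assumes \<Omega>: "smooth_on U \<Omega>" "\<And>x. x \<in> U \<Longrightarrow> \<Omega> x \<noteq> 0"
  shows "riemannian_surface U (conf_metric \<Omega> g)"
  unfolding riemannian_surface_def
proof (intro conjI allI ballI impI)
  show "open U" "connected U" "U \<noteq> {}"
    using riem by (simp_all add: riemannian_surface_def)
  show "smooth_on U (\<lambda>x. conf_metric \<Omega> g x $ i $ j)" for i j
    unfolding conf_metric_def power2_eq_square vector_scaleR_component
    by (simp, intro smooth_on_intros open_U \<Omega> smooth_g)
  fix x assume x: "x \<in> U"
  show "transpose (conf_metric \<Omega> g x) = conf_metric \<Omega> g x"
    using g_sym[OF x] by (simp add: vec_eq_iff transpose_def conf_metric_def)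
  fix v :: pt assume "v \<noteq> 0"
  then show "v \<bullet> (conf_metric \<Omega> g x *v v) > 0"
    using g_pos[OF x, of v] \<Omega>(2)[OF x]
    by (simp add: conf_metric_def scaleR_matrix_vector_assoc[symmetric])
qed

text \<open>The transformed tensors enter through their defining equations only; how
  \<open>S\<close> and \<open>t\<close> change is derived in \<open>conf_potential\<close>.\<close>

locale conformal_change = structured_frame U g m \<V> T S \<tau> t for U g m \<V> T S \<tau> t +
  fixes B :: "nat \<Rightarrow> pt \<Rightarrow> real" and \<Omega> :: "pt \<Rightarrow> real" and T' S' :: tensor3 and \<tau>' :: tensor2 and t' :: "pt \<Rightarrow> real"
  assumes basis: "basis_on U 4 B \<V>" and smooth_V: "\<forall>V\<in>\<V>. smooth_on U V"
    and smooth_Omega: "smooth_on U \<Omega>" and Omega_nz: "x \<in> U \<Longrightarrow> \<Omega> x \<noteq> 0"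
    and str': "structure_tensors U (conf_metric \<Omega> g) (conf_potentials U \<Omega> \<V>) T' \<tau>'"
    and con': "conformal_structure U (conf_metric \<Omega> g) T' S' t'"
begin

text \<open>\<open>\<Omega>\<close> may be negative. Rescaling the frame by its inverse is still
  correct since the metric contains \<open>\<Omega>\<close> squared.\<close>

definition w :: "pt \<Rightarrow> complex" where "w x = of_real (inverse (\<Omega> x))"

definition m' :: "2 \<Rightarrow> pt \<Rightarrow> complex" where "m' i x = w x * m i x"

lemma smooth_w [intro]: "csmooth U w"
  unfolding w_def by (intro csmooth_of_real smooth_on_inverse open_U smooth_Omega Omega_nz)

lemma cnj_w [simp]: "cnj (w x) = w x"
  by (simp add: w_def)

lemma w_nz: "x \<in> U \<Longrightarrow> w x \<noteq> 0"
  by (simp add: w_def Omega_nz)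

lemma conf_metric_w:
  assumes "x \<in> U"
  shows "of_real (conf_metric \<Omega> g x $ i $ j) * (w x * a) * (w x * b) = of_real (g x $ i $ j) * a * b"
proof -
  have "of_real (conf_metric \<Omega> g x $ i $ j) * (w x * a) * (w x * b)
    = of_real (\<Omega> x * inverse (\<Omega> x)) * of_real (\<Omega> x * inverse (\<Omega> x)) * (of_real (g x $ i $ j) * a * b)"
    by (simp only: conf_metric_def w_def vector_scaleR_component real_scaleR_def of_real_mult power2_eq_square mult_ac)
  then show ?thesis by (simp add: Omega_nz[OF assms])
qed

sublocale conf: structured_frame U "conf_metric \<Omega> g" m' "conf_potentials U \<Omega> \<V>" T' S' \<tau>' t'
proof unfold_locales
  show "riemannian_surface U (conf_metric \<Omega> g)"
    by (rule conformal_riemannian[OF smooth_Omega Omega_nz])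
  show "csmooth U (m' i)" for i
    unfolding m'_def by (intro csmooth_intros smooth_w smooth_m)
  fix x assume x: "x \<in> U"
  show "(\<Sum>i\<in>UNIV. \<Sum>j\<in>UNIV. complex_of_real (conf_metric \<Omega> g x $ i $ j) * m' i x * m' j x) = 0"
    unfolding m'_def conf_metric_w[OF x] by (rule null_m[OF x])
  show "(\<Sum>i\<in>UNIV. \<Sum>j\<in>UNIV. complex_of_real (conf_metric \<Omega> g x $ i $ j) * m' i x * cnj (m' j x)) = 2"
    unfolding m'_def complex_cnj_mult cnj_w conf_metric_w[OF x] by (rule norm_m[OF x])
qed (rule str' con')+

lemma conf_mb: "conf.mb i x = w x * mb i x"
  by (simp only: conf.mb_def m'_def mb_def complex_cnj_mult cnj_w)

lemma conf_dv: "dv m' f x = w x * dv m f x" "dv conf.mb f x = w x * dv mb f x"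
  by (simp_all add: dv_def m'_def conf_mb sum_distrib_left mult.assoc)

lemma cnj_dv_w: "x \<in> U \<Longrightarrow> cnj (dv m w x) = dv mb w x"
  using dv_cnj[OF smooth_w, of x m] by simp

text \<open>The commutator of the frame fields determines the connection coefficient, since it can be
  tested on the coordinate functions.\<close>

lemma conf_aa:
  assumes x: "x \<in> U"
  shows "conf.aa x = w x * aa x - dv m w x"
proof -
  define e where "e = w x * aa x - dv m w x - conf.aa x"
  have "cnj e * m i x = e * mb i x" for i
  proof -
    define f where "f = (\<lambda>x::pt. complex_of_real (x $ i))"
    have f: "csmooth U f"
      unfolding f_def by (intro csmooth_of_real smooth_on_coordinate)
    have mf: "dv u f x = u i x" for u
      using exhaust_2[of i] by (auto simp: dv_def f_def cpd_of_real pd_coordinate sum_2)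
    have "dv m' (dv conf.mb f) x = w x * dv m (\<lambda>x. w x * dv mb f x) x"
      "dv conf.mb (dv m' f) x = w x * dv mb (\<lambda>x. w x * dv m f x) x"
      unfolding conf_dv by (simp_all add: conf_dv cong: dv_cong)
    then have "w x * (w x * (dv m (dv mb f) x - dv mb (dv m f) x) + dv m w x * mb i x - dv mb w x * m i x)
       = cnj (conf.aa x) * (w x * m i x) - conf.aa x * (w x * mb i x)"
      using conf.frame_commutator[OF x f]
      by (simp add: dv_mult smooth_w csmooth_dv smooth_m smooth_mb f x conf_dv mf conf_mb m'_def algebra_simps)
    then have "w x * (cnj e * m i x - e * mb i x) = 0"
      unfolding frame_commutator[OF x f] mf e_def by (simp add: cnj_dv_w[OF x] algebra_simps)
    then show ?thesis using w_nz[OF x] by simp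
  qed
  from this[of 1] this[of 2] have "e * (m 1 x * mb 2 x - m 2 x * mb 1 x) = 0" by algebra
  then have "e = 0" using frame_independent[OF x] by simp
  then show ?thesis by (simp add: e_def)
qed

lemma conf_eth:
  assumes x: "x \<in> U"
  shows "conf.eth s f x = w x * eth s f x + of_int s * dv m w x * f x"
    "conf.ethb s f x = w x * ethb s f x - of_int s * dv mb w x * f x"
  by (simp_all add: conf.eth_def conf.ethb_def eth_def ethb_def conf_dv conf_aa[OF x] cnj_dv_w[OF x] algebra_simps)

text \<open>The second derivative of the rescaled potential is computed from either system and
  compared on jets with V = 0 and dV = b arbitrary. In the frame \<open>m'\<close> the result reads
  S \<mapsto> \<Omega>^2 S and dt \<mapsto> dt - 3 d ln|\<Omega>|.\<close>

lemma conf_potential: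
  assumes x: "x \<in> U"
  shows "conf.sg x = w x * sg x" "conf.p x = w x * p x + 3 * dv m w x"
proof -
  define w1 where "w1 = dv m w"
  have sw1: "csmooth U w1" unfolding w1_def by (intro csmooth_dv smooth_m smooth_w)
  have E: "w x * (1/2 * sg x * cnj b + 2 * p x * b) + 6 * w1 x * b = 1/2 * conf.sg x * cnj b + 2 * conf.p x * b" for b
  proof -
    obtain V where V: "V \<in> \<V>" "smooth_on U V" "cf V x = of_real 0" "eth 0 (cf V) x = b" "lap V x = of_real 0"
      by (rule jets_surjective[OF basis smooth_V x])
    note sV = smooth_cf[OF V(2)]
    define V' where "V' y = V y / (\<Omega> y)\<^sup>2" for y
    have V': "V' \<in> conf_potentials U \<Omega> \<V>"
      unfolding conf_potentials_def V'_def using V(1) by auto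
    have cfV': "cf V' y = w y * w y * cf V y" for y
      by (simp add: cf_def V'_def w_def power2_eq_square divide_inverse)
    have sV': "smooth_on U V'"
      unfolding V'_def power2_eq_square
      by (intro smooth_on_divide smooth_on_mult open_U V(2) smooth_Omega) (simp add: Omega_nz)
    have vb: "ethb 0 (cf V) x = cnj b"
      using cnj_eth_cf(1)[OF x V(2)] V(4) by simp
    have e0: "conf.eth 0 (cf V') y = 2 * (w y * w y * w1 y * cf V y) + w y * w y * w y * eth 0 (cf V) y" if y: "y \<in> U" for y
      unfolding conf_eth[OF y] cfV'
      by (simp add: eth_def dv_mult smooth_w csmooth_mult sV y w1_def algebra_simps)
    have e1: "eth 1 (conf.eth 0 (cf V')) x = w x * w x * (w x * eth 1 (eth 0 (cf V)) x + 5 * w1 x * b)"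
    proof -
      have "eth 1 (conf.eth 0 (cf V')) x = eth 1 (\<lambda>y. 2 * (w y * w y * w1 y * cf V y) + w y * w y * w y * eth 0 (cf V) y) x"
        by (rule eth_cong[OF x e0])
      also have "\<dots> = 2 * (eth 1 (\<lambda>y. w y * w y * w1 y) x * cf V x + w x * w x * w1 x * eth 0 (cf V) x)
         + eth 0 (\<lambda>y. w y * w y * w y) x * eth 0 (cf V) x + w x * w x * w x * eth 1 (eth 0 (cf V)) x"
        using eth_mult(1)[OF x _ sV, of "\<lambda>y. w y * w y * w1 y" 1 1 0]
          eth_mult(1)[OF x _ smooth_eth[OF sV], of "\<lambda>y. w y * w y * w y" 1 0 1 0]
        by (simp add: eth_linear_rules csmooth_intros smooth_w sw1 sV smooth_eth x)
      also have "eth 0 (\<lambda>y. w y * w y * w y) x = 3 * (w x * w x * w1 x)"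
        by (simp add: eth_def dv_mult smooth_w csmooth_mult x w1_def algebra_simps)
      finally show ?thesis
        by (simp add: V algebra_simps)
    qed
    have eb0: "conf.ethb 0 (cf V') x = w x * w x * w x * cnj b"
    proof -
      have "ethb 0 (cf V') x = 2 * (w x * dv mb w x * cf V x) + w x * w x * ethb 0 (cf V) x"
        unfolding cfV'
        by (simp add: ethb_def dv_mult smooth_w csmooth_mult sV x algebra_simps)
      then show ?thesis
        unfolding conf_eth[OF x] by (simp add: vb V)
    qed
    have "conf.eth 1 (conf.eth 0 (cf V')) x = w x * w x * w x * (w x * (1/2 * sg x * cnj b + 2 * p x * b) + 6 * w1 x * b)"
      unfolding conf_eth(1)[OF x, of 1] e1 e0[OF x] potential_eth(1)[OF x V(1,2)]
      by (simp add: V vb w1_def algebra_simps)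
    moreover have "conf.eth 1 (conf.eth 0 (cf V')) x = w x * w x * w x * (1/2 * conf.sg x * cnj b + 2 * conf.p x * b)"
      using conf.potential_eth(1)[OF x V' sV'] unfolding eb0 e0[OF x]
      by (simp add: V cfV' algebra_simps)
    ultimately show ?thesis using w_nz[OF x] by simp
  qed
  define P where "P = w x * sg x - conf.sg x"
  define Q where "Q = w x * p x + 3 * w1 x - conf.p x"
  \<comment> \<open>As \<open>b\<close> and \<open>cnj b\<close> are independent over the complex
    numbers, the values 1 and \<i> already force both coefficients to vanish.\<close>
  have "P * cnj b + 4 * Q * b = 0" for b
    using E[of b] unfolding P_def Q_def by (simp add: field_simps; algebra)
  from this[of 1] this[of \<i>] have "P = 0" "Q = 0"
    by (simp_all add: complex_eq_iff)
  then show "conf.sg x = w x * sg x" "conf.p x = w x * p x + 3 * dv m w x"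
    by (simp_all add: P_def Q_def w1_def)
qed

text \<open>\<open>ethb\<close> of the rescaled \<open>sg\<close> produces - 2 times
  \<open>w * dv mb w * sg\<close>, halved in \<open>xi_eq\<close>; the shift of \<open>pb\<close> by
  \<open>3 * dv mb w\<close>, divided by 3, cancels it. This is what the factor 2/3 in
  \<open>Xi\<close> is for.\<close>

lemma conf_Xi:
  assumes x: "x \<in> U"
  shows "Xi (conf_metric \<Omega> g) S' t' x i j = Xi g S t x i j"
proof -
  define X where "X x i j = Xi (conf_metric \<Omega> g) S' t' x i j - Xi g S t x i j" for x i j
  have d: "K2 X u v x = K2 (Xi (conf_metric \<Omega> g) S' t') u v x - K2 (Xi g S t) u v x" for u v
    by (simp add: K_defs X_def sum_2 algebra_simps)
  have c: "K2 Y m' m' x = w x * w x * K2 Y m m x" "K2 Y m' conf.mb x = w x * w x * K2 Y m mb x" for Y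
    by (simp_all add: K_defs m'_def conf_mb sum_2 algebra_simps)
  have "conf.xi x = w x * w x * xi x"
  proof -
    have "conf.pb x = cnj (conf.p x)" by simp
    then have pb: "conf.pb x = w x * pb x + 3 * dv mb w x"
      unfolding conf_potential[OF x] by (simp add: cnj_dv_w[OF x])
    have "ethb 3 conf.sg x = ethb 3 (\<lambda>x. w x * sg x) x"
      by (rule ethb_cong[OF x]) (rule conf_potential)
    then have "ethb 3 conf.sg x = dv mb w x * sg x + w x * ethb 3 sg x"
      by (simp add: ethb_def dv_mult smooth_w x algebra_simps)
    then show ?thesis
      unfolding conf.xi_eq[OF x] xi_eq[OF x] conf_eth[OF x] pb conf_potential[OF x]
      by (simp add: field_simps)
  qed
  then have "K2 X m m x = 0"
    unfolding d conf.xi_def xi_def c using w_nz[OF x] by simp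
  moreover have "K2 X m mb x = 0"
    using conf.K2_Xi_mixed(1)[OF x] w_nz[OF x] unfolding d c K2_Xi_mixed[OF x] by simp
  ultimately have "X x i j = 0" by (rule K2_zeroI[OF x])
  then show ?thesis by (simp add: X_def)
qed

end

section \<open>Existence of null frames\<close>

context riemannian_domain
begin

text \<open>Gram-Schmidt: the frame is \<open>e\<^sub>1 + i e\<^sub>2\<close> for an orthonormal frame with \<open>e\<^sub>1\<close> proportional to
  the first coordinate field.\<close>

definition gram_schmidt :: "2 \<Rightarrow> pt \<Rightarrow> complex" where
  "gram_schmidt i x = (if i = 1
     then Complex (1 / sqrt (g x $ 1 $ 1)) (- (g x $ 1 $ 2) / (sqrt (g x $ 1 $ 1) * sqrt (detg x)))
     else Complex 0 (sqrt (g x $ 1 $ 1) / sqrt (detg x)))"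

lemma null_frame_gram_schmidt: "null_frame U g gram_schmidt"
proof unfold_locales
  have s11: "smooth_on U (\<lambda>x. sqrt (g x $ 1 $ 1))"
    by (intro smooth_on_sqrt open_U smooth_g g11_pos)
  have sd: "smooth_on U (\<lambda>x. sqrt (detg x))"
    by (intro smooth_on_sqrt smooth_on_intros open_U smooth_g detg_pos)
  show "csmooth U (gram_schmidt i)" for i
  proof (cases "i = 1")
    case True
    have "smooth_on U (\<lambda>x. 1 / sqrt (g x $ 1 $ 1))"
      "smooth_on U (\<lambda>x. - (g x $ 1 $ 2) / (sqrt (g x $ 1 $ 1) * sqrt (detg x)))"
      using g11_pos detg_pos by (force intro!: smooth_on_intros open_U smooth_g s11 sd)+
    with True show ?thesis by (simp add: csmooth_def gram_schmidt_def)
  next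
    case False
    have "smooth_on U (\<lambda>x. sqrt (g x $ 1 $ 1) / sqrt (detg x))"
      using detg_pos by (force intro!: smooth_on_divide open_U s11 sd)
    with False show ?thesis by (simp add: csmooth_def gram_schmidt_def smooth_on_const)
  qed
  fix x assume x: "x \<in> U"
  define r where "r = sqrt (g x $ 1 $ 1)"
  define d where "d = sqrt (detg x)"
  have r: "r * r = g x $ 1 $ 1" "r \<noteq> 0"
    using g11_pos[OF x] by (simp_all add: r_def)
  have "d * d = detg x" and d0: "d \<noteq> 0"
    using detg_pos[OF x] by (simp_all add: d_def)
  then have d: "r * r * g x $ 2 $ 2 = d * d + g x $ 1 $ 2 * g x $ 1 $ 2"
    by (simp add: r)
  have m: "gram_schmidt 1 x = Complex (1 / r) (- (g x $ 1 $ 2) / (r * d))" "gram_schmidt 2 x = Complex 0 (r / d)"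
    by (simp_all add: gram_schmidt_def r_def d_def)
  show "(\<Sum>i\<in>UNIV. \<Sum>j\<in>UNIV. complex_of_real (g x $ i $ j) * gram_schmidt i x * gram_schmidt j x) = 0"
    unfolding sum_2 m g_sym21[OF x] r(1)[symmetric]
    using r(2) d0 d by (simp add: complex_eq_iff field_simps; algebra)
  show "(\<Sum>i\<in>UNIV. \<Sum>j\<in>UNIV. complex_of_real (g x $ i $ j) * gram_schmidt i x * cnj (gram_schmidt j x)) = 2"
    unfolding sum_2 m g_sym21[OF x] r(1)[symmetric]
    using r(2) d0 d by (simp add: complex_eq_iff field_simps; algebra)
qed

end

section \<open>From frame components back to tensors\<close>

context null_frame
begin

lemma contract1:
  assumes x: "x \<in> U"
  shows "of_real (\<Sum>a\<in>UNIV. X a * raise1 g Y x a) = (K1 (\<lambda>_. X) m x * K1 Y mb x + K1 (\<lambda>_. X) mb x * K1 Y m x) / 2"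
  unfolding of_real_sum of_real_mult raise1_frame[OF x] by (simp add: K_defs sum_2 field_simps)

text \<open>\<open>s\<close> is the symmetriser acting on frame slots. The divisor 8 is 4 from the
  trace-free projection times 2 from \<open>ginv_trace\<close>.\<close>

lemma K4_sym3_tracefree:
  fixes Z :: "2 \<Rightarrow> 2 \<Rightarrow> 2 \<Rightarrow> 2 \<Rightarrow> real"
  assumes x: "x \<in> U"
  defines "s \<equiv> \<lambda>n u v w. K4 (\<lambda>_. Z) n u v w x + K4 (\<lambda>_. Z) n u w v x + K4 (\<lambda>_. Z) n v u w x
     + K4 (\<lambda>_. Z) n w u v x + K4 (\<lambda>_. Z) n v w u x + K4 (\<lambda>_. Z) n w v u x"
  shows "K4 (\<lambda>x l i j k. sym3_tracefree (g x) (Z l) i j k) n u v w x = s n u v w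
    - (K2 gt u v x * (s n m mb w + s n mb m w) + K2 gt v w x * (s n m mb u + s n mb m u)
       + K2 gt w u x * (s n m mb v + s n mb m v)) / 8"
proof -
  define Y where "Y l k = (\<Sum>a\<in>UNIV. \<Sum>b\<in>UNIV. ginv g x a b * sym3 (Z l) a b k)" for l k
  have e: "sym3_tracefree (g x) (Z l) i j k = sym3 (Z l) i j k
      - (g x $ i $ j * Y l k + g x $ j $ k * Y l i + g x $ k $ i * Y l j) / 4" for l i j k
    by (simp add: sym3_tracefree_def Let_def Y_def ginv_def)
  have y: "K2 (\<lambda>_. Y) n w x = (s n m mb w + s n mb m w) / 2" for n w
  proof -
    have "complex_of_real (Y l k) = (K2 (\<lambda>_ a b. sym3 (Z l) a b k) m mb x + K2 (\<lambda>_ a b. sym3 (Z l) a b k) mb m x) / 2" for l k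
      unfolding Y_def by (rule ginv_trace[OF x])
    note * = this
    have "K2 (\<lambda>_. Y) n w x = (K4 (\<lambda>_ l. sym3 (Z l)) n m mb w x + K4 (\<lambda>_ l. sym3 (Z l)) n mb m w x) / 2"
      unfolding K2_def[of "\<lambda>_. Y"] * unfolding K_defs sum_2 by (simp add: field_simps)
    moreover have "K4 (\<lambda>_ l. sym3 (Z l)) n u v w x = s n u v w" for u v w
      unfolding s_def K_defs sym3_def sum_2 by (simp add: algebra_simps)
    ultimately show ?thesis by simp
  qed
  have "K4 (\<lambda>x l i j k. sym3_tracefree (g x) (Z l) i j k) n u v w x =
     K4 (\<lambda>_ l. sym3 (Z l)) n u v w x - (K2 gt u v x * K2 (\<lambda>_. Y) n w x + K2 gt v w x * K2 (\<lambda>_. Y) n u x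
       + K2 gt w u x * K2 (\<lambda>_. Y) n v x) / 4"
  proof -
    have "K4 (\<lambda>x l i j k. sym3_tracefree (g x) (Z l) i j k) n u v w x =
      (\<Sum>l\<in>UNIV. \<Sum>i\<in>UNIV. \<Sum>j\<in>UNIV. \<Sum>k\<in>UNIV. (of_real (sym3 (Z l) i j k)
      - (of_real (g x $ i $ j) * of_real (Y l k) + of_real (g x $ j $ k) * of_real (Y l i)
         + of_real (g x $ k $ i) * of_real (Y l j)) / 4) * n l x * u i x * v j x * w k x)"
      unfolding K4_def e by simp
    then show ?thesis
      by (simp add: K_defs sum_2 algebra_simps add_divide_distrib diff_divide_distrib)
  qed
  moreover have "K4 (\<lambda>_ l. sym3 (Z l)) n u v w x = s n u v w"
    unfolding s_def K_defs sym3_def sum_2 by (simp add: algebra_simps)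
  ultimately show ?thesis
    unfolding y by (simp add: algebra_simps add_divide_distrib diff_divide_distrib)
qed

end

context framed_system
begin

abbreviation \<Xi> :: tensor2 where "\<Xi> \<equiv> Xi g S t"

text \<open>Both sides are trace-free and totally symmetric in i, j, k, so with the derivative along
  \<open>m\<close> only the slots \<open>m m m\<close> and \<open>mb mb mb\<close> carry content,
  namely \<open>eth_sg\<close> and \<open>eth_sgb\<close>.\<close>

lemma nabla3_S_structure:
  assumes x: "x \<in> U"
  shows "nabla3 g S x l i j k =
         1/6 * sym3_tracefree (g x)
           (\<lambda>i j k. - 2/3 * S x i j k * grad t x l + 2 * grad t x i * S x j k l
                    + \<Xi> x i j * g x $ k $ l) i j k"
proof -
  define Z where "Z l i j k = - 2/3 * S x i j k * grad t x l + 2 * grad t x i * S x j k l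
                    + \<Xi> x i j * g x $ k $ l" for l i j k
  \<comment> \<open>The difference of both sides. \<open>Z\<close> is frozen at \<open>x\<close>;
    the argument \<open>y\<close> only gives \<open>X\<close> the type that \<open>K4\<close>
    expects. The later structure lemmas freeze scalars in the same way.\<close>
  define X where "X y l i j k = nabla3 g S y l i j k - 1/6 * sym3_tracefree (g y) (Z l) i j k" for y l i j k
  have Zc: "K4 (\<lambda>_. Z) n u v w x = - 2/3 * K3 S u v w x * K1 (grad t) n x + 2 * K1 (grad t) u x * K3 S v w n x
      + K2 \<Xi> u v x * K2 gt w n x" for n u v w
  proof -
    have "K4 (\<lambda>_. Z) n u v w x = (\<Sum>l\<in>UNIV. \<Sum>i\<in>UNIV. \<Sum>j\<in>UNIV. \<Sum>k\<in>UNIV.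
      (- 2/3 * of_real (S x i j k) * of_real (grad t x l) + 2 * of_real (grad t x i) * of_real (S x j k l)
       + of_real (\<Xi> x i j) * of_real (g x $ k $ l)) * n l x * u i x * v j x * w k x)"
      unfolding K4_def Z_def by simp
    then show ?thesis
      by (simp add: K_defs sum_2 algebra_simps add_divide_distrib diff_divide_distrib)
  qed
  have Xc: "K4 X n u v w x = K4 (nabla3 g S) n u v w x - 1/6 * K4 (\<lambda>x l i j k. sym3_tracefree (g x) (Z l) i j k) n u v w x" for n u v w
    unfolding K4_def X_def of_real_diff of_real_mult by (simp add: sum_2 algebra_simps)
  have mbm: "K4 (nabla3 g S) m mb mb mb x = eth (- 3) sgb x"
    using nabla3_eth(1)[where X=S, OF x smooth_S frame_weight_mb frame_weight_mb frame_weight_mb] by (simp add: sgb_def)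
  note n3 = nabla3_S(1)[OF x] mbm
    nabla3_S(3-8)[OF x frame_weight_m frame_weight_m] nabla3_S(3-8)[OF x frame_weight_m frame_weight_mb]
  have "K4 X m u v w x = 0" if "u \<in> {m, mb}" "v \<in> {m, mb}" "w \<in> {m, mb}" for u v w
    using that
    by (auto simp: Xc K4_sym3_tracefree[OF x] Zc n3 K3_S_mixed[OF x] K2_g[OF x] K2_Xi_mixed[OF x]
        eth_sg[OF x] eth_sgb[OF x] p_def[symmetric] pb_def[symmetric] sg_def[symmetric] sgb_def[symmetric]
        xi_def[symmetric] xib_def[symmetric] field_simps)
  then have "X x l i j k = 0" by (rule K4_zeroI[OF x])
  moreover have "Z l = (\<lambda>i j k. - 2/3 * S x i j k * grad t x l + 2 * grad t x i * S x j k l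
                    + \<Xi> x i j * g x $ k $ l)"
    by (simp add: Z_def fun_eq_iff)
  ultimately show ?thesis by (simp add: X_def)
qed

text \<open>Only \<open>m m m\<close> and its conjugate contribute, each with
  \<open>sg * sgb / 8\<close>.\<close>

lemma S_norm:
  assumes x: "x \<in> U"
  shows "of_real (\<Sum>a\<in>UNIV. \<Sum>b\<in>UNIV. \<Sum>c\<in>UNIV. raise3 g S x a b c * S x a b c) = sg x * sgb x / 4"
proof -
  have r: "complex_of_real (raise3 g S x a b c) = (m a x * m b x * m c x * sgb x + mb a x * mb b x * mb c x * sg x) / 8" for a b c
    unfolding raise3_frame[OF x] by (simp add: K3_S_mixed[OF x] sg_def sgb_def)
  show ?thesis
    unfolding of_real_sum of_real_mult r by (simp add: sg_def sgb_def K3_def sum_2 field_simps)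
qed

lemma raise2_tracefree:
  assumes x: "x \<in> U" and Y: "K2 Y m mb x = 0" "K2 Y mb m x = 0"
  shows "of_real (raise2 g Y x a b) = (m a x * m b x * K2 Y mb mb x + mb a x * mb b x * K2 Y m m x) / 4"
  unfolding raise2_frame[OF x] Y by simp

lemma contract_S:
  assumes x: "x \<in> U" and Y: "K2 Y m mb x = 0" "K2 Y mb m x = 0"
  shows "K1 (\<lambda>x k. \<Sum>a\<in>UNIV. \<Sum>b\<in>UNIV. S x k a b * raise2 g Y x a b) m x = sg x * K2 Y mb mb x / 4" (is "K1 ?q m x = _")
    "K1 (\<lambda>x k. \<Sum>a\<in>UNIV. \<Sum>b\<in>UNIV. S x k a b * raise2 g Y x a b) mb x = sgb x * K2 Y m m x / 4"
proof -
  have "K1 ?q u x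
      = (K3 S u m m x * K2 Y mb mb x + K3 S u mb mb x * K2 Y m m x) / 4" for u
    unfolding K1_def of_real_sum of_real_mult raise2_tracefree[OF assms] by (simp add: K3_def sum_2 field_simps)
  then show "K1 ?q m x = sg x * K2 Y mb mb x / 4"
    "K1 ?q mb x = sgb x * K2 Y m m x / 4"
    by (simp_all add: K3_S_mixed[OF x] sg_def sgb_def)
qed

lemma contract_Xi_t:
  assumes x: "x \<in> U"
  shows "K1 (\<lambda>x k. \<Sum>a\<in>UNIV. \<Xi> x k a * raise1 g (grad t) x a) m x = xi x * pb x / 2" (is "K1 ?y m x = _")
    "K1 (\<lambda>x k. \<Sum>a\<in>UNIV. \<Xi> x k a * raise1 g (grad t) x a) mb x = xib x * p x / 2"
proof -
  have "K1 ?y u x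
      = (K2 \<Xi> u m x * pb x + K2 \<Xi> u mb x * p x) / 2" for u
    unfolding K1_def[of ?y] contract1[OF x]
    by (simp add: K_defs p_def pb_def sum_2 field_simps)
  then show "K1 ?y m x = xi x * pb x / 2"
    "K1 ?y mb x = xib x * p x / 2"
    by (simp_all add: K2_Xi_mixed[OF x] xi_def xib_def)
qed

lemma cnj_ethb_xi: "eth (- 2) xib x = 2/3 * sgb x * xi x" if x: "x \<in> U"
  using cnj_eth(2)[OF x smooth_comps(7), of xib 2] by (simp add: ethb_xi[OF x] flip: cnj_eth)

text \<open>The component \<open>m m m\<close> is \<open>eth_xi\<close>, which fixes the sign of the
  2/9 term. In \<open>m mb mb\<close> the two parts of that term cancel, leaving the conjugate of
  \<open>ethb_xi\<close>.\<close>

lemma nabla2_Xi_structure: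
  assumes x: "x \<in> U"
  shows "nabla2 g \<Xi> x k i j =
         1/3 * S x i j k * (\<Sum>a\<in>UNIV. \<Sum>b\<in>UNIV. \<Sum>c\<in>UNIV. raise3 g S x a b c * S x a b c)
         + 2/9 * sym3
           (\<lambda>i j k. \<Xi> x j k * grad t x i
              - 1/2 * g x $ i $ j * (\<Sum>a\<in>UNIV. \<Xi> x k a * raise1 g (grad t) x a)) i j k
         + 2/3 * sym2_tracefree (g x)
           (\<lambda>i j. g x $ j $ k * (\<Sum>a\<in>UNIV. \<Sum>b\<in>UNIV. S x i a b * raise2 g \<Xi> x a b)) i j"
proof -
  define N where "N = (\<Sum>a\<in>UNIV. \<Sum>b\<in>UNIV. \<Sum>c\<in>UNIV. raise3 g S x a b c * S x a b c)"
  define y where "y = (\<lambda>x k. \<Sum>a\<in>UNIV. \<Xi> x k a * raise1 g (grad t) x a)"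
  define q where "q = (\<lambda>x i. \<Sum>a\<in>UNIV. \<Sum>b\<in>UNIV. S x i a b * raise2 g \<Xi> x a b)"
  define X where "X z k i j = nabla2 g \<Xi> z k i j - (1/3 * S z i j k * N
     + 2/9 * sym3 (\<lambda>i j k. \<Xi> z j k * grad t z i - 1/2 * g z $ i $ j * y z k) i j k
     + 2/3 * (g z $ j $ k * q z i + g z $ i $ k * q z j - g z $ i $ j * q z k))" for z k i j
  \<comment> \<open>The trace over i, j of the product of g_jk and q_i is q_k, which makes the
    projection explicit.\<close>
  have tf: "sym2_tracefree (g x) (\<lambda>i j. g x $ j $ k * q x i) i j
     = g x $ j $ k * q x i + g x $ i $ k * q x j - g x $ i $ j * q x k" for i j k
  proof -
    have "(\<Sum>a\<in>UNIV. \<Sum>b\<in>UNIV. ginv g x a b * (g x $ b $ k * q x a))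
      = (\<Sum>a\<in>UNIV. (\<Sum>b\<in>UNIV. ginv g x a b * g x $ b $ k) * q x a)"
      by (simp add: sum_2 algebra_simps)
    also have "\<dots> = q x k"
      using exhaust_2[of k] by (simp only: ginv_g[OF x]) (auto simp: sum_2)
    finally show ?thesis
      by (simp add: sym2_tracefree_def ginv_def)
  qed
  have Xc: "K3 X n u v x = K3 (nabla2 g \<Xi>) n u v x - (1/3 * K3 S u v n x * (sg x * sgb x / 4)
     + 2/9 * (K2 \<Xi> v n x * K1 (grad t) u x + K2 \<Xi> n v x * K1 (grad t) u x
        + K2 \<Xi> u n x * K1 (grad t) v x + K2 \<Xi> n u x * K1 (grad t) v x
        + K2 \<Xi> u v x * K1 (grad t) n x + K2 \<Xi> v u x * K1 (grad t) n x
        - 1/2 * (K2 gt u v x * K1 y n x + K2 gt v u x * K1 y n x + K2 gt u n x * K1 y v x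
          + K2 gt n u x * K1 y v x + K2 gt v n x * K1 y u x + K2 gt n v x * K1 y u x))
     + 2/3 * (K2 gt v n x * K1 q u x + K2 gt u n x * K1 q v x - K2 gt u v x * K1 q n x))" for n u v
  proof -
    have "K3 X n u v x = (\<Sum>k\<in>UNIV. \<Sum>i\<in>UNIV. \<Sum>j\<in>UNIV. (of_real (nabla2 g \<Xi> x k i j)
     - (1/3 * of_real (S x i j k) * (sg x * sgb x / 4)
     + 2/9 * (of_real (\<Xi> x j k) * of_real (grad t x i) + of_real (\<Xi> x k j) * of_real (grad t x i)
        + of_real (\<Xi> x i k) * of_real (grad t x j) + of_real (\<Xi> x k i) * of_real (grad t x j)
        + of_real (\<Xi> x i j) * of_real (grad t x k) + of_real (\<Xi> x j i) * of_real (grad t x k)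
        - 1/2 * (of_real (g x $ i $ j) * of_real (y x k) + of_real (g x $ j $ i) * of_real (y x k)
          + of_real (g x $ i $ k) * of_real (y x j) + of_real (g x $ k $ i) * of_real (y x j)
          + of_real (g x $ j $ k) * of_real (y x i) + of_real (g x $ k $ j) * of_real (y x i)))
     + 2/3 * (of_real (g x $ j $ k) * of_real (q x i) + of_real (g x $ i $ k) * of_real (q x j)
        - of_real (g x $ i $ j) * of_real (q x k)))) * n k x * u i x * v j x)"
      unfolding K3_def X_def S_norm[OF x, folded N_def, symmetric]
      by (intro sum.cong refl) (simp add: sym3_def algebra_simps)
    then show ?thesis
      by (simp add: K_defs sum_2 algebra_simps add_divide_distrib diff_divide_distrib)
  qed
  have n2: "K3 (nabla2 g \<Xi>) m m m x = eth 2 xi x" "K3 (nabla2 g \<Xi>) m mb mb x = eth (- 2) xib x"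
    "K3 (nabla2 g \<Xi>) m m mb x = 0" "K3 (nabla2 g \<Xi>) m mb m x = 0"
    using nabla2_eth(1)[where X=\<Xi>, OF x smooth_Xi frame_weight_m frame_weight_m]
      nabla2_eth(1)[where X=\<Xi>, OF x smooth_Xi frame_weight_mb frame_weight_mb]
      nabla2_eth(1)[where X=\<Xi>, OF x smooth_Xi frame_weight_m frame_weight_mb]
      nabla2_eth(1)[where X=\<Xi>, OF x smooth_Xi frame_weight_mb frame_weight_m]
    by (simp_all add: xi_def xib_def eth_cong[OF x K2_Xi_mixed(1)] eth_cong[OF x K2_Xi_mixed(2)] eth_0)
  have yc: "K1 y m x = xi x * pb x / 2" "K1 y mb x = xib x * p x / 2"
    unfolding y_def by (rule contract_Xi_t[OF x])+
  have qc: "K1 q m x = sg x * xib x / 4" "K1 q mb x = sgb x * xi x / 4"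
    unfolding q_def xi_def xib_def by (rule contract_S[OF x K2_Xi_mixed[OF x]])+
  have "K3 X m u v x = 0" if "u \<in> {m, mb}" "v \<in> {m, mb}" for u v
    using that
    by (auto simp: Xc n2 yc qc K3_S_mixed[OF x] K2_g[OF x] K2_Xi_mixed[OF x]
        eth_xi[OF x] cnj_ethb_xi[OF x] p_def[symmetric] pb_def[symmetric] sg_def[symmetric] sgb_def[symmetric]
        xi_def[symmetric] xib_def[symmetric] field_simps)
  then have "X x k i j = 0" by (rule K3_zeroI[OF x])
  then show ?thesis
    unfolding X_def N_def[symmetric] y_def[symmetric] q_def[symmetric] tf[symmetric]
    using tf[of k i j] by (simp add: y_def q_def)
qed

end

context framed_system
begin

lemma contract_S_t:
  assumes x: "x \<in> U"
  shows "K2 (\<lambda>x i j. \<Sum>a\<in>UNIV. S x i j a * raise1 g (grad t) x a) m m x = sg x * pb x / 2" (is "K2 ?s m m x = _")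
    "K2 (\<lambda>x i j. \<Sum>a\<in>UNIV. S x i j a * raise1 g (grad t) x a) m mb x = 0"
    "K1 (\<lambda>x k. \<Sum>a\<in>UNIV. \<Sum>b\<in>UNIV. S x k a b * raise1 g (grad t) x a * raise1 g (grad t) x b) m x
      = sg x * pb x * pb x / 4" (is "K1 ?r m x = _")
proof -
  have *: "K2 ?s u v x = (K3 S u v m x * pb x + K3 S u v mb x * p x) / 2" for u v
    unfolding K2_def of_real_sum of_real_mult raise1_frame[OF x]
    by (simp add: K3_def p_def pb_def sum_2 field_simps)
  show "K2 ?s m m x = sg x * pb x / 2"
    "K2 ?s m mb x = 0"
    unfolding * by (simp_all add: K3_S_mixed[OF x] sg_def)
  have "K1 ?r m x
    = (K3 S m m m x * pb x * pb x + K3 S m m mb x * pb x * p x + K3 S m mb m x * pb x * p x + K3 S m mb mb x * p x * p x) / 4"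
    unfolding K1_def of_real_sum of_real_mult raise1_frame[OF x, of "grad t", folded p_def pb_def]
    by (simp add: K3_def sum_2 field_simps)
  then show "K1 ?r m x
      = sg x * pb x * pb x / 4"
    by (simp add: K3_S_mixed[OF x] sg_def)
qed

lemma div_tau:
  assumes x: "x \<in> U"
  shows "K1 (\<lambda>x k. \<Sum>a\<in>UNIV. \<Sum>b\<in>UNIV. ginv g x a b * nabla2 g \<tau> x b a k) m x = ethb 2 th x / 2" (is "K1 ?d m x = _")
proof -
  have "complex_of_real (\<Sum>a\<in>UNIV. \<Sum>b\<in>UNIV. ginv g x a b * nabla2 g \<tau> x b a k)
    = (K2 (\<lambda>x a b. nabla2 g \<tau> x b a k) m mb x + K2 (\<lambda>x a b. nabla2 g \<tau> x b a k) mb m x) / 2" for k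
    by (rule ginv_trace[OF x])
  note * = this
  have "K1 ?d m x
    = (K3 (nabla2 g \<tau>) mb m m x + K3 (nabla2 g \<tau>) m mb m x) / 2"
    unfolding K1_def * by (simp add: K_defs sum_2 field_simps)
  moreover have "K3 (nabla2 g \<tau>) mb m m x = ethb 2 th x" "K3 (nabla2 g \<tau>) m mb m x = 0"
    using nabla2_eth(2)[where X=\<tau>, OF x smooth_tau frame_weight_m frame_weight_m]
      nabla2_eth(1)[where X=\<tau>, OF x smooth_tau frame_weight_mb frame_weight_m]
    by (simp_all add: th_def eth_cong[OF x K2_tau_mixed(2)] eth_0)
  ultimately show ?thesis by simp
qed

text \<open>A real covector is determined by its component along \<open>m\<close>, which here is
  half of \<open>ethb_th\<close>.\<close>

lemma div_tau_structure:
  assumes x: "x \<in> U"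
  shows "(\<Sum>a\<in>UNIV. \<Sum>b\<in>UNIV. ginv g x a b * nabla2 g \<tau> x b a k) =
         - (\<Sum>a\<in>UNIV. \<Sum>b\<in>UNIV. S x k a b * raise2 g \<tau> x a b)
         + (\<Sum>a\<in>UNIV. \<Sum>b\<in>UNIV. S x k a b * raise2 g \<Xi> x a b)
         - 2/3 * (\<Sum>a\<in>UNIV. \<Xi> x k a * raise1 g (grad t) x a)
         - 4/9 * (\<Sum>a\<in>UNIV. \<Sum>b\<in>UNIV. S x k a b * raise1 g (grad t) x a * raise1 g (grad t) x b)
         - 5/9 * (\<Sum>a\<in>UNIV. \<Sum>b\<in>UNIV. \<Sum>c\<in>UNIV. S x a b c * raise3 g S x a b c) * grad t x k
         + 1/2 * grad (scalar_curvature g) x k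
         - scalar_curvature g x * grad t x k"
proof -
  define d where "d = (\<lambda>x k. \<Sum>a\<in>UNIV. \<Sum>b\<in>UNIV. ginv g x a b * nabla2 g \<tau> x b a k)"
  define s1 where "s1 = (\<lambda>x k. \<Sum>a\<in>UNIV. \<Sum>b\<in>UNIV. S x k a b * raise2 g \<tau> x a b)"
  define s2 where "s2 = (\<lambda>x k. \<Sum>a\<in>UNIV. \<Sum>b\<in>UNIV. S x k a b * raise2 g \<Xi> x a b)"
  define s3 where "s3 = (\<lambda>x k. \<Sum>a\<in>UNIV. \<Xi> x k a * raise1 g (grad t) x a)"
  define s4 where "s4 = (\<lambda>x k. \<Sum>a\<in>UNIV. \<Sum>b\<in>UNIV. S x k a b * raise1 g (grad t) x a * raise1 g (grad t) x b)"
  define N where "N = (\<Sum>a\<in>UNIV. \<Sum>b\<in>UNIV. \<Sum>c\<in>UNIV. S x a b c * raise3 g S x a b c)"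
  define X where "X z k = d z k - (- s1 z k + s2 z k - 2/3 * s3 z k - 4/9 * s4 z k - 5/9 * N * grad t z k
    + 1/2 * grad (scalar_curvature g) z k - scalar_curvature g x * grad t z k)" for z k
  have N: "of_real N = sg x * sgb x / 4"
    unfolding N_def using S_norm[OF x] by (simp add: mult.commute)
  have "K1 X m x = K1 d m x - (- K1 s1 m x + K1 s2 m x - 2/3 * K1 s3 m x - 4/9 * K1 s4 m x - 5/9 * of_real N * p x
    + 1/2 * K1 (grad (scalar_curvature g)) m x - cR x * p x)"
    unfolding X_def K1_def p_def cR_def by (simp add: sum_2 algebra_simps add_divide_distrib diff_divide_distrib)
  also have "\<dots> = ethb 2 th x / 2 - (- (sg x * thb x / 4) + sg x * xib x / 4 - 2/3 * (xi x * pb x / 2)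
     - 4/9 * (sg x * pb x * pb x / 4) - 5/9 * (sg x * sgb x / 4) * p x + 1/2 * eth 0 cR x - cR x * p x)"
    unfolding d_def s1_def s2_def s3_def s4_def div_tau[OF x] contract_S(1)[OF x K2_tau_mixed[OF x]]
      contract_S(1)[OF x K2_Xi_mixed[OF x]] contract_Xi_t[OF x] contract_S_t[OF x] N K1_grad
      thb_def[symmetric] xib_def[symmetric] cR_def[symmetric, abs_def] ..
  also have "\<dots> = 0"
    unfolding ethb_th[OF x] by (simp add: algebra_simps add_divide_distrib diff_divide_distrib)
  finally have "X x k = 0" by (rule K1_zeroI[OF x])
  then show ?thesis
    unfolding X_def d_def s1_def s2_def s3_def s4_def N_def by simp
qed

text \<open>The component (m, m) is \<open>eth_p\<close>; the component (m, mb) carries the trace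
  and is \<open>eth_pb\<close>.\<close>

lemma hess_t_structure:
  assumes x: "x \<in> U"
  shows "hess g t x i j =
         3/2 * (\<tau> x i j
           + 2/3 * (\<Sum>a\<in>UNIV. S x i j a * raise1 g (grad t) x a)
           + 4/9 * sym2_tracefree (g x) (\<lambda>i j. grad t x i * grad t x j) i j
           - 1/3 * \<Xi> x i j)
         + 1/2 * g x $ i $ j *
           (1/3 * (\<Sum>a\<in>UNIV. \<Sum>b\<in>UNIV. \<Sum>c\<in>UNIV. raise3 g S x a b c * S x a b c)
            + 3/2 * scalar_curvature g x)"
proof -
  define s where "s = (\<lambda>x i j. \<Sum>a\<in>UNIV. S x i j a * raise1 g (grad t) x a)"
  define n where "n = (\<Sum>a\<in>UNIV. \<Sum>b\<in>UNIV. ginv g x a b * (grad t x a * grad t x b))"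
  define N where "N = (\<Sum>a\<in>UNIV. \<Sum>b\<in>UNIV. \<Sum>c\<in>UNIV. raise3 g S x a b c * S x a b c)"
  define X where "X z i j = hess g t z i j - (3/2 * (\<tau> z i j + 2/3 * s z i j
     + 4/9 * (2 * grad t z i * grad t z j - g z $ i $ j * n) - 1/3 * \<Xi> z i j)
     + 1/2 * g z $ i $ j * (1/3 * N + 3/2 * scalar_curvature g x))" for z i j
  have n: "of_real n = p x * pb x"
    unfolding n_def ginv_trace[OF x, of "\<lambda>x a b. grad t x a * grad t x b"]
    by (simp add: K_defs p_def pb_def sum_2 field_simps)
  have tf: "sym2_tracefree (g x) (\<lambda>i j. grad t x i * grad t x j) i j
     = 2 * grad t x i * grad t x j - g x $ i $ j * n" for i j
    by (simp add: sym2_tracefree_def ginv_def n_def)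
  have Xc: "K2 X u v x = K2 (hess g t) u v x - (3/2 * (K2 \<tau> u v x + 2/3 * K2 s u v x
     + 4/9 * (2 * K1 (grad t) u x * K1 (grad t) v x - K2 gt u v x * (p x * pb x)) - 1/3 * K2 \<Xi> u v x)
     + 1/2 * K2 gt u v x * (1/3 * (sg x * sgb x / 4) + 3/2 * cR x))" for u v
    unfolding X_def K_defs n[symmetric] S_norm[OF x, folded N_def, symmetric] cR_def
    by (simp add: sum_2 algebra_simps add_divide_distrib diff_divide_distrib)
  have sc: "K2 s m m x = sg x * pb x / 2" "K2 s m mb x = 0"
    unfolding s_def by (rule contract_S_t[OF x])+
  have "K2 (hess g t) m m x = eth 1 p x" "K2 (hess g t) m mb x = eth (- 1) pb x"
    unfolding hess_frame[OF x smooth_t] p_alt cf_def by simp_all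
  then have "K2 X m m x = 0" "K2 X m mb x = 0"
    unfolding Xc sc K2_g[OF x] K2_tau_mixed[OF x] K2_Xi_mixed[OF x] th_def[symmetric] xi_def[symmetric]
      p_def[symmetric] pb_def[symmetric]
    by (simp_all add: eth_p[OF x] eth_pb[OF x] algebra_simps add_divide_distrib diff_divide_distrib)
  then have "X x i j = 0" by (rule K2_zeroI[OF x])
  then show ?thesis
    unfolding tf X_def s_def N_def by simp
qed

end

theorem proposition3p9:
  fixes U :: "pt set" and g :: metric and \<V> :: "(pt \<Rightarrow> real) set" and \<F> :: "phase_fun set"
    and T S :: tensor3 and \<tau> \<Xi> :: tensor2 and t :: "pt \<Rightarrow> real"
  assumes sys: "nondegenerate_system U g \<V> \<F>"
    and str: "structure_tensors U g \<V> T \<tau>"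
    and con: "conformal_structure U g T S t"
    and Xi: "\<Xi> = Xi g S t"
  shows
    "(\<forall>\<Omega> T' \<tau>' S' t'.
        smooth_on U \<Omega> \<and> (\<forall>x\<in>U. \<Omega> x \<noteq> 0) \<and>
        structure_tensors U (conf_metric \<Omega> g) (conf_potentials U \<Omega> \<V>) T' \<tau>' \<and>
        conformal_structure U (conf_metric \<Omega> g) T' S' t' \<longrightarrow>
        (\<forall>x\<in>U. \<forall>i j. Xi (conf_metric \<Omega> g) S' t' x i j = \<Xi> x i j))
     \<and> (\<forall>x\<in>U. \<forall>l i j k.
       nabla3 g S x l i j k =
         1/6 * sym3_tracefree (g x)
           (\<lambda>i j k. - 2/3 * S x i j k * grad t x l + 2 * grad t x i * S x j k l
                    + \<Xi> x i j * g x $ k $ l) i j k)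
     \<and> (\<forall>x\<in>U. \<forall>k i j.
       nabla2 g \<Xi> x k i j =
         1/3 * S x i j k * (\<Sum>a\<in>UNIV. \<Sum>b\<in>UNIV. \<Sum>c\<in>UNIV. raise3 g S x a b c * S x a b c)
         + 2/9 * sym3
           (\<lambda>i j k. \<Xi> x j k * grad t x i
              - 1/2 * g x $ i $ j * (\<Sum>a\<in>UNIV. \<Xi> x k a * raise1 g (grad t) x a)) i j k
         + 2/3 * sym2_tracefree (g x)
           (\<lambda>i j. g x $ j $ k * (\<Sum>a\<in>UNIV. \<Sum>b\<in>UNIV. S x i a b * raise2 g \<Xi> x a b)) i j)
     \<and> (\<forall>x\<in>U. \<forall>k.
       (\<Sum>a\<in>UNIV. \<Sum>b\<in>UNIV. ginv g x a b * nabla2 g \<tau> x b a k) =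
         - (\<Sum>a\<in>UNIV. \<Sum>b\<in>UNIV. S x k a b * raise2 g \<tau> x a b)
         + (\<Sum>a\<in>UNIV. \<Sum>b\<in>UNIV. S x k a b * raise2 g \<Xi> x a b)
         - 2/3 * (\<Sum>a\<in>UNIV. \<Xi> x k a * raise1 g (grad t) x a)
         - 4/9 * (\<Sum>a\<in>UNIV. \<Sum>b\<in>UNIV. S x k a b * raise1 g (grad t) x a * raise1 g (grad t) x b)
         - 5/9 * (\<Sum>a\<in>UNIV. \<Sum>b\<in>UNIV. \<Sum>c\<in>UNIV. S x a b c * raise3 g S x a b c) * grad t x k
         + 1/2 * grad (scalar_curvature g) x k
         - scalar_curvature g x * grad t x k)
     \<and> (\<forall>x\<in>U. \<forall>i j.
       hess g t x i j =
         3/2 * (\<tau> x i j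
           + 2/3 * (\<Sum>a\<in>UNIV. S x i j a * raise1 g (grad t) x a)
           + 4/9 * sym2_tracefree (g x) (\<lambda>i j. grad t x i * grad t x j) i j
           - 1/3 * \<Xi> x i j)
         + 1/2 * g x $ i $ j *
           (1/3 * (\<Sum>a\<in>UNIV. \<Sum>b\<in>UNIV. \<Sum>c\<in>UNIV. raise3 g S x a b c * S x a b c)
            + 3/2 * scalar_curvature g x))"
proof -
  from sys obtain B :: "nat \<Rightarrow> pt \<Rightarrow> real" and C :: "nat \<Rightarrow> pt \<Rightarrow> real^2^2" and W H
    where riem: "riemannian_surface U g"
    and basis: "basis_on U 4 B \<V>" and smV: "\<forall>V\<in>\<V>. smooth_on U V"
    and H: "H = hamiltonian g (W 0)"
    and ci: "\<forall>m<3. conformal_integral U H (C m) (W m)"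
    and tr: "\<forall>x\<in>U. trace (C 1 x ** g x) = 0 \<and> trace (C 2 x ** g x) = 0"
    and irr: "\<forall>x\<in>U. irreducible_endomorphisms {C 1 x ** g x, C 2 x ** g x}"
    and bd: "\<forall>V\<in>\<V>. \<forall>m<3. bertrand_darboux U g (C m) V"
    unfolding nondegenerate_system_def by (elim conjE exE) (rule that; assumption)
  interpret D: riemannian_domain U g by unfold_locales (rule riem)
  define m where "m = D.gram_schmidt"
  interpret null_frame U g m
    unfolding m_def by (rule D.null_frame_gram_schmidt)
  interpret structured_frame U g m \<V> T S \<tau> t
    by unfold_locales (rule str con)+
  \<comment> \<open>Index 0 is the Hamiltonian, whose tensor is the inverse metric and not
    trace-free; the frame analysis concerns the other two integrals.\<close>
  have fk: "framed_killing U g m (C n)" if "n \<in> {1, 2}" for n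
  proof unfold_locales
    have "conformal_integral U H (C n) (W n)" using ci that by auto
    then show "smooth_on U (\<lambda>x. C n x $ i $ j)" "x \<in> U \<Longrightarrow> transpose (C n x) = C n x" for i j x
      by (simp_all add: conformal_integral_def)
    show "trace (C n x ** g x) = 0" if "x \<in> U" for x
      using tr that \<open>n \<in> {1, 2}\<close> by auto
  qed
  \<comment> \<open>The integrals are conformal for the one Hamiltonian with potential
    \<open>W 0\<close>, which yields the Killing equation; the Bertrand-Darboux condition is
    available for every potential in \<open>\<V>\<close>.\<close>
  have fbd: "framed_bd U g m \<V> T S \<tau> t (C n) B" if n: "n \<in> {1, 2}" for n
  proof -
    interpret F: framed_killing U g m "C n" by (rule fk[OF n])
    have "conformal_integral U (hamiltonian g (W 0)) (C n) (W n)" "smooth_on U (W 0)"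
      using ci n by (auto simp: H conformal_integral_def)
    from F.eth_c[OF this] show ?thesis
      by unfold_locales (use basis smV bd n in auto)
  qed
  interpret framed_system U g m \<V> T S \<tau> t "C 1" "C 2" B
    by (intro framed_system.intro fbd framed_system_axioms.intro structured_frame_axioms)
       (use irr in auto)
  have conf: "Xi (conf_metric \<Omega> g) S' t' x i j = Xi g S t x i j"
    if "smooth_on U \<Omega>" "\<forall>x\<in>U. \<Omega> x \<noteq> 0"
      "structure_tensors U (conf_metric \<Omega> g) (conf_potentials U \<Omega> \<V>) T' \<tau>'"
      "conformal_structure U (conf_metric \<Omega> g) T' S' t'" "x \<in> U" for \<Omega> T' \<tau>' S' t' x i j
  proof -
    interpret conformal_change U g m \<V> T S \<tau> t B \<Omega> T' S' \<tau>' t'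
      by unfold_locales (use basis smV that in auto)
    show ?thesis by (rule conf_Xi[OF that(5)])
  qed
  show ?thesis
    unfolding Xi
    by (intro conjI allI ballI impI nabla3_S_structure nabla2_Xi_structure div_tau_structure hess_t_structure;
        (elim conjE)?; (assumption | rule conf; assumption))
qed

end
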